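(* Let $\Omega$ be a bounded domain in $\mathbb{C}^n$, let $\mathcal{E}$ be a Hilbert space and let $g$ be a good kernel on $\Omega$ such that $g^{-1}$ is a polynomial. Let $\mathcal{S}$ be a submodule of $\mathcal{H}_g\otimes\mathcal{E}$. Then $\mathcal{S}$ is a Brehmer submodule of $\mathcal{H}_g\otimes\mathcal{E}$ if and only if there exist a Hilbert space $\mathcal{E}_*$ and a partially isometric multiplier $\Theta\in\mathcal{M}(\mathcal{H}_g\otimes\mathcal{E}_*,\mathcal{H}_g\otimes\mathcal{E})$ such that $$\mathcal{S}=\Theta(\mathcal{H}_g\otimes\mathcal{E}_* ).$$
   Context: All Hilbert spaces are complex. A scalar kernel $g$ on $\Omega$ is a positive semidefinite function $g:\Omega\times\Omega\to\mathbb{C}$, assumed holomorphic in the first variable and anti-holomorphic in the second; $\mathcal{H}_g$ is its reproducing kernel Hilbert space. It is a reproducing kernel Hilbert module if $z_j\mathcal{H}_g\subseteq\mathcal{H}_g$ for $j=1,\dots,n$, and then $M_{z_j}$ is the bounded operator of multiplication by the coordinate $z_j$. $g$ is a good kernel if $\mathcal{H}_g$ is a reproducing kernel Hilbert module, $\bigcap_{j=1}^n\ker(M_{z_j}^*-\bar w_jI_{\mathcal{H}_g})=\mathbb{C}\,g(\cdot,\boldsymbol{w})$ for all $\boldsymbol{w}\in\Omega$, and there exists $\boldsymbol{w}_0\in\Omega$ with $g(\cdot,\boldsymbol{w}_0)\equiv 1$. "$g^{-1}$ is a polynomial" means that $g^{-1}(\boldsymbol{z},\boldsymbol{w})=1/g(\boldsymbol{z},\boldsymbol{w})=\sum_{\boldsymbol{k},\boldsymbol{l}\in\mathbb{N}^n}a_{\boldsymbol{k}\boldsymbol{l}}\boldsymbol{z}^{\boldsymbol{k}}\bar{\boldsymbol{w}}^{\boldsymbol{l}}$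 is a finite sum (multi-indices with nonnegative integer entries). For a commuting tuple $\boldsymbol{T}=(T_1,\dots,T_n)$ of bounded operators, $g^{-1}(\boldsymbol{T},\boldsymbol{T}^* ):=\sum_{\boldsymbol{k},\boldsymbol{l}}a_{\boldsymbol{k}\boldsymbol{l}}\boldsymbol{T}^{\boldsymbol{k}}\boldsymbol{T}^{*\boldsymbol{l}}$. $\mathcal{H}_g\otimes\mathcal{E}$ is identified with the reproducing kernel Hilbert space of $\mathcal{E}$-valued functions on $\Omega$ with kernel $g(\boldsymbol{z},\boldsymbol{w})I_{\mathcal{E}}$. A submodule $\mathcal{S}$ of $\mathcal{H}_g\otimes\mathcal{E}$ is a closed subspace invariant under $M_{z_j}\otimes I_{\mathcal{E}}$, $j=1,\dots,n$; put $R_{z_j}=(M_{z_j}\otimes I_{\mathcal{E}})|_{\mathcal{S}}\in\mathcal{B}(\mathcal{S})$ and $\boldsymbol{R}_z=(R_{z_1},\dots,R_{z_n})$. $\mathcal{S}$ is a Brehmer submodule if $g^{-1}(\boldsymbol{R}_z,\boldsymbol{R}_z^* )=\sum_{\boldsymbol{k},\boldsymbol{l}}a_{\boldsymbol{k}\boldsymbol{l}}\boldsymbol{R}_z^{\boldsymbol{k}}\boldsymbol{R}_z^{*\boldsymbol{l}}\ge 0$ on $\mathcal{S}$ (adjoints taken in $\mathcal{B}(\mathcal{S})$). $\mathcal{M}(\mathcal{H}_g\otimes\mathcal{E}_*,\mathcal{H}_g\otimes\mathcal{E})$ is the set of functions $\Theta:\Omega\to\mathcal{B}(\mathcal{E}_*,\mathcal{E})$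 such that $\Theta f\in\mathcal{H}_g\otimes\mathcal{E}$ for all $f\in\mathcal{H}_g\otimes\mathcal{E}_*$, where $(\Theta f)(\boldsymbol{w})=\Theta(\boldsymbol{w})f(\boldsymbol{w})$; $\Theta$ is partially isometric if the induced bounded operator $M_\Theta:f\mapsto\Theta f$ is a partial isometry. *)

theory Defs
  imports
    "HOL-Analysis.Analysis"
    "HOL-Library.Function_Algebras"
    "HOL-Library.Nonpos_Ints"
begin

section \<open>Complex vector spaces\<close>

class complex_vector = ab_group_add +
  fixes scaleC :: "complex \<Rightarrow> 'a \<Rightarrow> 'a" (infixr "*\<^sub>C" 75)
  assumes scaleC_add_right: "a *\<^sub>C (x + y) = a *\<^sub>C x + a *\<^sub>C y"
    and scaleC_add_left: "(a + b) *\<^sub>C x = a *\<^sub>C x + b *\<^sub>C x"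
    and scaleC_scaleC: "a *\<^sub>C b *\<^sub>C x = (a * b) *\<^sub>C x"
    and scaleC_one: "1 *\<^sub>C x = x"

global_interpretation complex_vector: vector_space "scaleC :: complex \<Rightarrow> 'a \<Rightarrow> 'a::complex_vector"
  by standard (auto simp: scaleC_add_right scaleC_add_left scaleC_scaleC scaleC_one)

instantiation complex :: complex_vector
begin
definition scaleC_complex :: "complex \<Rightarrow> complex \<Rightarrow> complex" where
  "scaleC_complex a x = a * x"
instance
  by standard (auto simp: scaleC_complex_def algebra_simps)
end

instantiation "fun" :: (type, complex_vector) complex_vector
begin
definition scaleC_fun :: "complex \<Rightarrow> ('a \<Rightarrow> 'b) \<Rightarrow> 'a \<Rightarrow> 'b" where
  "scaleC_fun a f = (\<lambda>x. a *\<^sub>C f x)"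
instance
  by standard (auto simp: scaleC_fun_def fun_eq_iff scaleC_add_right scaleC_add_left
      scaleC_scaleC scaleC_one)
end

section \<open>Hilbert spaces and their operators\<close>

text \<open>A Hilbert space is a linear subspace of an ambient complex vector space (given by the type)
  together with an inner product, linear in the first argument. The values of the inner product
  and of operators outside the carrier carry no meaning.\<close>

record 'a ip_space =
  carr :: "'a set"
  ip :: "'a \<Rightarrow> 'a \<Rightarrow> complex"

definition hnorm :: "'a ip_space \<Rightarrow> 'a \<Rightarrow> real" where
  "hnorm H x = sqrt (Re (ip H x x))"

definition inner_product_space :: "'a::complex_vector ip_space \<Rightarrow> bool" where
  "inner_product_space H \<longleftrightarrow>
     complex_vector.subspace (carr H) \<and>
     (\<forall>x\<in>carr H. \<forall>y\<in>carr H. \<forall>z\<in>carr H. ip H (x + y) z = ip H x z + ip H y z) \<and>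
     (\<forall>c. \<forall>x\<in>carr H. \<forall>y\<in>carr H. ip H (c *\<^sub>C x) y = c * ip H x y) \<and>
     (\<forall>x\<in>carr H. \<forall>y\<in>carr H. ip H y x = cnj (ip H x y)) \<and>
     (\<forall>x\<in>carr H. x \<noteq> 0 \<longrightarrow> 0 < Re (ip H x x))"

definition hconverges :: "'a::complex_vector ip_space \<Rightarrow> (nat \<Rightarrow> 'a) \<Rightarrow> 'a \<Rightarrow> bool" where
  "hconverges H s x \<longleftrightarrow> (\<lambda>m. hnorm H (s m - x)) \<longlonglongrightarrow> 0"

definition hCauchy :: "'a::complex_vector ip_space \<Rightarrow> (nat \<Rightarrow> 'a) \<Rightarrow> bool" where
  "hCauchy H s \<longleftrightarrow> (\<forall>e>0. \<exists>N. \<forall>m\<ge>N. \<forall>k\<ge>N. hnorm H (s m - s k) < e)"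

definition hilbert_space :: "'a::complex_vector ip_space \<Rightarrow> bool" where
  "hilbert_space H \<longleftrightarrow>
     inner_product_space H \<and>
     (\<forall>s. range s \<subseteq> carr H \<and> hCauchy H s \<longrightarrow> (\<exists>x\<in>carr H. hconverges H s x))"

definition closed_subspace :: "'a::complex_vector ip_space \<Rightarrow> 'a set \<Rightarrow> bool" where
  "closed_subspace H S \<longleftrightarrow>
     complex_vector.subspace S \<and> S \<subseteq> carr H \<and>
     (\<forall>s x. range s \<subseteq> S \<and> x \<in> carr H \<and> hconverges H s x \<longrightarrow> x \<in> S)"

definition bounded_op ::
  "'a::complex_vector ip_space \<Rightarrow> 'b::complex_vector ip_space \<Rightarrow> ('a \<Rightarrow> 'b) \<Rightarrow> bool" where
  "bounded_op H K T \<longleftrightarrow>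
     T ` carr H \<subseteq> carr K \<and>
     (\<forall>x\<in>carr H. \<forall>y\<in>carr H. T (x + y) = T x + T y) \<and>
     (\<forall>c. \<forall>x\<in>carr H. T (c *\<^sub>C x) = c *\<^sub>C T x) \<and>
     (\<exists>C. \<forall>x\<in>carr H. hnorm K (T x) \<le> C * hnorm H x)"

definition hadjoint :: "'a ip_space \<Rightarrow> 'b ip_space \<Rightarrow> ('a \<Rightarrow> 'b) \<Rightarrow> 'b \<Rightarrow> 'a" where
  "hadjoint H K T y = (THE x. x \<in> carr H \<and> (\<forall>u\<in>carr H. ip K (T u) y = ip H u x))"

definition positive_op :: "'a ip_space \<Rightarrow> ('a \<Rightarrow> 'a) \<Rightarrow> bool" where
  "positive_op H A \<longleftrightarrow> (\<forall>x\<in>carr H. ip H (A x) x \<in> \<real>\<^sub>\<ge>\<^sub>0)"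

definition partial_isometry ::
  "'a::complex_vector ip_space \<Rightarrow> 'b::complex_vector ip_space \<Rightarrow> ('a \<Rightarrow> 'b) \<Rightarrow> bool" where
  "partial_isometry H K T \<longleftrightarrow>
     bounded_op H K T \<and>
     (\<forall>x\<in>carr H. (\<forall>y\<in>carr H. T y = 0 \<longrightarrow> ip H x y = 0) \<longrightarrow> hnorm K (T x) = hnorm H x)"

definition complex_space :: "complex ip_space" where
  "complex_space = \<lparr>carr = UNIV, ip = (\<lambda>x y. x * cnj y)\<rparr>"

section \<open>Multi-indices and polynomials in a tuple and its adjoint\<close>

definition monomial :: "complex^'n \<Rightarrow> nat^'n \<Rightarrow> complex" where
  "monomial z k = (\<Prod>j\<in>UNIV. (z $ j) ^ (k $ j))"

text \<open>The composition follows an arbitrary fixed enumeration of the index type; for commuting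
  tuples the enumeration is irrelevant.\<close>

definition op_monomial :: "('n::finite \<Rightarrow> 'a \<Rightarrow> 'a) \<Rightarrow> nat^'n \<Rightarrow> 'a \<Rightarrow> 'a" where
  "op_monomial T k =
     foldr (\<lambda>j A. (T j ^^ (k $ j)) \<circ> A) (SOME js. distinct js \<and> set js = UNIV) id"

text \<open>Polynomials in \<open>z\<close> and \<open>cnj w\<close> are given by their coefficient functions.\<close>

type_synonym 'n coeffs = "nat^'n \<Rightarrow> nat^'n \<Rightarrow> complex"

definition coeff_support :: "'n::finite coeffs \<Rightarrow> ((nat^'n) \<times> (nat^'n)) set" where
  "coeff_support a = {(k, l). a k l \<noteq> 0}"

definition inverse_is_polynomial ::
  "(complex^'n) set \<Rightarrow> (complex^'n \<Rightarrow> complex^'n \<Rightarrow> complex) \<Rightarrow> 'n::finite coeffs \<Rightarrow> bool" where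
  "inverse_is_polynomial \<Omega> g a \<longleftrightarrow>
     finite (coeff_support a) \<and>
     (\<forall>z\<in>\<Omega>. \<forall>w\<in>\<Omega>. g z w \<noteq> 0 \<and>
        1 / g z w = (\<Sum>(k, l)\<in>coeff_support a. a k l * monomial z k * cnj (monomial w l)))"

text \<open>The operator \<open>\<Sum> a k l T^k T*^l\<close> on \<open>H\<close>.\<close>

definition poly_op ::
  "'n::finite coeffs \<Rightarrow> 'a::complex_vector ip_space \<Rightarrow> ('n \<Rightarrow> 'a \<Rightarrow> 'a) \<Rightarrow> 'a \<Rightarrow> 'a" where
  "poly_op a H T x =
     (\<Sum>(k, l)\<in>coeff_support a.
        a k l *\<^sub>C op_monomial T k (op_monomial (\<lambda>j. hadjoint H H (T j)) l x))"

section \<open>Kernels and reproducing kernel Hilbert spaces\<close>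

definition bounded_domain :: "(complex^'n) set \<Rightarrow> bool" where
  "bounded_domain \<Omega> \<longleftrightarrow> open \<Omega> \<and> connected \<Omega> \<and> \<Omega> \<noteq> {} \<and> bounded \<Omega>"

text \<open>Holomorphy in several variables: the real Frechet derivative exists and is complex linear.\<close>

definition holomorphic_several :: "(complex^'n \<Rightarrow> complex) \<Rightarrow> (complex^'n) set \<Rightarrow> bool" where
  "holomorphic_several f \<Omega> \<longleftrightarrow>
     (\<forall>z\<in>\<Omega>. \<exists>D. (f has_derivative D) (at z) \<and> (\<forall>c v. D (c *s v) = c * D v))"

definition scalar_kernel ::
  "(complex^'n) set \<Rightarrow> (complex^'n \<Rightarrow> complex^'n \<Rightarrow> complex) \<Rightarrow> bool" where
  "scalar_kernel \<Omega> g \<longleftrightarrow>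
     (\<forall>F c. finite F \<and> F \<subseteq> \<Omega> \<longrightarrow> (\<Sum>z\<in>F. \<Sum>w\<in>F. cnj (c z) * c w * g z w) \<in> \<real>\<^sub>\<ge>\<^sub>0) \<and>
     (\<forall>w\<in>\<Omega>. holomorphic_several (\<lambda>z. g z w) \<Omega>) \<and>
     (\<forall>z\<in>\<Omega>. holomorphic_several (\<lambda>w. cnj (g z w)) \<Omega>)"

text \<open>Functions on \<open>\<Omega>\<close> are represented by total functions vanishing off \<open>\<Omega>\<close>.\<close>

definition kernel_fun ::
  "'z set \<Rightarrow> ('z \<Rightarrow> 'z \<Rightarrow> complex) \<Rightarrow> 'z \<Rightarrow> 'e::complex_vector \<Rightarrow> 'z \<Rightarrow> 'e" where
  "kernel_fun \<Omega> g w \<eta> = (\<lambda>z. if z \<in> \<Omega> then g z w *\<^sub>C \<eta> else 0)"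

text \<open>\<open>H\<close> is the Hilbert space of \<open>E\<close>-valued functions on \<open>\<Omega>\<close> with reproducing kernel
  \<open>g(z,w) I\<^sub>E\<close>. Its carrier and the inner product on it are uniquely determined by these
  conditions. For \<open>E = complex_space\<close> this is the scalar space of \<open>g\<close>.\<close>

definition is_rkhs ::
  "'z set \<Rightarrow> ('z \<Rightarrow> 'z \<Rightarrow> complex) \<Rightarrow> 'e::complex_vector ip_space \<Rightarrow> ('z \<Rightarrow> 'e) ip_space \<Rightarrow> bool"
where
  "is_rkhs \<Omega> g E H \<longleftrightarrow>
     hilbert_space H \<and>
     (\<forall>f\<in>carr H. (\<forall>z\<in>\<Omega>. f z \<in> carr E) \<and> (\<forall>z. z \<notin> \<Omega> \<longrightarrow> f z = 0)) \<and>
     (\<forall>w\<in>\<Omega>. \<forall>\<eta>\<in>carr E. kernel_fun \<Omega> g w \<eta> \<in> carr H \<and>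
        (\<forall>f\<in>carr H. ip H f (kernel_fun \<Omega> g w \<eta>) = ip E (f w) \<eta>))"

definition coord_mult :: "'n \<Rightarrow> (complex^'n \<Rightarrow> 'e::complex_vector) \<Rightarrow> complex^'n \<Rightarrow> 'e" where
  "coord_mult j f = (\<lambda>z. (z $ j) *\<^sub>C f z)"

definition good_kernel ::
  "(complex^'n) set \<Rightarrow> (complex^'n \<Rightarrow> complex^'n \<Rightarrow> complex) \<Rightarrow> bool" where
  "good_kernel \<Omega> g \<longleftrightarrow>
     scalar_kernel \<Omega> g \<and>
     (\<exists>H. is_rkhs \<Omega> g complex_space H \<and>
        (\<forall>j. coord_mult j ` carr H \<subseteq> carr H) \<and>
        (\<forall>w\<in>\<Omega>. {f \<in> carr H. \<forall>j. hadjoint H H (coord_mult j) f - cnj (w $ j) *\<^sub>C f = 0}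
                = range (\<lambda>c. c *\<^sub>C kernel_fun \<Omega> g w 1))) \<and>
     (\<exists>w0\<in>\<Omega>. \<forall>z\<in>\<Omega>. g z w0 = 1)"

section \<open>Submodules and multipliers\<close>

definition submodule ::
  "(complex^'n \<Rightarrow> 'e::complex_vector) ip_space \<Rightarrow> (complex^'n \<Rightarrow> 'e) set \<Rightarrow> bool" where
  "submodule H S \<longleftrightarrow> closed_subspace H S \<and> (\<forall>j. coord_mult j ` S \<subseteq> S)"

text \<open>Replacing the carrier of \<open>H\<close> by \<open>S\<close> makes \<open>S\<close> a Hilbert space in its own right, so that the
  adjoints occurring in \<open>poly_op\<close> are those of the restrictions to \<open>S\<close>.\<close>

definition Brehmer_submodule ::
  "'n::finite coeffs \<Rightarrow> (complex^'n \<Rightarrow> 'e::complex_vector) ip_space \<Rightarrow>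
     (complex^'n \<Rightarrow> 'e) set \<Rightarrow> bool" where
  "Brehmer_submodule a H S \<longleftrightarrow>
     submodule H S \<and> positive_op (H\<lparr>carr := S\<rparr>) (poly_op a (H\<lparr>carr := S\<rparr>) coord_mult)"

definition mult_op ::
  "'z set \<Rightarrow> ('z \<Rightarrow> 'f \<Rightarrow> 'e::complex_vector) \<Rightarrow> ('z \<Rightarrow> 'f) \<Rightarrow> 'z \<Rightarrow> 'e" where
  "mult_op \<Omega> \<Theta> f = (\<lambda>w. if w \<in> \<Omega> then \<Theta> w (f w) else 0)"

definition is_multiplier ::
  "'z set \<Rightarrow> 'f::complex_vector ip_space \<Rightarrow> ('z \<Rightarrow> 'f) ip_space \<Rightarrow>
     'e::complex_vector ip_space \<Rightarrow> ('z \<Rightarrow> 'e) ip_space \<Rightarrow> ('z \<Rightarrow> 'f \<Rightarrow> 'e) \<Rightarrow> bool" where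
  "is_multiplier \<Omega> F HF E HE \<Theta> \<longleftrightarrow>
     (\<forall>w\<in>\<Omega>. bounded_op F E (\<Theta> w)) \<and> (\<forall>f\<in>carr HF. mult_op \<Omega> \<Theta> f \<in> carr HE)"

definition partially_isometric_multiplier ::
  "'z set \<Rightarrow> 'f::complex_vector ip_space \<Rightarrow> ('z \<Rightarrow> 'f) ip_space \<Rightarrow>
     'e::complex_vector ip_space \<Rightarrow> ('z \<Rightarrow> 'e) ip_space \<Rightarrow> ('z \<Rightarrow> 'f \<Rightarrow> 'e) \<Rightarrow> bool" where
  "partially_isometric_multiplier \<Omega> F HF E HE \<Theta> \<longleftrightarrow>
     is_multiplier \<Omega> F HF E HE \<Theta> \<and> partial_isometry HF HE (mult_op \<Omega> \<Theta>)"

text \<open>\<open>S\<close> is the image of the space with kernel \<open>g I\<^sub>F\<close> under a partially isometric multiplier, for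
  the given coefficient Hilbert space \<open>F\<close>.\<close>

definition is_multiplier_range ::
  "'z set \<Rightarrow> ('z \<Rightarrow> 'z \<Rightarrow> complex) \<Rightarrow> 'e::complex_vector ip_space \<Rightarrow> ('z \<Rightarrow> 'e) ip_space \<Rightarrow>
     ('z \<Rightarrow> 'e) set \<Rightarrow> 'f::complex_vector ip_space \<Rightarrow> bool" where
  "is_multiplier_range \<Omega> g E HE S F \<longleftrightarrow>
     (\<exists>HF \<Theta>. is_rkhs \<Omega> g F HF \<and> partially_isometric_multiplier \<Omega> F HF E HE \<Theta> \<and>
        S = mult_op \<Omega> \<Theta> ` carr HF)"

end

theory Submission
  imports Defs
begin

text \<open>Let \<open>k w \<eta>\<close> be the projection of the kernel function \<open>g(\<cdot>,w)\<eta>\<close> to \<open>S\<close>. These vectors are total in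
  \<open>S\<close> and are eigenvectors of the adjoints of the restricted coordinate multiplications, so
  \<open>\<Delta> = g\<inverse>(R,R*)\<close> satisfies \<open>(\<Delta> (k w \<eta>)) z = (k w \<eta>) z / g(z,w)\<close>. Hence \<open>S\<close> is a Brehmer submodule
  iff the quotient of the kernel of \<open>S\<close> by \<open>g\<close> is positive semidefinite. If \<open>S\<close> is the range of a
  partially isometric multiplier \<open>\<Theta>\<close>, that quotient is \<open>\<Theta>(z) \<Theta>(w)*\<close>. Conversely, let \<open>F\<close> be the
  reproducing kernel space of the quotient and \<open>\<Theta>(z)\<close> the evaluation at \<open>z\<close>: the functions
  \<open>g(\<cdot>,w) \<Theta>(w)*\<eta>\<close> have the same Gram matrix as the \<open>k w \<eta>\<close>, so the multiplication by \<open>\<Theta>\<close>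
  identifies their closed span with \<open>S\<close>.\<close>

section \<open>Semi-inner product spaces and Hilbert spaces\<close>

text \<open>The definition of a submodule states no norm bound for the coordinate multiplications,
  yet \<open>\<Delta>\<close> is built from their adjoints. On the vectors
  \<open>skernel w \<eta>\<close> the adjoint relation can be written down explicitly, and a uniform
  boundedness argument turns this into continuity on \<open>S\<close>. Continuity of
  \<open>\<Delta>\<close> is in turn what carries positivity from the linear span of these vectors
  to their closure.

  The coefficient space has to be constructed inside a given type, so completions are not taken as
  classes of Cauchy sequences but realized by pointwise limits of functions. This places the space
  of the quotient kernel among the \<open>E\<close>-valued functions. The same construction, with
  values now in \<open>F\<close>, must then yield the space with kernel \<open>g\<close> times the
  identity of \<open>F\<close>. Positivity of that kernel is a Schur product statement:
  \<open>g\<close> is weighted entrywise by the Gram matrix of vectors of \<open>F\<close>.\<close>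

locale semi_ip =
  fixes H :: "'a::complex_vector ip_space"
  assumes subspace_carr: "complex_vector.subspace (carr H)"
    and ip_add_left: "\<lbrakk>x \<in> carr H; y \<in> carr H; z \<in> carr H\<rbrakk> \<Longrightarrow> ip H (x + y) z = ip H x z + ip H y z"
    and ip_scale_left: "\<lbrakk>x \<in> carr H; y \<in> carr H\<rbrakk> \<Longrightarrow> ip H (c *\<^sub>C x) y = c * ip H x y"
    and ip_commute: "\<lbrakk>x \<in> carr H; y \<in> carr H\<rbrakk> \<Longrightarrow> ip H y x = cnj (ip H x y)"
    and ip_nonneg: "x \<in> carr H \<Longrightarrow> 0 \<le> Re (ip H x x)"
begin

lemma carr_zero [simp]: "0 \<in> carr H"
  and carr_add [simp]: "x \<in> carr H \<Longrightarrow> y \<in> carr H \<Longrightarrow> x + y \<in> carr H"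
  and carr_diff [simp]: "x \<in> carr H \<Longrightarrow> y \<in> carr H \<Longrightarrow> x - y \<in> carr H"
  and carr_scale [simp]: "x \<in> carr H \<Longrightarrow> c *\<^sub>C x \<in> carr H"
  and carr_minus [simp]: "x \<in> carr H \<Longrightarrow> - x \<in> carr H"
  and carr_sum [simp]: "(\<And>i. i \<in> A \<Longrightarrow> f i \<in> carr H) \<Longrightarrow> sum f A \<in> carr H"
  using subspace_carr
  by (auto intro: complex_vector.subspace_0 complex_vector.subspace_add complex_vector.subspace_diff
      complex_vector.subspace_scale complex_vector.subspace_neg complex_vector.subspace_sum)

lemma ip_add_right:
  "\<lbrakk>x \<in> carr H; y \<in> carr H; z \<in> carr H\<rbrakk> \<Longrightarrow> ip H z (x + y) = ip H z x + ip H z y"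
  using ip_commute[of "x + y" z] ip_commute[of x z] ip_commute[of y z]
  by (simp add: ip_add_left)

lemma ip_scale_right:
  "\<lbrakk>x \<in> carr H; y \<in> carr H\<rbrakk> \<Longrightarrow> ip H y (c *\<^sub>C x) = cnj c * ip H y x"
  using ip_commute[of "c *\<^sub>C x" y] ip_commute[of x y] by (simp add: ip_scale_left)

lemma ip_minus_left: "\<lbrakk>x \<in> carr H; y \<in> carr H\<rbrakk> \<Longrightarrow> ip H (- x) y = - ip H x y"
  using ip_scale_left[of x y "- 1"] by simp

lemma ip_minus_right: "\<lbrakk>x \<in> carr H; y \<in> carr H\<rbrakk> \<Longrightarrow> ip H y (- x) = - ip H y x"
  using ip_scale_right[of x y "- 1"] by simp

lemma ip_diff_left:
  "\<lbrakk>x \<in> carr H; y \<in> carr H; z \<in> carr H\<rbrakk> \<Longrightarrow> ip H (x - y) z = ip H x z - ip H y z"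
  using ip_add_left[of x "- y" z] ip_minus_left[of y z] by simp

lemma ip_diff_right:
  "\<lbrakk>x \<in> carr H; y \<in> carr H; z \<in> carr H\<rbrakk> \<Longrightarrow> ip H z (x - y) = ip H z x - ip H z y"
  using ip_add_right[of x "- y" z] ip_minus_right[of y z] by simp

lemma ip_zero_left [simp]: "x \<in> carr H \<Longrightarrow> ip H 0 x = 0"
  using ip_scale_left[of 0 x 0] by simp

lemma ip_zero_right [simp]: "x \<in> carr H \<Longrightarrow> ip H x 0 = 0"
  using ip_scale_right[of 0 x 0] by simp

lemma ip_sum_left:
  "\<lbrakk>\<And>i. i \<in> A \<Longrightarrow> f i \<in> carr H; z \<in> carr H\<rbrakk> \<Longrightarrow> ip H (sum f A) z = (\<Sum>i\<in>A. ip H (f i) z)"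
  by (induction A rule: infinite_finite_induct) (auto simp: ip_add_left)

lemma ip_sum_right:
  "\<lbrakk>\<And>i. i \<in> A \<Longrightarrow> f i \<in> carr H; z \<in> carr H\<rbrakk> \<Longrightarrow> ip H z (sum f A) = (\<Sum>i\<in>A. ip H z (f i))"
  by (induction A rule: infinite_finite_induct) (auto simp: ip_add_right)

lemma hnorm_nonneg [simp]: "x \<in> carr H \<Longrightarrow> 0 \<le> hnorm H x"
  by (simp add: hnorm_def ip_nonneg)

lemma hnorm_sq: "x \<in> carr H \<Longrightarrow> (hnorm H x)\<^sup>2 = Re (ip H x x)"
  by (simp add: hnorm_def ip_nonneg)

lemma ip_self: "x \<in> carr H \<Longrightarrow> ip H x x = complex_of_real ((hnorm H x)\<^sup>2)"
  using ip_commute[of x x] by (simp add: hnorm_sq complex_eq_iff)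

lemma hnorm_zero [simp]: "hnorm H 0 = 0"
  by (simp add: hnorm_def)

lemma hnorm_scale: "x \<in> carr H \<Longrightarrow> hnorm H (c *\<^sub>C x) = cmod c * hnorm H x"
proof -
  assume x: "x \<in> carr H"
  have "ip H (c *\<^sub>C x) (c *\<^sub>C x) = (c * cnj c) * complex_of_real ((hnorm H x)\<^sup>2)"
    using x ip_self[OF x] by (simp add: ip_scale_left ip_scale_right)
  also have "\<dots> = complex_of_real ((cmod c * hnorm H x)\<^sup>2)"
    by (simp add: power_mult_distrib flip: complex_norm_square)
  finally have "(hnorm H (c *\<^sub>C x))\<^sup>2 = (cmod c * hnorm H x)\<^sup>2"
    using x by (simp add: hnorm_sq)
  then show ?thesis
    using x by (simp add: power2_eq_iff_nonneg)
qed

lemma hnorm_minus: "x \<in> carr H \<Longrightarrow> hnorm H (- x) = hnorm H x"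
  using hnorm_scale[of x "- 1"] by simp

lemma hnorm_commute: "\<lbrakk>x \<in> carr H; y \<in> carr H\<rbrakk> \<Longrightarrow> hnorm H (x - y) = hnorm H (y - x)"
  using hnorm_minus[of "x - y"] by simp

lemma hnorm_sq_add:
  assumes "x \<in> carr H" "y \<in> carr H"
  shows "(hnorm H (x + y))\<^sup>2 = (hnorm H x)\<^sup>2 + 2 * Re (ip H x y) + (hnorm H y)\<^sup>2"
  using assms ip_commute[of x y] by (simp add: hnorm_sq ip_add_left ip_add_right)

lemma hnorm_sq_diff:
  assumes "x \<in> carr H" "y \<in> carr H"
  shows "(hnorm H (x - y))\<^sup>2 = (hnorm H x)\<^sup>2 - 2 * Re (ip H x y) + (hnorm H y)\<^sup>2"
  using assms ip_commute[of x y] by (simp add: hnorm_sq ip_diff_left ip_diff_right)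

lemma hnorm_parallelogram:
  assumes "x \<in> carr H" "y \<in> carr H"
  shows "(hnorm H (x + y))\<^sup>2 + (hnorm H (x - y))\<^sup>2 = 2 * (hnorm H x)\<^sup>2 + 2 * (hnorm H y)\<^sup>2"
  using assms by (simp add: hnorm_sq_add hnorm_sq_diff)

lemma Cauchy_Schwarz:
  assumes x: "x \<in> carr H" and y: "y \<in> carr H"
  shows "cmod (ip H x y) \<le> hnorm H x * hnorm H y"
proof -
  define p where "p = ip H x y"
  \<comment> \<open>Scaling \<open>y\<close> by \<open>t * p\<close> makes the cross term real,
    namely \<open>t\<close> times the square of \<open>cmod p\<close>, which leaves a quadratic
    inequality valid for every real \<open>t\<close>.\<close>
  have key: "0 \<le> (hnorm H x)\<^sup>2 - 2 * t * (cmod p)\<^sup>2 + t\<^sup>2 * (cmod p)\<^sup>2 * (hnorm H y)\<^sup>2" for t :: real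
  proof -
    let ?c = "complex_of_real t * p"
    have "Re (ip H x (?c *\<^sub>C y)) = t * (cmod p)\<^sup>2"
    proof -
      have "ip H x (?c *\<^sub>C y) = of_real t * (cnj p * p)"
        using x y by (simp add: ip_scale_right p_def)
      also have "\<dots> = of_real (t * (cmod p)\<^sup>2)"
        by (simp add: complex_norm_square mult.commute flip: of_real_power)
      finally show ?thesis by simp
    qed
    moreover have "0 \<le> (hnorm H (x - ?c *\<^sub>C y))\<^sup>2" by simp
    ultimately show ?thesis
      using x y by (simp add: hnorm_sq_diff hnorm_scale norm_mult power_mult_distrib)
  qed
  show ?thesis
  proof (cases "hnorm H y = 0")
    case True
    \<comment> \<open>Without definiteness a vector \<open>y\<close> of norm zero need not vanish.
      The inequality is then linear in \<open>t\<close>, and the chosen \<open>t\<close> turns its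
      right-hand side into \<open>- 1\<close>.\<close>
    have "p = 0"
    proof (rule ccontr)
      assume "p \<noteq> 0"
      then have "(cmod p)\<^sup>2 > 0" by simp
      moreover have "0 \<le> (hnorm H x)\<^sup>2 - 2 * (((hnorm H x)\<^sup>2 + 1) / (2 * (cmod p)\<^sup>2)) * (cmod p)\<^sup>2"
        using key[of "((hnorm H x)\<^sup>2 + 1) / (2 * (cmod p)\<^sup>2)"] True by simp
      ultimately show False by (simp add: field_simps)
    qed
    then show ?thesis using True by (simp add: p_def)
  next
    case False
    then have pos: "hnorm H y > 0" using y hnorm_nonneg[of y] by linarith
    \<comment> \<open>The inverse of the squared norm of \<open>y\<close> is the value of
      \<open>t\<close> that minimizes the quadratic.\<close>
    have "0 \<le> (hnorm H x)\<^sup>2 - (cmod p)\<^sup>2 / (hnorm H y)\<^sup>2"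
      using key[of "1 / (hnorm H y)\<^sup>2"] pos by (simp add: field_simps power2_eq_square)
    then have "(cmod p)\<^sup>2 \<le> (hnorm H x * hnorm H y)\<^sup>2"
      using pos by (simp add: field_simps)
    then show ?thesis
      using x y by (simp add: p_def power2_le_iff_abs_le)
  qed
qed

lemma hnorm_triangle:
  assumes x: "x \<in> carr H" and y: "y \<in> carr H"
  shows "hnorm H (x + y) \<le> hnorm H x + hnorm H y"
proof -
  have "Re (ip H x y) \<le> hnorm H x * hnorm H y"
    using Cauchy_Schwarz[OF x y] complex_Re_le_cmod[of "ip H x y"] by linarith
  then have "(hnorm H (x + y))\<^sup>2 \<le> (hnorm H x + hnorm H y)\<^sup>2"
    using x y by (simp add: hnorm_sq_add power2_sum)
  then show ?thesis
    by (rule power2_le_imp_le) (use x y in simp)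
qed

lemma hnorm_triangle_diff:
  assumes "x \<in> carr H" "y \<in> carr H" "z \<in> carr H"
  shows "hnorm H (x - z) \<le> hnorm H (x - y) + hnorm H (y - z)"
  using hnorm_triangle[of "x - y" "y - z"] assms by simp

lemma hnorm_triangle_ineq_abs:
  assumes "x \<in> carr H" "y \<in> carr H"
  shows "\<bar>hnorm H x - hnorm H y\<bar> \<le> hnorm H (x - y)"
  using hnorm_triangle[of "x - y" y] hnorm_triangle[of "y - x" x] assms hnorm_commute[of x y]
  by simp

section \<open>Norm convergence and continuity of the inner product\<close>

lemma hconvergesI_bound:
  assumes "\<And>n. s n \<in> carr H" "x \<in> carr H" "r \<longlonglongrightarrow> 0" "\<And>n. hnorm H (s n - x) \<le> r n"
  shows "hconverges H s x"
  unfolding hconverges_def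
  by (rule tendsto_sandwich[OF _ _ tendsto_const assms(3)]) (use assms in auto)

lemma hconverges_const [simp]: "hconverges H (\<lambda>_. x) x"
  by (simp add: hconverges_def)

lemma hconverges_hnorm:
  assumes "\<And>n. s n \<in> carr H" "x \<in> carr H" "hconverges H s x"
  shows "(\<lambda>n. hnorm H (s n)) \<longlonglongrightarrow> hnorm H x"
proof -
  have "(\<lambda>n. hnorm H (s n) - hnorm H x) \<longlonglongrightarrow> 0"
    by (rule Lim_null_comparison[OF _ assms(3)[unfolded hconverges_def]])
       (use assms hnorm_triangle_ineq_abs in auto)
  then show ?thesis by (simp add: LIM_zero_iff)
qed

lemma hconverges_ip:
  assumes s: "\<And>n. s n \<in> carr H" "x \<in> carr H" "hconverges H s x"
    and t: "\<And>n. t n \<in> carr H" "y \<in> carr H" "hconverges H t y"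
  shows "(\<lambda>n. ip H (s n) (t n)) \<longlonglongrightarrow> ip H x y"
proof -
  have "(\<lambda>n. hnorm H (s n - x) * hnorm H (t n) + hnorm H x * hnorm H (t n - y)) \<longlonglongrightarrow>
      0 * hnorm H y + hnorm H x * 0"
    by (intro tendsto_intros hconverges_hnorm t)
       (use s t in \<open>auto simp: hconverges_def\<close>)
  then have lim: "(\<lambda>n. hnorm H (s n - x) * hnorm H (t n) + hnorm H x * hnorm H (t n - y)) \<longlonglongrightarrow> 0"
    by simp
  have "cmod (ip H (s n) (t n) - ip H x y)
      \<le> hnorm H (s n - x) * hnorm H (t n) + hnorm H x * hnorm H (t n - y)" for n
  proof -
    have "ip H (s n) (t n) - ip H x y = ip H (s n - x) (t n) + ip H x (t n - y)"
      using s t by (simp add: ip_diff_left ip_diff_right)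
    then show ?thesis
      using norm_triangle_ineq[of "ip H (s n - x) (t n)" "ip H x (t n - y)"]
        Cauchy_Schwarz[of "s n - x" "t n"] Cauchy_Schwarz[of x "t n - y"] s t by simp
  qed
  then have "(\<lambda>n. ip H (s n) (t n) - ip H x y) \<longlonglongrightarrow> 0"
    by (intro Lim_null_comparison[OF _ lim]) auto
  then show ?thesis by (simp add: LIM_zero_iff)
qed

lemma hconverges_add:
  assumes "\<And>n. s n \<in> carr H" "x \<in> carr H" "hconverges H s x"
    and "\<And>n. t n \<in> carr H" "y \<in> carr H" "hconverges H t y"
  shows "hconverges H (\<lambda>n. s n + t n) (x + y)"
proof (rule hconvergesI_bound)
  show "(\<lambda>n. hnorm H (s n - x) + hnorm H (t n - y)) \<longlonglongrightarrow> 0"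
    using tendsto_add[OF assms(3)[unfolded hconverges_def] assms(6)[unfolded hconverges_def]]
    by simp
  fix n
  show "hnorm H (s n + t n - (x + y)) \<le> hnorm H (s n - x) + hnorm H (t n - y)"
    using hnorm_triangle[of "s n - x" "t n - y"] assms by (simp add: algebra_simps)
qed (use assms in auto)

lemma hconverges_scale:
  assumes "\<And>n. s n \<in> carr H" "x \<in> carr H" "hconverges H s x"
  shows "hconverges H (\<lambda>n. c *\<^sub>C s n) (c *\<^sub>C x)"
proof -
  have "hnorm H (c *\<^sub>C s n - c *\<^sub>C x) = cmod c * hnorm H (s n - x)" for n
    using assms hnorm_scale[of "s n - x" c] by (simp add: complex_vector.scale_right_diff_distrib)
  then show ?thesis
    using tendsto_mult_left[OF assms(3)[unfolded hconverges_def], of "cmod c"]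
    by (simp add: hconverges_def)
qed

lemma hCauchyI_hconverges:
  assumes "\<And>n. s n \<in> carr H" "x \<in> carr H" "hconverges H s x"
  shows "hCauchy H s"
  unfolding hCauchy_def
proof (intro allI impI)
  fix e :: real
  assume "e > 0"
  then obtain N where N: "\<And>n. n \<ge> N \<Longrightarrow> \<bar>hnorm H (s n - x)\<bar> < e / 2"
    using assms(3)[unfolded hconverges_def LIMSEQ_iff, rule_format, of "e / 2"] by auto
  show "\<exists>N. \<forall>m\<ge>N. \<forall>k\<ge>N. hnorm H (s m - s k) < e"
  proof (intro exI allI impI)
    fix m k assume "m \<ge> N" "k \<ge> N"
    then show "hnorm H (s m - s k) < e"
      using hnorm_triangle_diff[of "s m" x "s k"] N[of m] N[of k] assms hnorm_commute[of x "s k"]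
      by (simp add: abs_less_iff)
  qed
qed

end

section \<open>Hilbert spaces: projections and the Riesz representation\<close>

lemma semi_ip_inner_product_space:
  assumes "inner_product_space H"
  shows "semi_ip H"
proof -
  note * = assms[unfolded inner_product_space_def]
  note scale = *[THEN conjunct2, THEN conjunct2, THEN conjunct1, rule_format]
    and pos = *[THEN conjunct2, THEN conjunct2, THEN conjunct2, THEN conjunct2, rule_format]
  have sub: "complex_vector.subspace (carr H)" using * by (rule conjunct1)
  have "0 \<in> carr H" using sub by (rule complex_vector.subspace_0)
  then have 0: "ip H 0 0 = 0" using scale[of 0 0 0] by simp
  show ?thesis
  proof
    show "0 \<le> Re (ip H x x)" if "x \<in> carr H" for x
      using pos[OF that] 0 by (cases "x = 0") auto
  qed (fact sub scale *[THEN conjunct2, THEN conjunct1, rule_format]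
      *[THEN conjunct2, THEN conjunct2, THEN conjunct2, THEN conjunct1, rule_format])+
qed

text \<open>Definiteness and completeness are kept apart from \<open>semi_ip\<close> because the
  later space of formal kernel sums can contain nonzero vectors of norm zero and is not complete in
  general.\<close>

locale hilbert = semi_ip H for H :: "'a::complex_vector ip_space" +
  assumes hilbert_space: "hilbert_space H"
begin

lemma ip_eq_0_iff: "x \<in> carr H \<Longrightarrow> Re (ip H x x) = 0 \<longleftrightarrow> x = 0"
proof -
  assume x: "x \<in> carr H"
  have "inner_product_space H" using hilbert_space unfolding hilbert_space_def by (rule conjunct1)
  then have "x \<noteq> 0 \<longrightarrow> 0 < Re (ip H x x)"
    unfolding inner_product_space_def using x by (elim conjE) (erule bspec)
  then show ?thesis using ip_zero_left[of 0] by auto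
qed

lemma hnorm_eq_0_iff: "x \<in> carr H \<Longrightarrow> hnorm H x = 0 \<longleftrightarrow> x = 0"
  using ip_eq_0_iff[of x] by (auto simp: hnorm_def)

lemma complete:
  assumes "\<And>n. s n \<in> carr H" "hCauchy H s"
  obtains x where "x \<in> carr H" "hconverges H s x"
  using assms hilbert_space unfolding hilbert_space_def by blast

lemma eqI_ip:
  assumes "x \<in> carr H" "y \<in> carr H" "\<And>z. z \<in> carr H \<Longrightarrow> ip H x z = ip H y z"
  shows "x = y"
  using ip_eq_0_iff[of "x - y"] assms by (simp add: ip_diff_left)

lemma hconverges_unique:
  assumes "\<And>n. s n \<in> carr H" "x \<in> carr H" "hconverges H s x" "y \<in> carr H" "hconverges H s y"
  shows "x = y"
proof (rule eqI_ip)
  fix z assume "z \<in> carr H"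
  then have "(\<lambda>n. ip H (s n) z) \<longlonglongrightarrow> ip H x z" "(\<lambda>n. ip H (s n) z) \<longlonglongrightarrow> ip H y z"
    using assms by (auto intro!: hconverges_ip)
  then show "ip H x z = ip H y z" by (rule LIMSEQ_unique)
qed (use assms in auto)

text \<open>The subspace need not be closed: the projection is the limit of a minimizing sequence.\<close>

lemma projection_exists:
  assumes M: "complex_vector.subspace M" "M \<subseteq> carr H" and x: "x \<in> carr H"
  obtains p s where "p \<in> carr H" "\<And>n. s n \<in> M" "hconverges H s p"
    "\<And>m. m \<in> M \<Longrightarrow> ip H (x - p) m = 0"
proof -
  define d where "d = Inf ((\<lambda>m. (hnorm H (x - m))\<^sup>2) ` M)"
  have M0: "0 \<in> M" using M(1) by (rule complex_vector.subspace_0)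
  have bdd: "bdd_below ((\<lambda>m. (hnorm H (x - m))\<^sup>2) ` M)" by (rule bdd_belowI[of _ 0]) auto
  have d_le: "d \<le> (hnorm H (x - m))\<^sup>2" if "m \<in> M" for m
    unfolding d_def by (rule cInf_lower[OF _ bdd]) (use that in auto)
  have "\<exists>m\<in>M. (hnorm H (x - m))\<^sup>2 < d + 1 / real (Suc n)" for n
  proof -
    have "d < d + 1 / real (Suc n)" by simp
    then show ?thesis
      unfolding d_def using M0 by (subst (asm) cInf_less_iff[OF _ bdd]) auto
  qed
  then obtain s where s: "\<And>n. s n \<in> M" "\<And>n. (hnorm H (x - s n))\<^sup>2 < d + 1 / real (Suc n)"
    by metis
  have sH: "s n \<in> carr H" for n using s(1) M(2) by auto
  have half: "(1/2) *\<^sub>C (a + b) \<in> M" if "a \<in> M" "b \<in> M" for a b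
    using that M(1) by (simp add: complex_vector.subspace_add complex_vector.subspace_scale)
  \<comment> \<open>Parallelogram law for \<open>x - s m\<close> and \<open>x - s k\<close>: the
    midpoint of \<open>s m\<close> and \<open>s k\<close> lies in \<open>M\<close>, so its squared
    distance from \<open>x\<close> is at least \<open>d\<close>, which leaves little room for
    \<open>s m - s k\<close>.\<close>
  have close: "(hnorm H (s m - s k))\<^sup>2 \<le> 2 / real (Suc m) + 2 / real (Suc k)" for m k
  proof -
    let ?h = "(1/2) *\<^sub>C (s m + s k)"
    have h: "?h \<in> M" using half s(1) by blast
    then have hH: "?h \<in> carr H" using M(2) by auto
    have e: "(x - s m) + (x - s k) = 2 *\<^sub>C (x - ?h)"
    proof -
      have "2 *\<^sub>C x = x + x" using scaleC_add_left[of 1 1 x] by (simp add: scaleC_one)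
      then show ?thesis
        by (simp add: complex_vector.scale_right_diff_distrib scaleC_one)
    qed
    have "(hnorm H ((x - s m) + (x - s k)))\<^sup>2 + (hnorm H ((x - s m) - (x - s k)))\<^sup>2
        = 2 * (hnorm H (x - s m))\<^sup>2 + 2 * (hnorm H (x - s k))\<^sup>2"
      using x sH by (intro hnorm_parallelogram) auto
    moreover have "(hnorm H ((x - s m) + (x - s k)))\<^sup>2 = 4 * (hnorm H (x - ?h))\<^sup>2"
      unfolding e using x hH by (subst hnorm_scale) (auto simp: power_mult_distrib)
    moreover have "hnorm H ((x - s m) - (x - s k)) = hnorm H (s m - s k)"
      using sH hnorm_commute[of "s k" "s m"] by simp
    ultimately show ?thesis
      using s(2)[of m] s(2)[of k] d_le[OF h] by simp
  qed
  have "hCauchy H s"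
    unfolding hCauchy_def
  proof (intro allI impI)
    fix e :: real assume e: "e > 0"
    obtain N where N: "4 / e\<^sup>2 < real N" using reals_Archimedean2 by blast
    show "\<exists>N. \<forall>m\<ge>N. \<forall>k\<ge>N. hnorm H (s m - s k) < e"
    proof (intro exI allI impI)
      fix m k assume mk: "m \<ge> N" "k \<ge> N"
      have "2 / real (Suc m) < e\<^sup>2 / 2" if "m \<ge> N" for m
      proof -
        have "4 / e\<^sup>2 < real (Suc m)" using N that by linarith
        then show ?thesis using e by (simp add: field_simps)
      qed
      from this[OF mk(1)] this[OF mk(2)] have "(hnorm H (s m - s k))\<^sup>2 < e\<^sup>2"
        using close[of m k] by linarith
      then show "hnorm H (s m - s k) < e" using e by (simp add: power2_less_imp_less)
    qed
  qed
  then obtain p where p: "p \<in> carr H" "hconverges H s p" using complete sH by blast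
  have dp: "(hnorm H (x - p))\<^sup>2 = d"
  proof (rule LIMSEQ_unique)
    have "hconverges H (\<lambda>n. x - s n) (x - p)"
      using p(2) hnorm_commute[OF sH p(1)] by (simp add: hconverges_def)
    then show "(\<lambda>n. (hnorm H (x - s n))\<^sup>2) \<longlonglongrightarrow> (hnorm H (x - p))\<^sup>2"
      using x sH p by (intro tendsto_power hconverges_hnorm) auto
    have u: "(\<lambda>n. d + 1 / real (Suc n)) \<longlonglongrightarrow> d"
      using tendsto_add[OF tendsto_const[of d] LIMSEQ_Suc[OF lim_1_over_n]] by simp
    show "(\<lambda>n. (hnorm H (x - s n))\<^sup>2) \<longlonglongrightarrow> d"
      by (rule tendsto_sandwich[OF _ _ tendsto_const u])
         (use d_le s in \<open>auto intro!: always_eventually less_imp_le\<close>)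
  qed
  \<comment> \<open>The limit \<open>p\<close> may lie outside \<open>M\<close>, so minimality at
    \<open>p + m\<close> has to be inherited from the points \<open>s n + m\<close> of
    \<open>M\<close>.\<close>
  have minp: "d \<le> (hnorm H (x - p - m))\<^sup>2" if m: "m \<in> M" for m
  proof (rule LIMSEQ_le_const)
    have mH: "m \<in> carr H" using m M(2) by auto
    have "hconverges H (\<lambda>n. x - s n - m) (x - p - m)"
      using p(2) hnorm_commute[OF sH p(1)] by (simp add: hconverges_def)
    then show "(\<lambda>n. (hnorm H (x - s n - m))\<^sup>2) \<longlonglongrightarrow> (hnorm H (x - p - m))\<^sup>2"
      using x sH p mH by (intro tendsto_power hconverges_hnorm) auto
    have "d \<le> (hnorm H (x - s n - m))\<^sup>2" for n
      using d_le[of "s n + m"] complex_vector.subspace_add[OF M(1) s(1) m] by (simp add: algebra_simps)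
    then show "\<exists>N. \<forall>n\<ge>N. d \<le> (hnorm H (x - s n - m))\<^sup>2" by blast
  qed
  have "ip H (x - p) m = 0" if m: "m \<in> M" for m
  proof (rule ccontr)
    assume nz: "ip H (x - p) m \<noteq> 0"
    define q where "q = ip H (x - p) m"
    \<comment> \<open>Moving from \<open>p\<close> by \<open>t * q\<close> times \<open>m\<close>
      changes the squared distance by \<open>t\<close> times the square of \<open>cmod q\<close>
      times (\<open>t\<close> times the squared norm of \<open>m\<close>, minus 2). This
      \<open>t\<close> makes the bracket negative; the added 1 covers an \<open>m\<close> of norm
      zero.\<close>
    define t where "t = 1 / ((hnorm H m)\<^sup>2 + 1)"
    let ?c = "complex_of_real t * q"
    have mH: "m \<in> carr H" using m M(2) by auto
    have tpos: "t > 0" unfolding t_def by (simp add: add_nonneg_pos)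
    have cm: "?c *\<^sub>C m \<in> M" using M(1) m by (rule complex_vector.subspace_scale)
    have "Re (ip H (x - p) (?c *\<^sub>C m)) = t * (cmod q)\<^sup>2"
    proof -
      have "ip H (x - p) (?c *\<^sub>C m) = of_real t * (cnj q * q)"
        using x p mH by (simp add: ip_scale_right q_def)
      also have "\<dots> = of_real (t * (cmod q)\<^sup>2)"
        by (simp add: complex_norm_square mult.commute flip: of_real_power)
      finally show ?thesis by simp
    qed
    then have "(hnorm H (x - p - ?c *\<^sub>C m))\<^sup>2
        = d - 2 * t * (cmod q)\<^sup>2 + t\<^sup>2 * (cmod q)\<^sup>2 * (hnorm H m)\<^sup>2"
      using x p mH by (subst hnorm_sq_diff)
        (auto simp: dp hnorm_scale norm_mult power_mult_distrib)
    then have "0 \<le> t * (cmod q)\<^sup>2 * (t * (hnorm H m)\<^sup>2 - 2)"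
      using minp[OF cm] by (simp add: algebra_simps power2_eq_square)
    moreover have "t * (hnorm H m)\<^sup>2 < 2"
      unfolding t_def by (smt (verit) divide_le_eq_1 mult_cancel_right1 times_divide_eq_left zero_le_power2)
    moreover have "t * (cmod q)\<^sup>2 > 0" using tpos nz by (simp add: q_def)
    ultimately show False by (simp add: zero_le_mult_iff)
  qed
  then show thesis using that p s(1) by blast
qed

text \<open>A subspace with trivial orthogonal complement is dense: the remainder of the projection
  vanishes, and the projection is already a limit of elements of \<open>M\<close>.\<close>

lemma dense_sequence:
  assumes M: "complex_vector.subspace M" "M \<subseteq> carr H" and x: "x \<in> carr H"
    and total: "\<And>y. y \<in> carr H \<Longrightarrow> (\<And>m. m \<in> M \<Longrightarrow> ip H y m = 0) \<Longrightarrow> y = 0"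
  obtains s where "\<And>n. s n \<in> M" "hconverges H s x"
proof -
  obtain p s where ps: "p \<in> carr H" "\<And>n. s n \<in> M" "hconverges H s p"
    "\<And>m. m \<in> M \<Longrightarrow> ip H (x - p) m = 0"
    using projection_exists[OF M x] by blast
  have "x - p = 0" using ps x by (intro total) auto
  then have "x = p" by simp
  then show thesis using that ps(2,3) by blast
qed

lemma closed_projection_exists:
  assumes S: "closed_subspace H S" and x: "x \<in> carr H"
  obtains p where "p \<in> S" "\<And>m. m \<in> S \<Longrightarrow> ip H (x - p) m = 0"
proof -
  have *: "complex_vector.subspace S" "S \<subseteq> carr H"
    "\<And>s x. range s \<subseteq> S \<Longrightarrow> x \<in> carr H \<Longrightarrow> hconverges H s x \<Longrightarrow> x \<in> S"
    using S unfolding closed_subspace_def by auto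
  obtain p s where "p \<in> carr H" "\<And>n. s n \<in> S" "hconverges H s p"
    "\<And>m. m \<in> S \<Longrightarrow> ip H (x - p) m = 0"
    using projection_exists[OF *(1,2) x] by blast
  then show thesis using that *(3)[of s p] by blast
qed

lemma Riesz_representation:
  fixes \<phi> :: "'a \<Rightarrow> complex"
  assumes add: "\<And>x y. x \<in> carr H \<Longrightarrow> y \<in> carr H \<Longrightarrow> \<phi> (x + y) = \<phi> x + \<phi> y"
    and scale: "\<And>c x. x \<in> carr H \<Longrightarrow> \<phi> (c *\<^sub>C x) = c * \<phi> x"
    and bound: "\<And>x. x \<in> carr H \<Longrightarrow> cmod (\<phi> x) \<le> C * hnorm H x"
  obtains y where "y \<in> carr H" "\<And>x. x \<in> carr H \<Longrightarrow> \<phi> x = ip H x y"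
proof (cases "\<forall>x\<in>carr H. \<phi> x = 0")
  case True
  then show thesis using that[of 0] by simp
next
  case False
  then obtain u where u: "u \<in> carr H" "\<phi> u \<noteq> 0" by blast
  have diff: "\<phi> (x - y) = \<phi> x - \<phi> y" if "x \<in> carr H" "y \<in> carr H" for x y
    using add[of x "(- 1) *\<^sub>C y"] scale[of y "- 1"] that by simp
  define N where "N = {x \<in> carr H. \<phi> x = 0}"
  have N: "closed_subspace H N"
    unfolding closed_subspace_def
  proof (intro conjI allI impI)
    show "complex_vector.subspace N"
      using add scale scale[of 0 0] by (auto simp: complex_vector.subspace_def N_def)
    fix s x assume a: "range s \<subseteq> N \<and> x \<in> carr H \<and> hconverges H s x"
    then have s: "s n \<in> carr H" "\<phi> (s n) = 0" for n unfolding N_def by auto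
    have "(\<lambda>n. C * hnorm H (s n - x)) \<longlonglongrightarrow> C * 0"
      using a unfolding hconverges_def by (intro tendsto_intros) auto
    moreover have "cmod (\<phi> x) \<le> C * hnorm H (s n - x)" for n
      using bound[of "s n - x"] diff[of "s n" x] s a by simp
    ultimately have "cmod (\<phi> x) \<le> C * 0" by (intro LIMSEQ_le_const) auto
    then show "x \<in> N" using a by (simp add: N_def)
  qed (auto simp: N_def)
  obtain p where p: "p \<in> N" "\<And>m. m \<in> N \<Longrightarrow> ip H (u - p) m = 0"
    using closed_projection_exists[OF N u(1)] by blast
  define v where "v = u - p"
  have v: "v \<in> carr H" "\<phi> v = \<phi> u" using p(1) u diff by (auto simp: v_def N_def)
  have v0: "ip H v v \<noteq> 0"
    using ip_eq_0_iff[of v] v u diff[of 0 0] by auto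
  show thesis
  proof (rule that)
    \<comment> \<open>Up to scaling the representing vector must be \<open>v\<close>, which is
      orthogonal to the kernel of \<open>\<phi>\<close>; evaluating at \<open>v\<close> forces the
      scalar.\<close>
    show "(cnj (\<phi> v / ip H v v)) *\<^sub>C v \<in> carr H" using v by simp
    fix x assume x: "x \<in> carr H"
    have n: "x - (\<phi> x / \<phi> v) *\<^sub>C v \<in> N" using x v u by (simp add: N_def diff scale)
    then have nH: "x - (\<phi> x / \<phi> v) *\<^sub>C v \<in> carr H" by (simp add: N_def)
    have "ip H (x - (\<phi> x / \<phi> v) *\<^sub>C v) v = 0"
      using p(2)[OF n] ip_commute[OF nH v(1)] ip_commute[OF v(1) nH] by (simp add: v_def)
    then have "ip H x v = (\<phi> x / \<phi> v) * ip H v v"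
      using x v by (simp add: ip_diff_left ip_scale_left)
    then show "\<phi> x = ip H x ((cnj (\<phi> v / ip H v v)) *\<^sub>C v)"
      using x v u v0 by (simp add: ip_scale_right field_simps)
  qed
qed

end

lemma hilbertI: "hilbert_space H \<Longrightarrow> hilbert H"
  by (simp add: hilbert.intro hilbert_axioms_def hilbert_space_def semi_ip_inner_product_space)

text \<open>Cancels one factor from a bound on the square of a norm without a separate case for norm
  zero.\<close>

lemma le_if_mult_self_le: "a * a \<le> a * b \<Longrightarrow> 0 \<le> b \<Longrightarrow> a \<le> b" for a b :: real
  by (metis mult_le_cancel_left_pos not_le order_trans less_imp_le)

section \<open>Uniform boundedness of weakly bounded sets\<close>

context semi_ip begin

lemma hCauchyI_bound:
  assumes s: "\<And>n. s n \<in> carr H" and r: "r \<longlonglongrightarrow> 0"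
    and le: "\<And>n m. hnorm H (s (n + m) - s n) \<le> r n"
  shows "hCauchy H s"
  unfolding hCauchy_def
proof (intro allI impI)
  fix e :: real
  assume "e > 0"
  then obtain N where N: "\<bar>r N\<bar> < e / 2"
    using r[unfolded LIMSEQ_iff, rule_format, of "e / 2"] by auto
  show "\<exists>N. \<forall>m\<ge>N. \<forall>k\<ge>N. hnorm H (s m - s k) < e"
  proof (intro exI allI impI)
    fix m k assume "m \<ge> N" "k \<ge> N"
    then have "hnorm H (s m - s N) \<le> r N" "hnorm H (s k - s N) \<le> r N"
      using le[of N "m - N"] le[of N "k - N"] by auto
    then show "hnorm H (s m - s k) < e"
      using hnorm_triangle_diff[of "s m" "s N" "s k"] N s hnorm_commute[of "s N" "s k"] by simp
  qed
qed

end

context hilbert begin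

text \<open>Sokal's gliding hump argument.\<close>

lemma uniform_boundedness:
  assumes B: "B \<subseteq> carr H" and bdd: "\<And>x. x \<in> carr H \<Longrightarrow> \<exists>c. \<forall>b\<in>B. cmod (ip H x b) \<le> c"
  shows "\<exists>C. \<forall>b\<in>B. hnorm H b \<le> C"
proof (rule ccontr)
  assume "\<not> ?thesis"
  \<comment> \<open>The growth \<open>4 ^ n\<close> is chosen to beat the step lengths
    \<open>(1/3)^n\<close> used below: their product is unbounded, while the steps remain
    summable.\<close>
  then have "\<exists>b\<in>B. hnorm H b > 4 ^ n" for n by (meson not_le)
  then obtain b where b: "\<And>n. b n \<in> B" "\<And>n. hnorm H (b n) > 4 ^ n" by metis
  have bH: "b n \<in> carr H" for n using b B by auto
  have bpos: "hnorm H (b n) > 0" for n using b(2)[of n] by (rule less_trans[rotated]) simp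
  \<comment> \<open>With \<open>u\<close> along \<open>b n\<close>, the inner products of
    \<open>x + u\<close> and \<open>x - u\<close> with \<open>b n\<close> differ by twice that of
    \<open>u\<close>, so at least one of them is as large as required.\<close>
  have "\<exists>x'. x' \<in> carr H \<and> hnorm H (x' - x) \<le> (1/3)^n \<and> cmod (ip H x' (b n)) \<ge> (1/3)^n * hnorm H (b n)"
    if x: "x \<in> carr H" for x n
  proof -
    define u where "u = complex_of_real ((1/3)^n / hnorm H (b n)) *\<^sub>C b n"
    have u: "u \<in> carr H" "hnorm H u = (1/3)^n"
      using bH bpos[of n] by (auto simp: u_def hnorm_scale norm_divide norm_power)
    have "ip H u (b n) = complex_of_real ((1/3)^n * hnorm H (b n))"
      using bpos[of n] bH by (simp add: u_def ip_scale_left ip_self power2_eq_square)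
    then have n: "cmod (ip H u (b n)) = (1/3)^n * hnorm H (b n)"
      using bpos[of n] by (simp add: norm_mult norm_power norm_divide)
    have "2 * ip H u (b n) = ip H (x + u) (b n) - ip H (x - u) (b n)"
      using x u bH by (simp add: ip_add_left ip_diff_left)
    then have "2 * cmod (ip H u (b n)) \<le> cmod (ip H (x + u) (b n)) + cmod (ip H (x - u) (b n))"
      by (metis norm_mult norm_numeral norm_triangle_ineq4)
    then have "cmod (ip H (x + u) (b n)) \<ge> (1/3)^n * hnorm H (b n) \<or>
        cmod (ip H (x - u) (b n)) \<ge> (1/3)^n * hnorm H (b n)"
      using n by linarith
    moreover have "hnorm H (x - u - x) = (1/3)^n" using u hnorm_minus[of u] by simp
    ultimately show ?thesis
      using x u by (auto intro: exI[of _ "x + u"] exI[of _ "x - u"])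
  qed
  then obtain pick where pick: "\<And>x n. x \<in> carr H \<Longrightarrow> pick x n \<in> carr H"
    "\<And>x n. x \<in> carr H \<Longrightarrow> hnorm H (pick x n - x) \<le> (1/3)^n"
    "\<And>x n. x \<in> carr H \<Longrightarrow> cmod (ip H (pick x n) (b n)) \<ge> (1/3)^n * hnorm H (b n)"
    by metis
  define s where "s = rec_nat 0 (\<lambda>n x. pick x n)"
  have s_Suc: "s (Suc n) = pick (s n) n" for n by (simp add: s_def)
  have sH: "s n \<in> carr H" for n
    by (induction n) (auto simp: s_Suc pick, simp add: s_def)
  \<comment> \<open>Partial sums of the geometric series; \<open>3/2\<close> is the sum of all
    powers of \<open>1/3\<close>.\<close>
  have tail: "hnorm H (s (n + m) - s n) \<le> (3/2) * (1/3)^n * (1 - (1/3)^m)" for n m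
  proof (induction m)
    case (Suc m)
    have "hnorm H (s (n + Suc m) - s n) \<le> hnorm H (s (Suc (n + m)) - s (n + m)) + hnorm H (s (n + m) - s n)"
      using hnorm_triangle_diff[of "s (n + Suc m)" "s (n + m)" "s n"] sH by simp
    also have "\<dots> \<le> (1/3)^(n + m) + (3/2) * (1/3)^n * (1 - (1/3)^m)"
      using Suc pick(2)[OF sH, of "n + m" "n + m"] by (simp add: s_Suc)
    also have "\<dots> = (3/2) * (1/3)^n * (1 - (1/3)^(Suc m))"
      by (simp add: power_add field_simps)
    finally show ?case .
  qed simp
  have tail': "hnorm H (s (n + m) - s n) \<le> (3/2) * (1/3)^n" for n m
  proof -
    have "(3/2) * (1/3::real)^n * (1 - (1/3)^m) \<le> (3/2) * (1/3)^n * 1" by (intro mult_left_mono) auto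
    then show ?thesis using tail[of n m] by linarith
  qed
  have r0: "(\<lambda>n. (3/2) * (1/3::real)^n) \<longlonglongrightarrow> 0"
    using tendsto_mult_left[OF LIMSEQ_power_zero[of "1/3::real"], of "3/2"] by simp
  have "hCauchy H s"
    by (rule hCauchyI_bound[OF sH r0 tail'])
  then obtain x where x: "x \<in> carr H" "hconverges H s x" using complete sH by blast
  have xs: "hnorm H (x - s n) \<le> (3/2) * (1/3)^n" for n
  proof (rule LIMSEQ_le_const2)
    have "hconverges H (\<lambda>m. s (m + n)) x"
      using LIMSEQ_ignore_initial_segment[OF x(2)[unfolded hconverges_def], of n]
      by (simp add: hconverges_def)
    then have "hconverges H (\<lambda>m. s (m + n) - s n) (x - s n)" by (simp add: hconverges_def)
    then show "(\<lambda>m. hnorm H (s (m + n) - s n)) \<longlonglongrightarrow> hnorm H (x - s n)"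
      using x sH by (intro hconverges_hnorm) auto
    show "\<exists>N. \<forall>m\<ge>N. hnorm H (s (m + n) - s n) \<le> (3/2) * (1/3)^n"
      using tail'[of n] by (auto simp: add.commute)
  qed
  obtain c where c: "\<And>y. y \<in> B \<Longrightarrow> cmod (ip H x y) \<le> c" using bdd x by blast
  \<comment> \<open>After step \<open>n\<close> the limit is at most
    \<open>(3/2) * (1/3)^(Suc n)\<close> away, which is half the length of that step. Half of the
    inner product gained with \<open>b n\<close> therefore survives in \<open>x\<close>, and it must
    stay below \<open>c\<close>.\<close>
  have "(4/3)^n \<le> 2 * c" for n
  proof -
    have "cmod (ip H (s (Suc n)) (b n)) \<le> cmod (ip H x (b n)) + cmod (ip H (x - s (Suc n)) (b n))"
      using sH bH x norm_triangle_ineq4[of "ip H x (b n)" "ip H (x - s (Suc n)) (b n)"]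
      by (simp add: ip_diff_left)
    also have "\<dots> \<le> c + hnorm H (x - s (Suc n)) * hnorm H (b n)"
      using c[OF b(1)] Cauchy_Schwarz[of "x - s (Suc n)" "b n"] sH bH x by (intro add_mono) auto
    also have "\<dots> \<le> c + (3/2) * (1/3)^(Suc n) * hnorm H (b n)"
      using xs[of "Suc n"] bpos[of n] by (intro add_left_mono mult_right_mono) auto
    finally have "(1/3)^n * hnorm H (b n) \<le> 2 * c"
      using pick(3)[OF sH, of n n] by (simp add: s_Suc)
    moreover have "(1/3)^n * 4^n \<le> (1/3)^n * hnorm H (b n)"
      using b(2)[of n] by (intro mult_left_mono) auto
    ultimately show ?thesis by (simp add: power_divide)
  qed
  moreover obtain n where "2 * c < (4/3)^n" using real_arch_pow[of "4/3" "2 * c"] by auto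
  ultimately show False by (meson not_le)
qed

end

section \<open>Bounded operators\<close>

text \<open>The defining identity has at most one solution because \<open>H\<close> is definite, so
  an adjoint can be computed by exhibiting a candidate.\<close>

lemma hadjoint_eqI:
  assumes "hilbert H" "x \<in> carr H" "\<And>u. u \<in> carr H \<Longrightarrow> ip K (T u) y = ip H u x"
  shows "hadjoint H K T y = x"
proof -
  interpret H: hilbert H by fact
  show ?thesis
    unfolding hadjoint_def
  proof (rule the_equality)
    fix x' assume x': "x' \<in> carr H \<and> (\<forall>u\<in>carr H. ip K (T u) y = ip H u x')"
    show "x' = x"
    proof (rule H.eqI_ip)
      fix z assume "z \<in> carr H"
      then show "ip H x' z = ip H x z"
        using x' assms H.ip_commute[of z x'] H.ip_commute[of z x] by metis
    qed (use x' assms in auto)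
  qed (use assms in auto)
qed

locale bounded_semi_ip_op = H: semi_ip H + K: semi_ip K
  for H :: "'a::complex_vector ip_space" and K :: "'b::complex_vector ip_space" and T :: "'a \<Rightarrow> 'b" +
  assumes bounded_op: "bounded_op H K T"
begin

lemma maps [simp]: "x \<in> carr H \<Longrightarrow> T x \<in> carr K"
  and add: "x \<in> carr H \<Longrightarrow> y \<in> carr H \<Longrightarrow> T (x + y) = T x + T y"
  and scale: "x \<in> carr H \<Longrightarrow> T (c *\<^sub>C x) = c *\<^sub>C T x"
  using bounded_op unfolding bounded_op_def by (simp_all add: image_subset_iff)

lemma zero [simp]: "T 0 = 0"
  using scale[of 0 0] by simp

lemma diff: "x \<in> carr H \<Longrightarrow> y \<in> carr H \<Longrightarrow> T (x - y) = T x - T y"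
  using add[of x "(- 1) *\<^sub>C y"] scale[of y "- 1"] by simp

lemma sum: "(\<And>i. i \<in> A \<Longrightarrow> f i \<in> carr H) \<Longrightarrow> T (\<Sum>i\<in>A. f i) = (\<Sum>i\<in>A. T (f i))"
  by (induction A rule: infinite_finite_induct) (auto simp: add)

lemma bound: obtains C where "C \<ge> 0" "\<And>x. x \<in> carr H \<Longrightarrow> hnorm K (T x) \<le> C * hnorm H x"
proof -
  obtain C where C: "\<And>x. x \<in> carr H \<Longrightarrow> hnorm K (T x) \<le> C * hnorm H x"
    using bounded_op unfolding bounded_op_def by (elim conjE exE) (rule that, erule bspec)
  have "hnorm K (T x) \<le> max C 0 * hnorm H x" if "x \<in> carr H" for x
    using C[OF that] mult_right_mono[of C "max C 0" "hnorm H x"] that by simp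
  then show thesis using that[of "max C 0"] by simp
qed

lemma hconverges_image:
  assumes "\<And>n. s n \<in> carr H" "x \<in> carr H" "hconverges H s x"
  shows "hconverges K (\<lambda>n. T (s n)) (T x)"
proof -
  obtain C where C: "\<And>x. x \<in> carr H \<Longrightarrow> hnorm K (T x) \<le> C * hnorm H x" using bound by blast
  show ?thesis
  proof (rule K.hconvergesI_bound)
    show "(\<lambda>n. C * hnorm H (s n - x)) \<longlonglongrightarrow> 0"
      using tendsto_mult_left[OF assms(3)[unfolded hconverges_def], of C] by simp
    show "hnorm K (T (s n) - T x) \<le> C * hnorm H (s n - x)" for n
      using C[of "s n - x"] assms by (simp add: diff)
  qed (use assms in auto)
qed

end

locale bounded_operator = bounded_semi_ip_op H K T + H: hilbert H
  for H :: "'a::complex_vector ip_space" and K :: "'b::complex_vector ip_space" and T :: "'a \<Rightarrow> 'b"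
begin

lemma adjoint_exists:
  assumes y: "y \<in> carr K"
  shows "\<exists>x\<in>carr H. \<forall>u\<in>carr H. ip K (T u) y = ip H u x"
proof -
  obtain C where C: "\<And>x. x \<in> carr H \<Longrightarrow> hnorm K (T x) \<le> C * hnorm H x" using bound by blast
  obtain x where "x \<in> carr H" "\<And>u. u \<in> carr H \<Longrightarrow> ip K (T u) y = ip H u x"
  proof (rule H.Riesz_representation[of "\<lambda>u. ip K (T u) y" "C * hnorm K y"])
    fix u assume u: "u \<in> carr H"
    have "cmod (ip K (T u) y) \<le> hnorm K (T u) * hnorm K y"
      using u y by (intro K.Cauchy_Schwarz) auto
    also have "\<dots> \<le> (C * hnorm H u) * hnorm K y"
      using C[OF u] y by (intro mult_right_mono) auto
    finally show "cmod (ip K (T u) y) \<le> (C * hnorm K y) * hnorm H u" by (simp add: mult_ac)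
  qed (use y in \<open>auto simp: add scale K.ip_add_left K.ip_scale_left\<close>)
  then show ?thesis by blast
qed

lemma hadjoint_in [simp]: "y \<in> carr K \<Longrightarrow> hadjoint H K T y \<in> carr H"
  using adjoint_exists[of y] hadjoint_eqI[OF H.hilbert_axioms, of _ K T y] by metis

lemma hadjoint_ip: "\<lbrakk>y \<in> carr K; u \<in> carr H\<rbrakk> \<Longrightarrow> ip H u (hadjoint H K T y) = ip K (T u) y"
  using adjoint_exists[of y] hadjoint_eqI[OF H.hilbert_axioms, of _ K T y] by metis

lemma hadjoint_add:
  "\<lbrakk>x \<in> carr K; y \<in> carr K\<rbrakk> \<Longrightarrow> hadjoint H K T (x + y) = hadjoint H K T x + hadjoint H K T y"
  by (rule hadjoint_eqI[OF H.hilbert_axioms]) (auto simp: H.ip_add_right K.ip_add_right hadjoint_ip)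

lemma hadjoint_scale:
  "x \<in> carr K \<Longrightarrow> hadjoint H K T (c *\<^sub>C x) = c *\<^sub>C hadjoint H K T x"
  by (rule hadjoint_eqI[OF H.hilbert_axioms]) (auto simp: H.ip_scale_right K.ip_scale_right hadjoint_ip)

lemma bounded_op_hadjoint: "bounded_op K H (hadjoint H K T)"
proof -
  obtain C where C: "C \<ge> 0" "\<And>x. x \<in> carr H \<Longrightarrow> hnorm K (T x) \<le> C * hnorm H x" using bound by blast
  have "hnorm H (hadjoint H K T y) \<le> C * hnorm K y" if y: "y \<in> carr K" for y
  proof -
    let ?x = "hadjoint H K T y"
    have x: "?x \<in> carr H" using y by simp
    have "(hnorm H ?x)\<^sup>2 = Re (ip K (T ?x) y)" using x y by (simp add: H.hnorm_sq hadjoint_ip)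
    also have "\<dots> \<le> hnorm K (T ?x) * hnorm K y"
      using K.Cauchy_Schwarz[of "T ?x" y] complex_Re_le_cmod[of "ip K (T ?x) y"] x y by simp
    also have "\<dots> \<le> (C * hnorm H ?x) * hnorm K y"
      using C(2)[OF x] y by (intro mult_right_mono) auto
    finally have "hnorm H ?x * hnorm H ?x \<le> hnorm H ?x * (C * hnorm K y)"
      by (simp add: power2_eq_square mult_ac)
    then show ?thesis
      by (rule le_if_mult_self_le) (use y C(1) in simp)
  qed
  then show ?thesis
    unfolding bounded_op_def by (auto simp: hadjoint_add hadjoint_scale)
qed

end

lemma bounded_opI:
  assumes "\<And>x. x \<in> carr H \<Longrightarrow> T x \<in> carr K"
    and "\<And>x y. x \<in> carr H \<Longrightarrow> y \<in> carr H \<Longrightarrow> T (x + y) = T x + T y"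
    and "\<And>c x. x \<in> carr H \<Longrightarrow> T (c *\<^sub>C x) = c *\<^sub>C T x"
    and "\<And>x. x \<in> carr H \<Longrightarrow> hnorm K (T x) \<le> C * hnorm H x"
  shows "bounded_op H K T"
  unfolding bounded_op_def using assms by blast

lemma bounded_op_id: "bounded_op H H id"
  by (rule bounded_opI[of _ _ _ 1]) auto

lemma bounded_op_comp:
  assumes "semi_ip H" "semi_ip K" "semi_ip L" "bounded_op H K T" "bounded_op K L U"
  shows "bounded_op H L (U \<circ> T)"
proof -
  interpret T: bounded_semi_ip_op H K T
    using assms by (simp add: bounded_semi_ip_op_def bounded_semi_ip_op_axioms_def)
  interpret U: bounded_semi_ip_op K L U
    using assms by (simp add: bounded_semi_ip_op_def bounded_semi_ip_op_axioms_def)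
  obtain C where C: "C \<ge> 0" "\<And>x. x \<in> carr H \<Longrightarrow> hnorm K (T x) \<le> C * hnorm H x"
    using T.bound by blast
  obtain D where D: "D \<ge> 0" "\<And>x. x \<in> carr K \<Longrightarrow> hnorm L (U x) \<le> D * hnorm K x"
    using U.bound by blast
  have "hnorm L (U (T x)) \<le> (D * C) * hnorm H x" if x: "x \<in> carr H" for x
  proof -
    have "hnorm L (U (T x)) \<le> D * hnorm K (T x)" using x by (intro D(2)) simp
    also have "\<dots> \<le> D * (C * hnorm H x)" using C(2)[OF x] D(1) by (intro mult_left_mono) auto
    finally show ?thesis by (simp add: mult_ac)
  qed
  then show ?thesis
    by (intro bounded_opI[where C = "D * C"]) (simp_all add: T.add U.add T.scale U.scale)
qed

lemma bounded_op_scaleC: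
  assumes "semi_ip H" "semi_ip K" "bounded_op H K T"
  shows "bounded_op H K (\<lambda>x. c *\<^sub>C T x)"
proof -
  interpret T: bounded_semi_ip_op H K T
    using assms by (simp add: bounded_semi_ip_op_def bounded_semi_ip_op_axioms_def)
  obtain C where C: "\<And>x. x \<in> carr H \<Longrightarrow> hnorm K (T x) \<le> C * hnorm H x"
    using T.bound by blast
  have "hnorm K (c *\<^sub>C T x) \<le> (cmod c * C) * hnorm H x" if "x \<in> carr H" for x
    using mult_left_mono[OF C[OF that], of "cmod c"] that by (simp add: T.K.hnorm_scale mult.assoc)
  then show ?thesis
    by (intro bounded_opI[where C = "cmod c * C"])
       (simp_all add: T.add T.scale scaleC_add_right mult.commute)
qed

lemma bounded_op_add:
  assumes "semi_ip H" "semi_ip K" "bounded_op H K T" "bounded_op H K U"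
  shows "bounded_op H K (\<lambda>x. T x + U x)"
proof -
  interpret T: bounded_semi_ip_op H K T
    using assms by (simp add: bounded_semi_ip_op_def bounded_semi_ip_op_axioms_def)
  interpret U: bounded_semi_ip_op H K U
    using assms by (simp add: bounded_semi_ip_op_def bounded_semi_ip_op_axioms_def)
  obtain C where C: "\<And>x. x \<in> carr H \<Longrightarrow> hnorm K (T x) \<le> C * hnorm H x"
    using T.bound by blast
  obtain D where D: "\<And>x. x \<in> carr H \<Longrightarrow> hnorm K (U x) \<le> D * hnorm H x"
    using U.bound by blast
  have "hnorm K (T x + U x) \<le> (C + D) * hnorm H x" if "x \<in> carr H" for x
    using C[OF that] D[OF that] T.K.hnorm_triangle[of "T x" "U x"] that by (simp add: algebra_simps)
  then show ?thesis
    by (intro bounded_opI[where C = "C + D"])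
       (simp_all add: T.add T.scale U.add U.scale scaleC_add_right add_ac)
qed

lemma bounded_op_sum:
  assumes "semi_ip H" "semi_ip K" "\<And>i. i \<in> A \<Longrightarrow> bounded_op H K (T i)"
  shows "bounded_op H K (\<lambda>x. \<Sum>i\<in>A. T i x)"
proof -
  interpret K: semi_ip K by fact
  have 0: "bounded_op H K (\<lambda>x. 0)" by (rule bounded_opI[where C = 0]) auto
  show ?thesis
    using assms(3) by (induction A rule: infinite_finite_induct) (auto simp: 0 bounded_op_add assms(1,2))
qed

text \<open>\<open>op_monomial\<close> folds along an unspecified enumeration of the indices. A
  property preserved by composing any \<open>T j\<close> on the left does not depend on that
  order.\<close>

lemma op_monomial_induct:
  assumes "P id" "\<And>j A. P A \<Longrightarrow> P (T j \<circ> A)"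
  shows "P (op_monomial T k)"
proof -
  have pow: "P ((T j ^^ m) \<circ> A)" if "P A" for j m A
    using that assms(2) by (induction m) (auto simp: comp_assoc)
  have "P (foldr (\<lambda>j A. (T j ^^ (k $ j)) \<circ> A) js id)" for js
  proof (induction js)
    case (Cons j js)
    then show ?case using pow[OF Cons.IH, where j = j and m = "k $ j"] by (simp add: o_def)
  qed (use assms(1) in \<open>simp add: id_def\<close>)
  then show ?thesis unfolding op_monomial_def .
qed

lemma bounded_op_op_monomial:
  assumes "semi_ip H" "\<And>j. bounded_op H H (T j)"
  shows "bounded_op H H (op_monomial T k)"
  by (rule op_monomial_induct) (use assms bounded_op_id bounded_op_comp in blast)+

text \<open>\<open>R c y\<close> records that \<open>y\<close> arose from \<open>x\<close> by
  operators that have acted as the scalar \<open>c\<close> so far. One instance of \<open>R\<close>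
  is evaluation at a point under coordinate multiplication, another is an eigenvector of the
  adjoints.\<close>

lemma op_monomial_scalar:
  fixes T :: "'n::finite \<Rightarrow> 'a \<Rightarrow> 'a" and R :: "complex \<Rightarrow> 'a \<Rightarrow> bool"
  assumes step: "\<And>j c y. R c y \<Longrightarrow> R (c * \<mu> $ j) (T j y)" and one: "R 1 x"
  shows "R (monomial \<mu> k) (op_monomial T k x)"
proof -
  have pow: "R (c * (\<mu> $ j) ^ m) ((T j ^^ m) y)" if "R c y" for j m c y
    using that
  proof (induction m)
    case (Suc m)
    then show ?case using step[of "c * (\<mu> $ j) ^ m" "(T j ^^ m) y" j] by (simp add: mult_ac)
  qed simp
  have *: "R (\<Prod>j\<in>set js. (\<mu> $ j) ^ (k $ j)) (foldr (\<lambda>j A. (T j ^^ (k $ j)) \<circ> A) js id x)"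
    if "distinct js" for js
    using that
  proof (induction js)
    case (Cons j js)
    then show ?case
      using pow[of "\<Prod>j\<in>set js. (\<mu> $ j) ^ (k $ j)" _ j "k $ j"] by (simp add: mult.commute)
  qed (simp add: one)
  \<comment> \<open>Some enumeration exists, so the chosen one is an enumeration too, and the
    product over its elements is the one in \<open>monomial\<close>.\<close>
  have "\<exists>js :: 'n list. distinct js \<and> set js = UNIV"
    using finite_distinct_list[of "UNIV :: 'n set"] by auto
  from *[OF someI_ex[OF this, THEN conjunct1]] someI_ex[OF this, THEN conjunct2] show ?thesis
    by (simp only: op_monomial_def monomial_def)
qed

section \<open>Boundedness from a formal adjoint\<close>

context hilbert begin

text \<open>A Hellinger--Toeplitz argument: the images of the unit vectors in the span of \<open>G\<close> under the
  formal adjoint are weakly bounded, hence bounded.\<close>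

lemma bounded_op_if_adjoint_on_total:
  assumes TH: "\<And>x. x \<in> carr H \<Longrightarrow> T x \<in> carr H"
    and add: "\<And>x y. x \<in> carr H \<Longrightarrow> y \<in> carr H \<Longrightarrow> T (x + y) = T x + T y"
    and scale: "\<And>c x. x \<in> carr H \<Longrightarrow> T (c *\<^sub>C x) = c *\<^sub>C T x"
    and G: "G \<subseteq> carr H"
    and total: "\<And>y. y \<in> carr H \<Longrightarrow> (\<And>m. m \<in> G \<Longrightarrow> ip H y m = 0) \<Longrightarrow> y = 0"
    and adj: "\<And>y. y \<in> G \<Longrightarrow> \<exists>y'\<in>carr H. \<forall>x\<in>carr H. ip H (T x) y = ip H x y'"
  shows "bounded_op H H T"
proof -
  define D where "D = complex_vector.span G"
  have D: "complex_vector.subspace D" "D \<subseteq> carr H" "G \<subseteq> D"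
    unfolding D_def using G subspace_carr
    by (auto simp: complex_vector.subspace_span complex_vector.span_superset
        intro: complex_vector.span_minimal[THEN subsetD])
  \<comment> \<open>Having a formal adjoint vector is preserved by linear combinations, so it passes
    from \<open>G\<close> to the span.\<close>
  have "y \<in> carr H \<and> (\<exists>y'\<in>carr H. \<forall>x\<in>carr H. ip H (T x) y = ip H x y')" if "y \<in> D" for y
    using that unfolding D_def
  proof (induction rule: complex_vector.span_induct_alt)
    case base
    show ?case using TH by (intro conjI bexI[of _ 0]) auto
  next
    case (step c u y)
    obtain u' where u': "u' \<in> carr H" "\<And>x. x \<in> carr H \<Longrightarrow> ip H (T x) u = ip H x u'"
      using adj step by blast
    obtain y' where y': "y' \<in> carr H" "\<And>x. x \<in> carr H \<Longrightarrow> ip H (T x) y = ip H x y'"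
      using step by blast
    have "u \<in> carr H" "y \<in> carr H" using step G by auto
    then show ?case
      using u' y' TH
      by (intro conjI bexI[of _ "c *\<^sub>C u' + y'"]) (auto simp: ip_add_right ip_scale_right)
  qed
  then obtain adj where adj: "\<And>y. y \<in> D \<Longrightarrow> adj y \<in> carr H"
    "\<And>y x. y \<in> D \<Longrightarrow> x \<in> carr H \<Longrightarrow> ip H (T x) y = ip H x (adj y)"
    by metis
  \<comment> \<open>For fixed \<open>x\<close> the inner product with \<open>adj y\<close> equals
    that of \<open>T x\<close> with \<open>y\<close>, hence is at most \<open>hnorm H (T x)\<close>
    over the unit ball of \<open>D\<close>.\<close>
  have "\<exists>C. \<forall>b\<in>adj ` {y \<in> D. hnorm H y \<le> 1}. hnorm H b \<le> C"
  proof (rule uniform_boundedness)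
    fix x assume x: "x \<in> carr H"
    have "cmod (ip H x (adj y)) \<le> hnorm H (T x)" if "y \<in> D" "hnorm H y \<le> 1" for y
    proof -
      have yH: "y \<in> carr H" using that D by auto
      have "cmod (ip H x (adj y)) \<le> hnorm H (T x) * hnorm H y"
        using Cauchy_Schwarz[OF TH[OF x] yH] adj(2)[OF that(1) x] by simp
      also have "\<dots> \<le> hnorm H (T x) * 1"
        using that TH[OF x] by (intro mult_left_mono) auto
      finally show ?thesis by simp
    qed
    then show "\<exists>c. \<forall>b\<in>adj ` {y \<in> D. hnorm H y \<le> 1}. cmod (ip H x b) \<le> c" by blast
  qed (use adj in auto)
  then obtain C where C: "\<And>y. y \<in> D \<Longrightarrow> hnorm H y \<le> 1 \<Longrightarrow> hnorm H (adj y) \<le> C" by auto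
  have C0: "C \<ge> 0"
    using C[of 0] complex_vector.subspace_0[OF D(1)] adj(1)[of 0] hnorm_nonneg[of "adj 0"] by (simp del: hnorm_nonneg)
  have bd: "cmod (ip H (T x) y) \<le> C * hnorm H x * hnorm H y" if x: "x \<in> carr H" and y: "y \<in> D" for x y
  proof (cases "hnorm H y = 0")
    case True
    have "y \<in> carr H" using y D by auto
    then show ?thesis using Cauchy_Schwarz[OF TH[OF x], of y] True by simp
  next
    case False
    have yH: "y \<in> carr H" using y D by auto
    then have pos: "hnorm H y > 0" using False hnorm_nonneg[of y] by linarith
    define u where "u = complex_of_real (1 / hnorm H y) *\<^sub>C y"
    have u: "u \<in> D" using y D(1) by (auto simp: u_def intro: complex_vector.subspace_scale)
    have nu: "hnorm H u = 1" using pos yH by (simp add: u_def hnorm_scale norm_divide)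
    have uH: "u \<in> carr H" using u D by auto
    have yu: "y = complex_of_real (hnorm H y) *\<^sub>C u"
      using pos by (simp add: u_def scaleC_one)
    have "cmod (ip H (T x) u) \<le> hnorm H x * hnorm H (adj u)"
      using Cauchy_Schwarz[OF x adj(1)[OF u]] adj(2)[OF u x] by simp
    also have "\<dots> \<le> hnorm H x * C" using C[OF u] nu x by (intro mult_left_mono) auto
    finally have "hnorm H y * cmod (ip H (T x) u) \<le> hnorm H y * (hnorm H x * C)"
      using pos by simp
    moreover have "cmod (ip H (T x) y) = hnorm H y * cmod (ip H (T x) u)"
      using uH TH[OF x] pos ip_scale_right[OF uH TH[OF x], of "complex_of_real (hnorm H y)"] yu
      by (simp add: norm_mult)
    ultimately show ?thesis by (simp add: mult_ac)
  qed
  have "hnorm H (T x) \<le> C * hnorm H x" if x: "x \<in> carr H" for x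
  proof -
    obtain s where s: "\<And>n. s n \<in> D" "hconverges H s (T x)"
      using dense_sequence[OF D(1,2) TH[OF x]] total D(3) by (metis subsetD)
    have sH: "s n \<in> carr H" for n using s D by auto
    \<comment> \<open>The bound \<open>bd\<close> is to be tested on \<open>T x\<close> itself,
      which may lie outside \<open>D\<close> and is therefore reached as a limit.\<close>
    have "cmod (ip H (T x) (T x)) \<le> C * hnorm H x * hnorm H (T x)"
    proof (rule LIMSEQ_le)
      show "(\<lambda>n. cmod (ip H (T x) (s n))) \<longlonglongrightarrow> cmod (ip H (T x) (T x))"
        using s sH TH[OF x] by (intro tendsto_norm hconverges_ip) auto
      show "(\<lambda>n. C * hnorm H x * hnorm H (s n)) \<longlonglongrightarrow> C * hnorm H x * hnorm H (T x)"
        using s sH TH[OF x] by (intro tendsto_mult_left hconverges_hnorm) auto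
    qed (use bd[OF x s(1)] in auto)
    then have "hnorm H (T x) * hnorm H (T x) \<le> hnorm H (T x) * (C * hnorm H x)"
      using ip_self[OF TH[OF x]] by (simp add: norm_mult norm_power power2_eq_square mult_ac)
    then show ?thesis
      by (rule le_if_mult_self_le) (use x C0 in simp)
  qed
  then show ?thesis
    unfolding bounded_op_def using TH add scale by blast
qed

end

section \<open>Sesquilinear forms on spans of pairs\<close>

instantiation prod :: (complex_vector, complex_vector) complex_vector
begin
definition scaleC_prod :: "complex \<Rightarrow> 'a \<times> 'b \<Rightarrow> 'a \<times> 'b" where
  "scaleC_prod c x = (c *\<^sub>C fst x, c *\<^sub>C snd x)"
instance
  by standard (auto simp: scaleC_prod_def prod_eq_iff scaleC_add_right scaleC_add_left
      scaleC_scaleC scaleC_one)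
end

text \<open>Span induction in one argument after the other. Membership in \<open>V\<close> is
  carried along because sesquilinearity is assumed only there.\<close>

lemma sesquilinear_zero_span:
  fixes Q :: "'a::complex_vector \<Rightarrow> 'a \<Rightarrow> complex"
  assumes V: "complex_vector.subspace V" "G \<subseteq> V"
    and left: "\<And>c x y z. x \<in> V \<Longrightarrow> y \<in> V \<Longrightarrow> z \<in> V \<Longrightarrow> Q (c *\<^sub>C x + y) z = c * Q x z + Q y z"
    and right: "\<And>c x y z. x \<in> V \<Longrightarrow> y \<in> V \<Longrightarrow> z \<in> V \<Longrightarrow> Q z (c *\<^sub>C x + y) = cnj c * Q z x + Q z y"
    and zero: "\<And>x y. x \<in> G \<Longrightarrow> y \<in> G \<Longrightarrow> Q x y = 0"
    and x: "x \<in> complex_vector.span G" and y: "y \<in> complex_vector.span G"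
  shows "Q x y = 0"
proof -
  have 0: "0 \<in> V" using V(1) by (rule complex_vector.subspace_0)
  have sV: "x \<in> V" if "x \<in> complex_vector.span G" for x
    using complex_vector.span_minimal[OF V(2,1)] that by blast
  have z1: "Q 0 z = 0" if "z \<in> V" for z using left[OF 0 0 that, of "- 1"] by simp
  have z2: "Q z 0 = 0" if "z \<in> V" for z using right[OF 0 0 that, of "- 1"] by simp
  have "x \<in> V \<and> Q x g = 0" if g: "g \<in> G" for g
    using x
  proof (induction rule: complex_vector.span_induct_alt)
    case base show ?case using z1 g V 0 by auto
  next
    case (step c u v)
    have "u \<in> V" "v \<in> V" "g \<in> V" using step g V by auto
    then show ?case
      using left[of u v g c] step zero g V(1)
      by (simp add: complex_vector.subspace_add complex_vector.subspace_scale)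
  qed
  then have a: "Q x g = 0" if "g \<in> G" for g using that by blast
  have "y \<in> V \<and> Q x y = 0"
    using y
  proof (induction rule: complex_vector.span_induct_alt)
    case base show ?case using z2 sV x 0 by auto
  next
    case (step c u v)
    have "u \<in> V" "v \<in> V" "x \<in> V" using step x V sV by auto
    then show ?case
      using right[of u v x c] step a V(1)
      by (simp add: complex_vector.subspace_add complex_vector.subspace_scale)
  qed
  then show ?thesis by blast
qed

lemma span_pairs_in:
  assumes "semi_ip A" "semi_ip B" "G \<subseteq> carr A \<times> carr B" "z \<in> complex_vector.span G"
  shows "fst z \<in> carr A" "snd z \<in> carr B"
proof -
  interpret A: semi_ip A by fact
  interpret B: semi_ip B by fact
  have "complex_vector.subspace (carr A \<times> carr B)"
    by (auto simp: complex_vector.subspace_def scaleC_prod_def zero_prod_def)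
  then have "z \<in> carr A \<times> carr B" using complex_vector.span_minimal[OF assms(3)] assms(4) by blast
  then show "fst z \<in> carr A" "snd z \<in> carr B" by auto
qed

text \<open>The span of \<open>G\<close> is the graph of a linear correspondence that need not first
  be shown to be a map. The difference of the two forms is sesquilinear on pairs and vanishes on
  generators. With \<open>T\<close> the identity this compares Gram matrices; with \<open>T\<close>
  equal to \<open>\<Delta>\<close> it expresses the form of \<open>\<Delta>\<close> as an inner
  product in the coefficient space.\<close>

lemma span_pairs_form_eq:
  assumes A: "semi_ip A" and B: "semi_ip B" and G: "G \<subseteq> carr A \<times> carr B"
    and T: "\<And>x. x \<in> carr A \<Longrightarrow> T x \<in> carr A"
    and lin: "\<And>c x y. x \<in> carr A \<Longrightarrow> y \<in> carr A \<Longrightarrow> T (c *\<^sub>C x + y) = c *\<^sub>C T x + T y"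
    and eq: "\<And>g h. g \<in> G \<Longrightarrow> h \<in> G \<Longrightarrow> ip A (T (fst g)) (fst h) = ip B (snd g) (snd h)"
    and z: "z \<in> complex_vector.span G" and w: "w \<in> complex_vector.span G"
  shows "ip A (T (fst z)) (fst w) = ip B (snd z) (snd w)"
proof -
  interpret A: semi_ip A by fact
  interpret B: semi_ip B by fact
  have T0: "T 0 = 0" using lin[of 0 0 "- 1"] by simp
  have Ta: "T (x + y) = T x + T y" if "x \<in> carr A" "y \<in> carr A" for x y
    using lin[OF that, of 1] by (simp add: scaleC_one)
  have Ts: "T (c *\<^sub>C x) = c *\<^sub>C T x" if "x \<in> carr A" for x c
    using lin[OF that, of 0 c] T0 by simp
  have "ip A (T (fst z)) (fst w) - ip B (snd z) (snd w) = 0"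
  proof (rule sesquilinear_zero_span[where V = "carr A \<times> carr B" and G = G
        and Q = "\<lambda>z w. ip A (T (fst z)) (fst w) - ip B (snd z) (snd w)"])
    show "complex_vector.subspace (carr A \<times> carr B)"
      by (auto simp: complex_vector.subspace_def scaleC_prod_def zero_prod_def)
  qed (use G z w T eq in \<open>auto simp: scaleC_prod_def Ta Ts A.ip_add_left A.ip_scale_left A.ip_add_right
      A.ip_scale_right B.ip_add_left B.ip_scale_left B.ip_add_right B.ip_scale_right algebra_simps\<close>)
  then show ?thesis by simp
qed

lemma span_image_fst:
  "complex_vector.span (fst ` G) = fst ` complex_vector.span G"
  for G :: "('a::complex_vector \<times> 'b::complex_vector) set"
proof -
  have "module_hom scaleC scaleC (fst :: 'a \<times> 'b \<Rightarrow> 'a)"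
    by unfold_locales (auto simp: scaleC_prod_def scaleC_add_right scaleC_add_left scaleC_scaleC scaleC_one)
  then show ?thesis
    by (rule module_hom.span_image)
qed

text \<open>Families with equal Gram matrices span isometric subspaces; \<open>y\<close> is the image of \<open>x\<close> under the
  resulting isometry of the closed spans.\<close>

lemma equal_Gram_transfer:
  assumes A: "semi_ip A" and B: "hilbert B"
    and a: "\<And>i. i \<in> I \<Longrightarrow> a i \<in> carr A" and b: "\<And>i. i \<in> I \<Longrightarrow> b i \<in> carr B"
    and eq: "\<And>i j. i \<in> I \<Longrightarrow> j \<in> I \<Longrightarrow> ip A (a i) (a j) = ip B (b i) (b j)"
    and s: "\<And>n. s n \<in> complex_vector.span (a ` I)" and x: "x \<in> carr A" "hconverges A s x"
  obtains y where "y \<in> carr B" "hnorm B y = hnorm A x"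
    "\<And>i. i \<in> I \<Longrightarrow> ip B y (b i) = ip A x (a i)"
proof -
  interpret A: semi_ip A by fact
  interpret B: hilbert B by fact
  define G where "G = (\<lambda>i. (a i, b i)) ` I"
  have fstG: "fst ` G = a ` I" by (auto simp: G_def image_image)
  have G: "G \<subseteq> carr A \<times> carr B" using a b by (auto simp: G_def)
  \<comment> \<open>Each approximating combination is lifted to a combination of pairs, whose second
    component is the corresponding combination of the \<open>b i\<close>.\<close>
  have "\<exists>z. z \<in> complex_vector.span G \<and> fst z = s n" for n
  proof -
    have "s n \<in> fst ` complex_vector.span G" using s[of n] by (simp only: span_image_fst[symmetric] fstG)
    then show ?thesis by (rule imageE) (rule exI, rule conjI, simp_all)
  qed
  then obtain z where z: "\<And>n. z n \<in> complex_vector.span G" "\<And>n. fst (z n) = s n" by metis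
  have eq': "ip A (fst u) (fst v) = ip B (snd u) (snd v)"
    if "u \<in> complex_vector.span G" "v \<in> complex_vector.span G" for u v
    by (rule span_pairs_form_eq[OF A B.semi_ip_axioms G, where T = "\<lambda>x. x"])
       (use that eq in \<open>auto simp: G_def\<close>)
  have nrm: "hnorm A (fst u) = hnorm B (snd u)" if "u \<in> complex_vector.span G" for u
    using eq'[OF that that] by (simp add: hnorm_def)
  have sA: "s n \<in> carr A" and zB: "snd (z n) \<in> carr B" for n
    using span_pairs_in[OF A B.semi_ip_axioms G z(1)[of n]] z(2) by auto
  \<comment> \<open>Differences of elements of the span of pairs stay in it, so the second
    components inherit the Cauchy property from the first.\<close>
  have "hnorm B (snd (z m) - snd (z k)) = hnorm A (s m - s k)" for m k
    using nrm[of "z m - z k"] z by (simp add: complex_vector.span_diff)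
  then have "hCauchy B (\<lambda>n. snd (z n))"
    using A.hCauchyI_hconverges[OF sA x] by (simp add: hCauchy_def)
  then obtain y where y: "y \<in> carr B" "hconverges B (\<lambda>n. snd (z n)) y"
    using B.complete[of "\<lambda>n. snd (z n)"] zB by blast
  show thesis
  proof (rule that[OF y(1)])
    have "(\<lambda>n. hnorm B (snd (z n))) \<longlonglongrightarrow> hnorm B y" by (rule B.hconverges_hnorm[OF zB y])
    moreover have "(\<lambda>n. hnorm B (snd (z n))) \<longlonglongrightarrow> hnorm A x"
      using A.hconverges_hnorm[OF sA x] nrm[OF z(1)] z(2) by simp
    ultimately show "hnorm B y = hnorm A x" by (rule LIMSEQ_unique)
    fix i assume i: "i \<in> I"
    have iG: "(a i, b i) \<in> complex_vector.span G"
      using i by (auto simp: G_def intro: complex_vector.span_base)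
    have "(\<lambda>n. ip B (snd (z n)) (b i)) \<longlonglongrightarrow> ip B y (b i)"
      using zB y b[OF i] by (intro B.hconverges_ip) auto
    moreover have "(\<lambda>n. ip A (s n) (a i)) \<longlonglongrightarrow> ip A x (a i)"
      using sA x a[OF i] by (intro A.hconverges_ip) auto
    then have "(\<lambda>n. ip B (snd (z n)) (b i)) \<longlonglongrightarrow> ip A x (a i)"
      using eq'[OF z(1) iG] z(2) by simp
    ultimately show "ip B y (b i) = ip A x (a i)" by (rule LIMSEQ_unique)
  qed
qed

section \<open>Reproducing kernel Hilbert spaces of operator valued kernels\<close>

context semi_ip begin

lemma hCauchy_bounded:
  assumes "\<And>n. s n \<in> carr H" "hCauchy H s"
  obtains B where "B > 0" "\<And>n. hnorm H (s n) \<le> B"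
proof -
  obtain N where N: "\<And>m. m \<ge> N \<Longrightarrow> hnorm H (s m - s N) < 1"
    using assms(2) unfolding hCauchy_def by (meson order_refl zero_less_one)
  define B where "B = Max ((\<lambda>n. hnorm H (s n)) ` {..N}) + 1"
  have M: "hnorm H (s n) \<le> Max ((\<lambda>n. hnorm H (s n)) ` {..N})" if "n \<le> N" for n
    by (rule Max_ge) (use that in auto)
  have "hnorm H (s n) \<le> B" for n
  proof (cases "n \<le> N")
    case True then show ?thesis using M[OF True] unfolding B_def by linarith
  next
    case False
    then have "hnorm H (s n - s N) < 1" using N by simp
    moreover have "hnorm H (s n) \<le> hnorm H (s n - s N) + hnorm H (s N)"
      using hnorm_triangle[of "s n - s N" "s N"] assms(1) by simp
    ultimately show ?thesis using M[of N] unfolding B_def by linarith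
  qed
  moreover have "B > 0" using M[of 0] hnorm_nonneg[OF assms(1)[of 0]] unfolding B_def by linarith
  ultimately show thesis using that by blast
qed

lemma hCauchy_add:
  assumes "\<And>n. s n \<in> carr H" "\<And>n. t n \<in> carr H" "hCauchy H s" "hCauchy H t"
  shows "hCauchy H (\<lambda>n. s n + t n)"
  unfolding hCauchy_def
proof (intro allI impI)
  fix e :: real assume "e > 0"
  then obtain M N where M: "\<And>m k. m \<ge> M \<Longrightarrow> k \<ge> M \<Longrightarrow> hnorm H (s m - s k) < e / 2"
    and N: "\<And>m k. m \<ge> N \<Longrightarrow> k \<ge> N \<Longrightarrow> hnorm H (t m - t k) < e / 2"
    using assms(3,4) unfolding hCauchy_def by (meson half_gt_zero)
  show "\<exists>N. \<forall>m\<ge>N. \<forall>k\<ge>N. hnorm H (s m + t m - (s k + t k)) < e"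
  proof (intro exI[of _ "max M N"] allI impI)
    fix m k assume "max M N \<le> m" "max M N \<le> k"
    moreover have "hnorm H (s m + t m - (s k + t k)) \<le> hnorm H (s m - s k) + hnorm H (t m - t k)"
      using hnorm_triangle[of "s m - s k" "t m - t k"] assms by (simp add: algebra_simps)
    ultimately show "hnorm H (s m + t m - (s k + t k)) < e"
      using M[of m k] N[of m k] by simp
  qed
qed

lemma hCauchy_scale:
  assumes "\<And>n. s n \<in> carr H" "hCauchy H s"
  shows "hCauchy H (\<lambda>n. c *\<^sub>C s n)"
  unfolding hCauchy_def
proof (intro allI impI)
  fix e :: real assume "e > 0"
  then have "e / (cmod c + 1) > 0" by (simp add: add_nonneg_pos)
  then obtain N where N: "\<And>m k. m \<ge> N \<Longrightarrow> k \<ge> N \<Longrightarrow> hnorm H (s m - s k) < e / (cmod c + 1)"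
    using assms(2) unfolding hCauchy_def by meson
  show "\<exists>N. \<forall>m\<ge>N. \<forall>k\<ge>N. hnorm H (c *\<^sub>C s m - c *\<^sub>C s k) < e"
  proof (intro exI[of _ N] allI impI)
    fix m k assume "N \<le> m" "N \<le> k"
    then have "hnorm H (s m - s k) * (cmod c + 1) < e"
      using N[of m k] by (simp add: pos_less_divide_eq add_nonneg_pos)
    moreover have "hnorm H (c *\<^sub>C s m - c *\<^sub>C s k) = cmod c * hnorm H (s m - s k)"
      using assms(1) hnorm_scale[of "s m - s k" c] by (simp add: complex_vector.scale_right_diff_distrib)
    moreover have "0 \<le> hnorm H (s m - s k)" using assms(1) by simp
    ultimately show "hnorm H (c *\<^sub>C s m - c *\<^sub>C s k) < e" by (simp add: algebra_simps)
  qed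
qed

lemma ip_diff_le:
  assumes "a \<in> carr H" "a' \<in> carr H" "b \<in> carr H" "b' \<in> carr H" "hnorm H b \<le> B" "hnorm H a' \<le> B"
  shows "cmod (ip H a b - ip H a' b') \<le> B * (hnorm H (a - a') + hnorm H (b - b'))"
proof -
  have "ip H a b - ip H a' b' = ip H (a - a') b + ip H a' (b - b')"
    using assms by (simp add: ip_diff_left ip_diff_right)
  then have "cmod (ip H a b - ip H a' b') \<le> cmod (ip H (a - a') b) + cmod (ip H a' (b - b'))"
    by (simp add: norm_triangle_ineq)
  also have "\<dots> \<le> hnorm H (a - a') * hnorm H b + hnorm H a' * hnorm H (b - b')"
    using assms by (intro add_mono Cauchy_Schwarz) auto
  also have "\<dots> \<le> hnorm H (a - a') * B + B * hnorm H (b - b')"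
    using assms by (intro add_mono mult_left_mono mult_right_mono) auto
  finally show ?thesis by (simp add: algebra_simps)
qed

end

text \<open>A semi-inner product space \<open>P\<close> with a linear map \<open>J\<close> into \<open>E\<close>-valued functions for which
  \<open>J (\<delta> z \<eta>)\<close> plays the role of the kernel function. The completion is realized by functions.\<close>

locale function_prespace = semi_ip P + E: hilbert E
  for P :: "'v::complex_vector ip_space" and E :: "'e::complex_vector ip_space" +
  fixes \<Omega> :: "'z set" and J :: "'v \<Rightarrow> 'z \<Rightarrow> 'e" and \<delta> :: "'z \<Rightarrow> 'e \<Rightarrow> 'v"
  assumes J_add: "\<lbrakk>x \<in> carr P; y \<in> carr P\<rbrakk> \<Longrightarrow> J (x + y) z = J x z + J y z"
    and J_scale: "x \<in> carr P \<Longrightarrow> J (c *\<^sub>C x) z = c *\<^sub>C J x z"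
    and J_in: "\<lbrakk>x \<in> carr P; z \<in> \<Omega>\<rbrakk> \<Longrightarrow> J x z \<in> carr E"
    and J_off: "\<lbrakk>x \<in> carr P; z \<notin> \<Omega>\<rbrakk> \<Longrightarrow> J x z = 0"
    and delta_in: "\<lbrakk>z \<in> \<Omega>; \<eta> \<in> carr E\<rbrakk> \<Longrightarrow> \<delta> z \<eta> \<in> carr P"
    and ip_delta: "\<lbrakk>z \<in> \<Omega>; \<eta> \<in> carr E; x \<in> carr P\<rbrakk> \<Longrightarrow> ip P x (\<delta> z \<eta>) = ip E (J x z) \<eta>"
    and delta_bound: "z \<in> \<Omega> \<Longrightarrow> \<exists>C. \<forall>\<eta>\<in>carr E. hnorm P (\<delta> z \<eta>) \<le> C * hnorm E \<eta>"
    and delta_span: "carr P \<subseteq> complex_vector.span {\<delta> z \<eta> |z \<eta>. z \<in> \<Omega> \<and> \<eta> \<in> carr E}"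
begin

lemma J_diff: "\<lbrakk>x \<in> carr P; y \<in> carr P\<rbrakk> \<Longrightarrow> J (x - y) z = J x z - J y z"
  using J_add[of x "(- 1) *\<^sub>C y"] J_scale[of y "- 1"] by simp

text \<open>Dual to the bound on \<open>\<delta> z\<close>: the value \<open>J x z\<close> is tested
  against itself by means of \<open>ip_delta\<close>.\<close>

lemma J_bound:
  assumes z: "z \<in> \<Omega>"
  obtains C where "C \<ge> 0" "\<And>x. x \<in> carr P \<Longrightarrow> hnorm E (J x z) \<le> C * hnorm P x"
proof -
  obtain C where C: "\<And>\<eta>. \<eta> \<in> carr E \<Longrightarrow> hnorm P (\<delta> z \<eta>) \<le> C * hnorm E \<eta>"
    using delta_bound[OF z] by blast
  have "hnorm E (J x z) \<le> \<bar>C\<bar> * hnorm P x" if x: "x \<in> carr P" for x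
  proof (rule le_if_mult_self_le)
    have Jx: "J x z \<in> carr E" using J_in x z by blast
    have "hnorm E (J x z) * hnorm E (J x z) = cmod (ip P x (\<delta> z (J x z)))"
      using Jx x z by (simp add: ip_delta E.ip_self norm_mult norm_power power2_eq_square)
    also have "\<dots> \<le> hnorm P x * hnorm P (\<delta> z (J x z))"
      using Jx x z by (intro Cauchy_Schwarz delta_in)
    also have "\<dots> \<le> hnorm P x * (\<bar>C\<bar> * hnorm E (J x z))"
    proof (rule mult_left_mono)
      show "hnorm P (\<delta> z (J x z)) \<le> \<bar>C\<bar> * hnorm E (J x z)"
        using C[OF Jx] mult_right_mono[of C "\<bar>C\<bar>" "hnorm E (J x z)"] Jx
        by (meson E.hnorm_nonneg abs_ge_self order_trans)
    qed (use x in simp)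
    finally show "hnorm E (J x z) * hnorm E (J x z) \<le> hnorm E (J x z) * (\<bar>C\<bar> * hnorm P x)"
      by (simp add: mult_ac)
  qed (use x in auto)
  then show thesis using that[of "\<bar>C\<bar>"] by simp
qed

text \<open>Elements of the completion are the pointwise limits of \<open>J\<close> along Cauchy
  sequences of \<open>P\<close>. Vectors of norm zero have \<open>J x = 0\<close> by
  \<open>J_bound\<close> and \<open>J_off\<close>, so no quotient has to be formed.\<close>

definition approx :: "(nat \<Rightarrow> 'v) \<Rightarrow> ('z \<Rightarrow> 'e) \<Rightarrow> bool" where
  "approx s f \<longleftrightarrow> (\<forall>n. s n \<in> carr P) \<and> hCauchy P s \<and> (\<forall>z. z \<notin> \<Omega> \<longrightarrow> f z = 0) \<and>
     (\<forall>z\<in>\<Omega>. f z \<in> carr E \<and> hconverges E (\<lambda>n. J (s n) z) (f z))"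

lemma approxD:
  assumes "approx s f"
  shows "s n \<in> carr P" "hCauchy P s" "z \<notin> \<Omega> \<Longrightarrow> f z = 0" "z \<in> \<Omega> \<Longrightarrow> f z \<in> carr E"
    "z \<in> \<Omega> \<Longrightarrow> hconverges E (\<lambda>n. J (s n) z) (f z)"
  using assms unfolding approx_def by auto

lemma approx_add:
  assumes "approx s f" "approx t h"
  shows "approx (\<lambda>n. s n + t n) (f + h)"
  unfolding approx_def using approxD[OF assms(1)] approxD[OF assms(2)]
  by (auto simp: J_add J_in intro!: hCauchy_add E.hconverges_add)

lemma approx_scale:
  assumes "approx s f"
  shows "approx (\<lambda>n. c *\<^sub>C s n) (c *\<^sub>C f)"
  unfolding approx_def using approxD[OF assms(1)]
  by (auto simp: J_scale J_in scaleC_fun_def intro!: hCauchy_scale E.hconverges_scale)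

lemma approx_diff:
  assumes "approx s f" "approx t h"
  shows "approx (\<lambda>n. s n - t n) (f - h)"
  using approx_add[OF assms(1) approx_scale[OF assms(2), of "- 1"]] by simp

lemma approx_const: "x \<in> carr P \<Longrightarrow> approx (\<lambda>_. x) (J x)"
  unfolding approx_def by (auto simp: J_in J_off hCauchy_def)

text \<open>This makes the inner product depend on the limit function alone. Pointwise convergence
  to zero makes the inner products of \<open>s n\<close> with every
  \<open>\<delta> z \<eta>\<close>, hence with every fixed vector of \<open>P\<close>, tend to zero.
  Splitting \<open>s n\<close> as \<open>s n - s N\<close> plus the fixed vector \<open>s N\<close>
  then forces the norms of a Cauchy sequence to zero.\<close>

lemma approx_zero:
  assumes s: "approx s (\<lambda>_. 0)"
  shows "(\<lambda>n. hnorm P (s n)) \<longlonglongrightarrow> 0"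
proof -
  note sD = approxD[OF s]
  have d: "(\<lambda>n. ip P (s n) (\<delta> z \<eta>)) \<longlonglongrightarrow> 0" if "z \<in> \<Omega>" "\<eta> \<in> carr E" for z \<eta>
  proof -
    have "(\<lambda>n. ip E (J (s n) z) \<eta>) \<longlonglongrightarrow> ip E 0 \<eta>"
      using sD that J_in by (intro E.hconverges_ip) auto
    then show ?thesis using that sD by (simp add: ip_delta)
  qed
  have w: "x \<in> carr P \<and> (\<lambda>n. ip P (s n) x) \<longlonglongrightarrow> 0"
    if "x \<in> complex_vector.span {\<delta> z \<eta> |z \<eta>. z \<in> \<Omega> \<and> \<eta> \<in> carr E}" for x
    using that
  proof (induction rule: complex_vector.span_induct_alt)
    case base show ?case using sD by simp
  next
    case (step c x y)
    have x: "x \<in> carr P" "(\<lambda>n. ip P (s n) x) \<longlonglongrightarrow> 0" using step d delta_in by auto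
    have "(\<lambda>n. cnj c * ip P (s n) x + ip P (s n) y) \<longlonglongrightarrow> cnj c * 0 + 0"
      using x step by (intro tendsto_intros) auto
    then show ?case using x step sD by (simp add: ip_add_right ip_scale_right)
  qed
  obtain B where B: "B > 0" "\<And>n. hnorm P (s n) \<le> B" using hCauchy_bounded sD by blast
  have "(\<lambda>n. (hnorm P (s n))\<^sup>2) \<longlonglongrightarrow> 0"
    unfolding LIMSEQ_iff
  proof (intro allI impI)
    fix e :: real assume e: "e > 0"
    then have "e / (2 * B) > 0" using B by simp
    then obtain N where N: "\<And>n m. n \<ge> N \<Longrightarrow> m \<ge> N \<Longrightarrow> hnorm P (s n - s m) < e / (2 * B)"
      using sD(2) unfolding hCauchy_def by meson
    have "(\<lambda>n. ip P (s n) (s N)) \<longlonglongrightarrow> 0" using w delta_span sD(1) by blast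
    then obtain M where M: "\<And>n. n \<ge> M \<Longrightarrow> cmod (ip P (s n) (s N)) < e / 2"
      using e unfolding LIMSEQ_iff by (metis diff_zero half_gt_zero)
    show "\<exists>no. \<forall>n\<ge>no. norm ((hnorm P (s n))\<^sup>2 - 0) < e"
    proof (intro exI[of _ "max M N"] allI impI)
      fix n assume n: "max M N \<le> n"
      have "(hnorm P (s n))\<^sup>2 = cmod (ip P (s n) (s n - s N) + ip P (s n) (s N))"
        using sD by (simp add: ip_diff_right ip_self norm_mult norm_power)
      also have "\<dots> \<le> hnorm P (s n) * hnorm P (s n - s N) + cmod (ip P (s n) (s N))"
        using sD by (intro order_trans[OF norm_triangle_ineq] add_mono Cauchy_Schwarz) auto
      also have "\<dots> \<le> B * (e / (2 * B)) + cmod (ip P (s n) (s N))"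
        using B N[of n N] n sD by (intro add_mono mult_mono) (auto intro: less_imp_le)
      also have "\<dots> < e" using M[of n] n B by simp
      finally show "norm ((hnorm P (s n))\<^sup>2 - 0) < e" by simp
    qed
  qed
  then have "(\<lambda>n. sqrt ((hnorm P (s n))\<^sup>2)) \<longlonglongrightarrow> sqrt 0" by (intro tendsto_real_sqrt)
  then show ?thesis using sD by simp
qed

lemma approx_unique:
  assumes "approx s f" "approx t f"
  shows "(\<lambda>n. hnorm P (s n - t n)) \<longlonglongrightarrow> 0"
  using approx_zero[of "\<lambda>n. s n - t n"] approx_diff[OF assms] by (simp add: zero_fun_def)

lemma approx_ip_convergent:
  assumes "approx s f" "approx t h"
  shows "convergent (\<lambda>n. ip P (s n) (t n))"
proof -
  note sD = approxD[OF assms(1)] and tD = approxD[OF assms(2)]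
  obtain B1 where B1: "B1 > 0" "\<And>n. hnorm P (s n) \<le> B1" using hCauchy_bounded sD by blast
  obtain B2 where B2: "B2 > 0" "\<And>n. hnorm P (t n) \<le> B2" using hCauchy_bounded tD by blast
  define B where "B = max B1 B2"
  have B: "B > 0" "\<And>n. hnorm P (s n) \<le> B" "\<And>n. hnorm P (t n) \<le> B"
    using B1 B2 by (auto simp: B_def intro: max.coboundedI1 max.coboundedI2)
  have "Cauchy (\<lambda>n. ip P (s n) (t n))"
  proof (rule CauchyI)
    fix e :: real assume "0 < e"
    then have "e / (2 * B) > 0" using B by simp
    then obtain M N where M: "\<And>m n. m \<ge> M \<Longrightarrow> n \<ge> M \<Longrightarrow> hnorm P (s m - s n) < e / (2 * B)"
      and N: "\<And>m n. m \<ge> N \<Longrightarrow> n \<ge> N \<Longrightarrow> hnorm P (t m - t n) < e / (2 * B)"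
      using sD(2) tD(2) unfolding hCauchy_def by meson
    show "\<exists>M. \<forall>m\<ge>M. \<forall>n\<ge>M. norm (ip P (s m) (t m) - ip P (s n) (t n)) < e"
    proof (intro exI[of _ "max M N"] allI impI)
      fix m n assume mn: "max M N \<le> m" "max M N \<le> n"
      have "norm (ip P (s m) (t m) - ip P (s n) (t n)) \<le> B * (hnorm P (s m - s n) + hnorm P (t m - t n))"
        using sD tD B by (intro ip_diff_le) auto
      also have "\<dots> < B * (e / (2 * B) + e / (2 * B))"
        using M[of m n] N[of m n] mn B by (intro mult_strict_left_mono add_strict_mono) auto
      also have "\<dots> = e" using B by (simp add: field_simps)
      finally show "norm (ip P (s m) (t m) - ip P (s n) (t n)) < e" .
    qed
  qed
  then show ?thesis by (simp add: Cauchy_convergent)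
qed

text \<open>Any other approximating sequence leads to the same inner product, as
  \<open>approx_ip\<close> shows.\<close>

definition rep :: "('z \<Rightarrow> 'e) \<Rightarrow> nat \<Rightarrow> 'v" where
  "rep f = (SOME s. approx s f)"

definition completion :: "('z \<Rightarrow> 'e) ip_space" where
  "completion = \<lparr>carr = {f. \<exists>s. approx s f}, ip = (\<lambda>f h. lim (\<lambda>n. ip P (rep f n) (rep h n)))\<rparr>"

lemma carr_completion: "f \<in> carr completion \<longleftrightarrow> (\<exists>s. approx s f)"
  by (simp add: completion_def)

lemma approx_rep: "approx s f \<Longrightarrow> approx (rep f) f"
  unfolding rep_def by (rule someI[of "\<lambda>s. approx s f"])

lemma approx_ip:
  assumes s: "approx s f" and t: "approx t h"
  shows "(\<lambda>n. ip P (s n) (t n)) \<longlonglongrightarrow> ip completion f h"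
proof -
  note r = approx_rep[OF s] approx_rep[OF t]
  have lim: "(\<lambda>n. ip P (rep f n) (rep h n)) \<longlonglongrightarrow> ip completion f h"
    using approx_ip_convergent[OF r] by (simp add: completion_def convergent_LIMSEQ_iff)
  obtain B1 where B1: "B1 > 0" "\<And>n. hnorm P (rep f n) \<le> B1" using hCauchy_bounded approxD[OF r(1)] by blast
  obtain B2 where B2: "B2 > 0" "\<And>n. hnorm P (t n) \<le> B2" using hCauchy_bounded approxD[OF t] by blast
  have "(\<lambda>n. max B1 B2 * (hnorm P (s n - rep f n) + hnorm P (t n - rep h n))) \<longlonglongrightarrow> max B1 B2 * (0 + 0)"
    by (intro tendsto_intros approx_unique[OF s r(1)] approx_unique[OF t r(2)])
  then have z: "(\<lambda>n. max B1 B2 * (hnorm P (s n - rep f n) + hnorm P (t n - rep h n))) \<longlonglongrightarrow> 0" by simp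
  have "cmod (ip P (s n) (t n) - ip P (rep f n) (rep h n))
      \<le> max B1 B2 * (hnorm P (s n - rep f n) + hnorm P (t n - rep h n))" for n
    using B1 B2 by (intro ip_diff_le approxD[OF s] approxD[OF t] approxD[OF r(1)] approxD[OF r(2)])
      (auto intro: max.coboundedI1 max.coboundedI2)
  then have "(\<lambda>n. ip P (s n) (t n) - ip P (rep f n) (rep h n)) \<longlonglongrightarrow> 0"
    by (intro Lim_null_comparison[OF _ z]) auto
  then show ?thesis using tendsto_add[OF _ lim] by fastforce
qed

lemma approx_norm:
  assumes "approx s f"
  shows "(\<lambda>n. hnorm P (s n)) \<longlonglongrightarrow> hnorm completion f"
  unfolding hnorm_def by (intro tendsto_intros approx_ip assms)

lemma inner_product_space_completion: "inner_product_space completion"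
  unfolding inner_product_space_def
proof (intro conjI ballI allI impI)
  show "complex_vector.subspace (carr completion)"
  proof -
    have "J 0 = 0" using J_scale[of 0 0] by (simp add: fun_eq_iff)
    then have "approx (\<lambda>_. 0) 0" using approx_const[of 0] by simp
    then show ?thesis
      by (intro complex_vector.subspaceI)
         (auto simp: carr_completion intro: approx_add approx_scale)
  qed
next
  fix f h k assume "f \<in> carr completion" "h \<in> carr completion" "k \<in> carr completion"
  then obtain s t u where a: "approx s f" "approx t h" "approx u k" unfolding carr_completion by blast
  have "(\<lambda>n. ip P (s n) (u n) + ip P (t n) (u n)) \<longlonglongrightarrow> ip completion f k + ip completion h k"
    by (intro tendsto_intros approx_ip a)
  moreover have "(\<lambda>n. ip P (s n) (u n) + ip P (t n) (u n)) \<longlonglongrightarrow> ip completion (f + h) k"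
    using approx_ip[OF approx_add[OF a(1,2)] a(3)] approxD[OF a(1)] approxD[OF a(2)] approxD[OF a(3)]
    by (simp add: ip_add_left)
  ultimately show "ip completion (f + h) k = ip completion f k + ip completion h k"
    by (rule LIMSEQ_unique[symmetric])
next
  fix c f h assume "f \<in> carr completion" "h \<in> carr completion"
  then obtain s t where a: "approx s f" "approx t h" unfolding carr_completion by blast
  have "(\<lambda>n. c * ip P (s n) (t n)) \<longlonglongrightarrow> c * ip completion f h"
    by (intro tendsto_intros approx_ip a)
  moreover have "(\<lambda>n. c * ip P (s n) (t n)) \<longlonglongrightarrow> ip completion (c *\<^sub>C f) h"
    using approx_ip[OF approx_scale[OF a(1)] a(2)] approxD[OF a(1)] approxD[OF a(2)]
    by (simp add: ip_scale_left)
  ultimately show "ip completion (c *\<^sub>C f) h = c * ip completion f h"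
    by (rule LIMSEQ_unique[symmetric])
next
  fix f h assume "f \<in> carr completion" "h \<in> carr completion"
  then obtain s t where a: "approx s f" "approx t h" unfolding carr_completion by blast
  have "(\<lambda>n. cnj (ip P (s n) (t n))) \<longlonglongrightarrow> cnj (ip completion f h)"
    by (intro tendsto_intros approx_ip a)
  moreover have "cnj (ip P (s n) (t n)) = ip P (t n) (s n)" for n
    using ip_commute[of "s n" "t n"] approxD[OF a(1)] approxD[OF a(2)] by simp
  ultimately show "ip completion h f = cnj (ip completion f h)"
    using approx_ip[OF a(2,1)] by (auto intro: LIMSEQ_unique)
next
  fix f :: "'z \<Rightarrow> 'e" assume f: "f \<in> carr completion" and nz: "f \<noteq> 0"
  then obtain s where s: "approx s f" unfolding carr_completion by blast
  note sD = approxD[OF s]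
  have lim: "(\<lambda>n. Re (ip P (s n) (s n))) \<longlonglongrightarrow> Re (ip completion f f)"
    by (intro tendsto_intros approx_ip s)
  then have ge: "0 \<le> Re (ip completion f f)"
    by (rule LIMSEQ_le_const) (use sD ip_nonneg in auto)
  have "Re (ip completion f f) \<noteq> 0"
  proof
    assume "Re (ip completion f f) = 0"
    then have n0: "(\<lambda>n. hnorm P (s n)) \<longlonglongrightarrow> 0"
      using approx_norm[OF s] by (simp add: hnorm_def)
    have "f z = 0" for z
    proof (cases "z \<in> \<Omega>")
      case True
      obtain C where C: "C \<ge> 0" "\<And>x. x \<in> carr P \<Longrightarrow> hnorm E (J x z) \<le> C * hnorm P x"
        using J_bound[OF True] by blast
      have "hconverges E (\<lambda>n. J (s n) z) 0"
      proof (rule E.hconvergesI_bound)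
        show "(\<lambda>n. C * hnorm P (s n)) \<longlonglongrightarrow> 0" using tendsto_mult_left[OF n0, of C] by simp
      qed (use C sD J_in True in auto)
      then show ?thesis
        using E.hconverges_unique[of "\<lambda>n. J (s n) z" "f z" 0] sD True J_in by auto
    qed (use sD in auto)
    then show False using nz by (auto simp: fun_eq_iff)
  qed
  then show "0 < Re (ip completion f f)" using ge by simp
qed

lemma completion_dense:
  assumes f: "f \<in> carr completion" and e: "e > 0"
  shows "\<exists>x\<in>carr P. hnorm completion (f - J x) < e"
proof -
  obtain s where s: "approx s f" using f unfolding carr_completion by blast
  note sD = approxD[OF s]
  obtain N where N: "\<And>m n. m \<ge> N \<Longrightarrow> n \<ge> N \<Longrightarrow> hnorm P (s m - s n) < e / 2"
    using sD(2) e unfolding hCauchy_def by (meson half_gt_zero)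
  have "(\<lambda>n. hnorm P (s n - s N)) \<longlonglongrightarrow> hnorm completion (f - J (s N))"
    by (intro approx_norm approx_diff s approx_const sD)
  then have "hnorm completion (f - J (s N)) \<le> e / 2"
    by (rule LIMSEQ_le_const2) (use N in \<open>auto intro!: exI[of _ N] less_imp_le\<close>)
  then show ?thesis using sD e by (intro bexI[of _ "s N"]) auto
qed

lemma J_in_completion: "x \<in> carr P \<Longrightarrow> J x \<in> carr completion"
  unfolding carr_completion using approx_const by blast

lemma hnorm_completion_J: "x \<in> carr P \<Longrightarrow> hnorm completion (J x) = hnorm P x"
  using approx_norm[OF approx_const[of x]] by (simp add: LIMSEQ_const_iff)

text \<open>A Cauchy sequence of functions is shadowed within \<open>1 / real (Suc n)\<close> by
  \<open>J (s n)\<close>. Since \<open>J\<close> preserves norms, \<open>s\<close> is Cauchy in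
  \<open>P\<close>, and the pointwise limits of \<open>J (s n)\<close> assemble to the limit
  function.\<close>

lemma hilbert_space_completion: "hilbert_space completion"
  unfolding hilbert_space_def
proof (intro conjI allI impI inner_product_space_completion)
  interpret C: semi_ip completion
    by (rule semi_ip_inner_product_space[OF inner_product_space_completion])
  fix F :: "nat \<Rightarrow> 'z \<Rightarrow> 'e" assume "range F \<subseteq> carr completion \<and> hCauchy completion F"
  then have F: "\<And>n. F n \<in> carr completion" "hCauchy completion F" by auto
  have "\<exists>x\<in>carr P. hnorm completion (F n - J x) < 1 / real (Suc n)" for n
    by (rule completion_dense[OF F(1)]) simp
  then obtain s where s: "\<And>n. s n \<in> carr P" "\<And>n. hnorm completion (F n - J (s n)) < 1 / real (Suc n)"
    by metis
  have r0: "(\<lambda>n. 1 / real (Suc n)) \<longlonglongrightarrow> 0" using LIMSEQ_Suc[OF lim_1_over_n] by simp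
  have Js: "J (s n) \<in> carr completion" for n using s J_in_completion by blast
  have FJ: "hconverges completion (\<lambda>n. F n - J (s n)) 0"
    by (rule C.hconvergesI_bound[OF _ _ r0]) (use F Js s in \<open>auto intro: less_imp_le\<close>)
  \<comment> \<open>The sum equals \<open>J (s n)\<close>, written as a Cauchy sequence minus a null
    sequence so that sums and multiples of Cauchy sequences apply.\<close>
  have "hCauchy completion (\<lambda>n. F n + (- 1) *\<^sub>C (F n - J (s n)))"
    by (intro C.hCauchy_add C.hCauchy_scale C.hCauchyI_hconverges[OF _ _ FJ]) (use F Js in auto)
  then have "hCauchy completion (\<lambda>n. J (s n))" by simp
  moreover have "hnorm completion (J (s m) - J (s n)) = hnorm P (s m - s n)" for m n
  proof -
    have "J (s m) - J (s n) = J (s m - s n)" using s by (simp add: fun_eq_iff J_diff)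
    then show ?thesis using hnorm_completion_J[of "s m - s n"] s by simp
  qed
  ultimately have Cs: "hCauchy P s" by (simp add: hCauchy_def)
  have "\<exists>y. y \<in> carr E \<and> hconverges E (\<lambda>n. J (s n) z) y" if z: "z \<in> \<Omega>" for z
  proof -
    obtain C where C: "C \<ge> 0" "\<And>x. x \<in> carr P \<Longrightarrow> hnorm E (J x z) \<le> C * hnorm P x"
      using J_bound[OF z] by blast
    have "hCauchy E (\<lambda>n. J (s n) z)"
      unfolding hCauchy_def
    proof (intro allI impI)
      fix e :: real assume "e > 0"
      then have "e / (C + 1) > 0" using C by simp
      then obtain N where N: "\<And>m n. m \<ge> N \<Longrightarrow> n \<ge> N \<Longrightarrow> hnorm P (s m - s n) < e / (C + 1)"
        using Cs unfolding hCauchy_def by meson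
      have "hnorm E (J (s m) z - J (s n) z) < e" if "m \<ge> N" "n \<ge> N" for m n
      proof -
        have "hnorm E (J (s m) z - J (s n) z) \<le> C * hnorm P (s m - s n)"
          using C(2)[of "s m - s n"] s by (simp add: J_diff)
        moreover have "hnorm P (s m - s n) * (C + 1) < e"
          using N[OF that] C by (simp add: pos_less_divide_eq)
        moreover have "0 \<le> hnorm P (s m - s n)" using s by simp
        ultimately show ?thesis by (simp add: algebra_simps)
      qed
      then show "\<exists>N. \<forall>m\<ge>N. \<forall>k\<ge>N. hnorm E (J (s m) z - J (s k) z) < e" by blast
    qed
    then show ?thesis using E.complete[of "\<lambda>n. J (s n) z"] s J_in z by metis
  qed
  then obtain y where y: "\<And>z. z \<in> \<Omega> \<Longrightarrow> y z \<in> carr E \<and> hconverges E (\<lambda>n. J (s n) z) (y z)"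
    by metis
  define f where "f = (\<lambda>z. if z \<in> \<Omega> then y z else 0)"
  have f: "approx s f" unfolding approx_def using s Cs y by (auto simp: f_def)
  have fC: "f \<in> carr completion" using f carr_completion by blast
  have "hconverges completion (\<lambda>n. J (s n)) f"
    unfolding hconverges_def LIMSEQ_iff
  proof (intro allI impI)
    fix e :: real assume e: "e > 0"
    then obtain N where N: "\<And>m n. m \<ge> N \<Longrightarrow> n \<ge> N \<Longrightarrow> hnorm P (s m - s n) < e / 2"
      using Cs unfolding hCauchy_def by (meson half_gt_zero)
    have "hnorm completion (J (s n) - f) < e" if n: "n \<ge> N" for n
    proof -
      have "(\<lambda>m. hnorm P (s n - s m)) \<longlonglongrightarrow> hnorm completion (J (s n) - f)"
        by (intro approx_norm approx_diff f approx_const s)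
      then have "hnorm completion (J (s n) - f) \<le> e / 2"
        by (rule LIMSEQ_le_const2) (use N n in \<open>auto intro!: exI[of _ N] less_imp_le\<close>)
      then show ?thesis using e by simp
    qed
    then show "\<exists>no. \<forall>n\<ge>no. norm (hnorm completion (J (s n) - f) - 0) < e"
      using Js fC by (intro exI[of _ N]) simp
  qed
  from C.hconverges_add[OF _ _ FJ _ _ this] have "hconverges completion F f"
    using F Js fC by simp
  then show "\<exists>x\<in>carr completion. hconverges completion F x" using fC by blast
qed

lemma completion_reproducing:
  assumes f: "f \<in> carr completion" and z: "z \<in> \<Omega>" and \<eta>: "\<eta> \<in> carr E"
  shows "ip completion f (J (\<delta> z \<eta>)) = ip E (f z) \<eta>"
proof -
  obtain s where s: "approx s f" using f unfolding carr_completion by blast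
  note sD = approxD[OF s]
  have "(\<lambda>n. ip P (s n) (\<delta> z \<eta>)) \<longlonglongrightarrow> ip completion f (J (\<delta> z \<eta>))"
    by (intro approx_ip s approx_const delta_in z \<eta>)
  moreover have "(\<lambda>n. ip E (J (s n) z) \<eta>) \<longlonglongrightarrow> ip E (f z) \<eta>"
    using sD z \<eta> J_in by (intro E.hconverges_ip) auto
  ultimately show ?thesis using sD z \<eta> by (auto simp: ip_delta intro: LIMSEQ_unique)
qed

lemma completion_evaluation_bounded:
  assumes z: "z \<in> \<Omega>"
  shows "\<exists>C. \<forall>f\<in>carr completion. hnorm E (f z) \<le> C * hnorm completion f"
proof -
  obtain C where C: "\<And>x. x \<in> carr P \<Longrightarrow> hnorm E (J x z) \<le> C * hnorm P x"
    using J_bound[OF z] by blast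
  have "hnorm E (f z) \<le> C * hnorm completion f" if f: "f \<in> carr completion" for f
  proof -
    obtain s where s: "approx s f" using f unfolding carr_completion by blast
    note sD = approxD[OF s]
    show ?thesis
    proof (rule LIMSEQ_le)
      show "(\<lambda>n. hnorm E (J (s n) z)) \<longlonglongrightarrow> hnorm E (f z)"
        using sD z J_in by (intro E.hconverges_hnorm) auto
      show "(\<lambda>n. C * hnorm P (s n)) \<longlonglongrightarrow> C * hnorm completion f"
        by (intro tendsto_mult_left approx_norm s)
    qed (use C sD in auto)
  qed
  then show ?thesis by blast
qed

lemma completion_exists:
  "\<exists>F :: ('z \<Rightarrow> 'e) ip_space. hilbert_space F \<and>
     (\<forall>f\<in>carr F. (\<forall>z\<in>\<Omega>. f z \<in> carr E) \<and> (\<forall>z. z \<notin> \<Omega> \<longrightarrow> f z = 0)) \<and>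
     (\<forall>z\<in>\<Omega>. \<exists>C. \<forall>f\<in>carr F. hnorm E (f z) \<le> C * hnorm F f) \<and>
     (\<forall>w\<in>\<Omega>. \<forall>\<eta>\<in>carr E. J (\<delta> w \<eta>) \<in> carr F \<and> (\<forall>f\<in>carr F. ip F f (J (\<delta> w \<eta>)) = ip E (f w) \<eta>))"
  using hilbert_space_completion completion_reproducing J_in_completion delta_in approxD(3,4)
    completion_evaluation_bounded
  by (intro exI[of _ completion]) (auto simp: carr_completion)

end

section \<open>The Hilbert space of a positive operator valued kernel\<close>

lemma sum_fun_apply: "(\<Sum>i\<in>A. f i) x = (\<Sum>i\<in>A. f i x)"
  for f :: "'i \<Rightarrow> 'a \<Rightarrow> 'b::comm_monoid_add"
  by (induction A rule: infinite_finite_induct) auto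

text \<open>The prespace consists of the finitely supported functions \<open>\<phi>\<close>, standing for the formal sum of
  the kernel functions at \<open>w\<close> in direction \<open>\<phi> w\<close>.\<close>

theorem operator_kernel_rkhs_exists:
  fixes K :: "'z \<Rightarrow> 'z \<Rightarrow> 'e::complex_vector \<Rightarrow> 'e"
  assumes E: "hilbert_space E"
    and K_in: "\<And>z w \<eta>. \<lbrakk>z \<in> \<Omega>; w \<in> \<Omega>; \<eta> \<in> carr E\<rbrakk> \<Longrightarrow> K z w \<eta> \<in> carr E"
    and K_add: "\<And>z w \<eta> \<zeta>. \<lbrakk>z \<in> \<Omega>; w \<in> \<Omega>; \<eta> \<in> carr E; \<zeta> \<in> carr E\<rbrakk> \<Longrightarrow> K z w (\<eta> + \<zeta>) = K z w \<eta> + K z w \<zeta>"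
    and K_scale: "\<And>z w \<eta> c. \<lbrakk>z \<in> \<Omega>; w \<in> \<Omega>; \<eta> \<in> carr E\<rbrakk> \<Longrightarrow> K z w (c *\<^sub>C \<eta>) = c *\<^sub>C K z w \<eta>"
    and K_herm: "\<And>z w \<eta> \<zeta>. \<lbrakk>z \<in> \<Omega>; w \<in> \<Omega>; \<eta> \<in> carr E; \<zeta> \<in> carr E\<rbrakk> \<Longrightarrow>
      ip E (K w z \<zeta>) \<eta> = cnj (ip E (K z w \<eta>) \<zeta>)"
    and K_pos: "\<And>A \<phi>. \<lbrakk>finite A; A \<subseteq> \<Omega>; \<And>w. w \<in> A \<Longrightarrow> \<phi> w \<in> carr E\<rbrakk> \<Longrightarrow>
      0 \<le> Re (\<Sum>z\<in>A. \<Sum>w\<in>A. ip E (K z w (\<phi> w)) (\<phi> z))"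
    and K_bound: "\<And>z. z \<in> \<Omega> \<Longrightarrow> \<exists>C. \<forall>\<eta>\<in>carr E. Re (ip E (K z z \<eta>) \<eta>) \<le> C * (hnorm E \<eta>)\<^sup>2"
  shows "\<exists>F :: ('z \<Rightarrow> 'e) ip_space. hilbert_space F \<and>
     (\<forall>f\<in>carr F. (\<forall>z\<in>\<Omega>. f z \<in> carr E) \<and> (\<forall>z. z \<notin> \<Omega> \<longrightarrow> f z = 0)) \<and>
     (\<forall>z\<in>\<Omega>. \<exists>C. \<forall>f\<in>carr F. hnorm E (f z) \<le> C * hnorm F f) \<and>
     (\<forall>w\<in>\<Omega>. \<forall>\<eta>\<in>carr E. (\<lambda>z. if z \<in> \<Omega> then K z w \<eta> else 0) \<in> carr F \<and>
        (\<forall>f\<in>carr F. ip F f (\<lambda>z. if z \<in> \<Omega> then K z w \<eta> else 0) = ip E (f w) \<eta>))"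
proof -
  interpret E: hilbert E by (rule hilbertI[OF E])
  define supp where "supp = (\<lambda>\<phi> :: 'z \<Rightarrow> 'e. {z. \<phi> z \<noteq> 0})"
  define J where "J = (\<lambda>\<phi> z. if z \<in> \<Omega> then \<Sum>w\<in>supp \<phi>. K z w (\<phi> w) else 0)"
  define P where "P = \<lparr>carr = {\<phi>. finite (supp \<phi>) \<and> supp \<phi> \<subseteq> \<Omega> \<and> (\<forall>z. \<phi> z \<in> carr E)},
    ip = (\<lambda>\<phi> \<psi>. \<Sum>z\<in>supp \<psi>. ip E (J \<phi> z) (\<psi> z))\<rparr>"
  define \<delta> where "\<delta> = (\<lambda>(z :: 'z) (\<eta> :: 'e) x. if x = z then \<eta> else 0)"
  have P: "\<phi> \<in> carr P \<longleftrightarrow> finite (supp \<phi>) \<and> supp \<phi> \<subseteq> \<Omega> \<and> (\<forall>z. \<phi> z \<in> carr E)" for \<phi>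
    by (simp add: P_def)
  have K0: "K z w 0 = 0" if "z \<in> \<Omega>" "w \<in> \<Omega>" for z w
    using K_scale[OF that E.carr_zero, of 0] by simp
  \<comment> \<open>Zero directions contribute nothing, so the sum may run over any finite set
    containing the support. This lets several functions share one index set.\<close>
  have J_eq: "J \<phi> z = (\<Sum>w\<in>A. K z w (\<phi> w))"
    if "finite A" "supp \<phi> \<subseteq> A" "A \<subseteq> \<Omega>" "z \<in> \<Omega>" for \<phi> A z
    unfolding J_def using that by (auto simp: supp_def K0 subset_iff intro!: sum.mono_neutral_left)
  have J_in: "J \<phi> z \<in> carr E" if "\<phi> \<in> carr P" for \<phi> z
    using that by (auto simp: J_def P intro!: K_in E.carr_sum)
  have ip_eq: "ip P \<phi> \<psi> = (\<Sum>z\<in>A. ip E (J \<phi> z) (\<psi> z))"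
    if "finite A" "supp \<psi> \<subseteq> A" "\<phi> \<in> carr P" for \<phi> \<psi> A
    using that J_in[OF that(3)] by (auto simp: P_def supp_def intro!: sum.mono_neutral_left)
  have ip_eq2: "ip P \<phi> \<psi> = (\<Sum>z\<in>A. \<Sum>w\<in>A. ip E (K z w (\<phi> w)) (\<psi> z))"
    if A: "finite A" "supp \<phi> \<subseteq> A" "supp \<psi> \<subseteq> A" "A \<subseteq> \<Omega>" and "\<phi> \<in> carr P" "\<psi> \<in> carr P" for \<phi> \<psi> A
  proof -
    have "ip P \<phi> \<psi> = (\<Sum>z\<in>A. ip E (J \<phi> z) (\<psi> z))" using that by (intro ip_eq)
    also have "\<dots> = (\<Sum>z\<in>A. \<Sum>w\<in>A. ip E (K z w (\<phi> w)) (\<psi> z))"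
    proof (rule sum.cong[OF refl])
      fix z assume z: "z \<in> A"
      then have "J \<phi> z = (\<Sum>w\<in>A. K z w (\<phi> w))" using A by (intro J_eq) auto
      then show "ip E (J \<phi> z) (\<psi> z) = (\<Sum>w\<in>A. ip E (K z w (\<phi> w)) (\<psi> z))"
        using that z by (auto simp: P intro!: E.ip_sum_left K_in)
    qed
    finally show ?thesis .
  qed
  have P_add: "\<phi> + \<psi> \<in> carr P" and P_supp: "supp (\<phi> + \<psi>) \<subseteq> supp \<phi> \<union> supp \<psi>"
    if "\<phi> \<in> carr P" "\<psi> \<in> carr P" for \<phi> \<psi>
  proof -
    show "supp (\<phi> + \<psi>) \<subseteq> supp \<phi> \<union> supp \<psi>" by (auto simp: supp_def)
    then show "\<phi> + \<psi> \<in> carr P"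
      using that by (auto simp: P intro: finite_subset)
  qed
  have P_scale: "c *\<^sub>C \<phi> \<in> carr P" and P_supp_scale: "supp (c *\<^sub>C \<phi>) \<subseteq> supp \<phi>"
    if "\<phi> \<in> carr P" for c \<phi>
  proof -
    show "supp (c *\<^sub>C \<phi>) \<subseteq> supp \<phi>" by (auto simp: supp_def scaleC_fun_def)
    then show "c *\<^sub>C \<phi> \<in> carr P"
      using that by (auto simp: P scaleC_fun_def intro: finite_subset)
  qed
  have J_off: "J \<phi> z = 0" if "z \<notin> \<Omega>" for \<phi> z using that by (simp add: J_def)
  have J_add: "J (\<phi> + \<psi>) z = J \<phi> z + J \<psi> z" if "\<phi> \<in> carr P" "\<psi> \<in> carr P" for \<phi> \<psi> z
  proof (cases "z \<in> \<Omega>")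
    case True
    let ?A = "supp \<phi> \<union> supp \<psi>"
    have A: "finite ?A" "?A \<subseteq> \<Omega>" using that by (auto simp: P)
    have "J (\<phi> + \<psi>) z = (\<Sum>w\<in>?A. K z w (\<phi> w + \<psi> w))"
      using J_eq[OF A(1) P_supp[OF that] A(2) True] by simp
    also have "\<dots> = (\<Sum>w\<in>?A. K z w (\<phi> w)) + (\<Sum>w\<in>?A. K z w (\<psi> w))"
      unfolding sum.distrib[symmetric] using A(2) True that by (intro sum.cong K_add) (auto simp: P)
    also have "\<dots> = J \<phi> z + J \<psi> z"
      using J_eq[OF A(1) _ A(2) True, of \<phi>] J_eq[OF A(1) _ A(2) True, of \<psi>] by simp
    finally show ?thesis .
  qed (simp add: J_def)
  have J_scale: "J (c *\<^sub>C \<phi>) z = c *\<^sub>C J \<phi> z" if "\<phi> \<in> carr P" for c \<phi> z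
  proof (cases "z \<in> \<Omega>")
    case True
    have A: "finite (supp \<phi>)" "supp \<phi> \<subseteq> \<Omega>" using that by (auto simp: P)
    have "J (c *\<^sub>C \<phi>) z = (\<Sum>w\<in>supp \<phi>. K z w (c *\<^sub>C \<phi> w))"
      using J_eq[OF A(1) P_supp_scale[OF that] A(2) True] by (simp add: scaleC_fun_def)
    also have "\<dots> = (\<Sum>w\<in>supp \<phi>. c *\<^sub>C K z w (\<phi> w))"
      using A(2) True that by (intro sum.cong K_scale) (auto simp: P)
    also have "\<dots> = c *\<^sub>C J \<phi> z"
      using True by (simp add: J_def complex_vector.scale_sum_right)
    finally show ?thesis .
  qed (simp add: J_def)
  have semi: "semi_ip P"
  proof
    show "complex_vector.subspace (carr P)"
      unfolding complex_vector.subspace_def using P_add P_scale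
      by (auto simp: P supp_def)
  next
    fix \<phi> \<psi> \<xi> assume a: "\<phi> \<in> carr P" "\<psi> \<in> carr P" "\<xi> \<in> carr P"
    have f: "finite (supp \<xi>)" using a by (simp add: P)
    show "ip P (\<phi> + \<psi>) \<xi> = ip P \<phi> \<xi> + ip P \<psi> \<xi>"
      using a J_in P_add[OF a(1,2)]
      by (simp add: ip_eq[OF f] J_add E.ip_add_left sum.distrib P)
  next
    fix c \<phi> \<xi> assume a: "\<phi> \<in> carr P" "\<xi> \<in> carr P"
    have f: "finite (supp \<xi>)" using a by (simp add: P)
    show "ip P (c *\<^sub>C \<phi>) \<xi> = c * ip P \<phi> \<xi>"
      using a J_in P_scale[OF a(1)]
      by (simp add: ip_eq[OF f] J_scale E.ip_scale_left sum_distrib_left P)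
  next
    fix \<phi> \<psi> assume a: "\<phi> \<in> carr P" "\<psi> \<in> carr P"
    let ?A = "supp \<phi> \<union> supp \<psi>"
    have A: "finite ?A" "?A \<subseteq> \<Omega>" using a by (auto simp: P)
    have "ip P \<psi> \<phi> = (\<Sum>z\<in>?A. \<Sum>w\<in>?A. ip E (K z w (\<psi> w)) (\<phi> z))"
      using A a by (intro ip_eq2) auto
    also have "\<dots> = (\<Sum>z\<in>?A. \<Sum>w\<in>?A. cnj (ip E (K w z (\<phi> z)) (\<psi> w)))"
      using A a by (intro sum.cong refl K_herm) (auto simp: P)
    also have "\<dots> = cnj (\<Sum>w\<in>?A. \<Sum>z\<in>?A. ip E (K w z (\<phi> z)) (\<psi> w))"
      by (subst sum.swap) simp
    also have "(\<Sum>w\<in>?A. \<Sum>z\<in>?A. ip E (K w z (\<phi> z)) (\<psi> w)) = ip P \<phi> \<psi>"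
      using A a by (intro ip_eq2[symmetric]) auto
    finally show "ip P \<psi> \<phi> = cnj (ip P \<phi> \<psi>)" .
  next
    fix \<phi> assume a: "\<phi> \<in> carr P"
    then show "0 \<le> Re (ip P \<phi> \<phi>)"
      by (subst ip_eq2[of "supp \<phi>"], simp_all only: P)
         (use a in \<open>auto simp only: P intro!: K_pos\<close>)
  qed
  have supp_delta: "supp (\<delta> z \<eta>) \<subseteq> {z}" for z \<eta> by (auto simp: supp_def \<delta>_def)
  have delta_in: "\<delta> z \<eta> \<in> carr P" if "z \<in> \<Omega>" "\<eta> \<in> carr E" for z \<eta>
    using that supp_delta[of z \<eta>] by (auto simp: P \<delta>_def intro: finite_subset)
  have ip_delta: "ip P \<phi> (\<delta> z \<eta>) = ip E (J \<phi> z) \<eta>" if "\<phi> \<in> carr P" for \<phi> z \<eta>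
    using ip_eq[OF _ supp_delta that, of z \<eta>] by (simp add: \<delta>_def)
  have J_delta: "J (\<delta> w \<eta>) = (\<lambda>z. if z \<in> \<Omega> then K z w \<eta> else 0)" if "w \<in> \<Omega>" for w \<eta>
  proof
    fix z
    show "J (\<delta> w \<eta>) z = (if z \<in> \<Omega> then K z w \<eta> else 0)"
      using J_eq[OF _ supp_delta, of w z \<eta>] that by (cases "z \<in> \<Omega>") (auto simp: \<delta>_def J_def)
  qed
  interpret semi_ip P by (rule semi)
  interpret function_prespace P E \<Omega> J \<delta>
  proof
    fix z assume z: "z \<in> \<Omega>"
    obtain C where C: "\<And>\<eta>. \<eta> \<in> carr E \<Longrightarrow> Re (ip E (K z z \<eta>) \<eta>) \<le> C * (hnorm E \<eta>)\<^sup>2"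
      using K_bound[OF z] by blast
    \<comment> \<open>The squared norm of \<open>\<delta> z \<eta>\<close> is the diagonal form
      \<open>ip E (K z z \<eta>) \<eta>\<close>, which explains the root of the constant; the
      absolute value keeps the radicand nonnegative.\<close>
    have "hnorm P (\<delta> z \<eta>) \<le> sqrt \<bar>C\<bar> * hnorm E \<eta>" if \<eta>: "\<eta> \<in> carr E" for \<eta>
    proof (rule power2_le_imp_le)
      have "(hnorm P (\<delta> z \<eta>))\<^sup>2 = Re (ip E (K z z \<eta>) \<eta>)"
        using delta_in[OF z \<eta>] z by (simp add: hnorm_sq ip_delta J_delta)
      also have "\<dots> \<le> \<bar>C\<bar> * (hnorm E \<eta>)\<^sup>2"
        by (rule order_trans[OF C[OF \<eta>]]) (intro mult_right_mono, auto)
      finally show "(hnorm P (\<delta> z \<eta>))\<^sup>2 \<le> (sqrt \<bar>C\<bar> * hnorm E \<eta>)\<^sup>2"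
        by (simp add: power_mult_distrib)
    qed (use \<eta> in auto)
    then show "\<exists>C. \<forall>\<eta>\<in>carr E. hnorm P (\<delta> z \<eta>) \<le> C * hnorm E \<eta>" by blast
  next
    show "carr P \<subseteq> complex_vector.span {\<delta> z \<eta> |z \<eta>. z \<in> \<Omega> \<and> \<eta> \<in> carr E}"
    proof
      fix \<phi> assume a: "\<phi> \<in> carr P"
      have "\<phi> = (\<Sum>z\<in>supp \<phi>. \<delta> z (\<phi> z))"
        using a by (auto simp: fun_eq_iff sum_fun_apply \<delta>_def P supp_def)
      moreover have "(\<Sum>z\<in>supp \<phi>. \<delta> z (\<phi> z)) \<in> complex_vector.span {\<delta> z \<eta> |z \<eta>. z \<in> \<Omega> \<and> \<eta> \<in> carr E}"
        using a by (intro complex_vector.span_sum complex_vector.span_base) (auto simp: P)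
      ultimately show "\<phi> \<in> complex_vector.span {\<delta> z \<eta> |z \<eta>. z \<in> \<Omega> \<and> \<eta> \<in> carr E}" by simp
    qed
  qed (use J_add J_scale J_in delta_in ip_delta in \<open>auto simp: J_off\<close>)
  show ?thesis using completion_exists by (simp add: J_delta cong: ball_cong)
qed

section \<open>The Schur product\<close>

text \<open>Induction on the finite set: splitting off the component along \<open>\<phi> a\<close> leaves a rank one term,
  which is nonnegative by assumption, and a family vanishing at \<open>a\<close>.\<close>

lemma Schur_product_nonneg:
  fixes g :: "'z \<Rightarrow> 'z \<Rightarrow> complex" and F :: "'f::complex_vector ip_space"
  assumes F: "hilbert F" and "finite A"
    and g: "\<And>c. 0 \<le> Re (\<Sum>z\<in>A. \<Sum>w\<in>A. cnj (c z) * c w * g z w)"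
    and "\<And>w. w \<in> A \<Longrightarrow> \<phi> w \<in> carr F"
  shows "0 \<le> Re (\<Sum>z\<in>A. \<Sum>w\<in>A. g z w * ip F (\<phi> w) (\<phi> z))"
proof -
  interpret F: hilbert F by fact
  \<comment> \<open>The induction runs over a set \<open>B\<close> outside of which the family
    vanishes, while both sums keep ranging over all of \<open>A\<close>, where positivity of
    \<open>g\<close> is available.\<close>
  have "0 \<le> Re (\<Sum>z\<in>A. \<Sum>w\<in>A. g z w * ip F (\<phi> w) (\<phi> z))"
    if "finite B" "B \<subseteq> A" "\<And>w. w \<in> A \<Longrightarrow> \<phi> w \<in> carr F" "\<And>w. w \<in> A - B \<Longrightarrow> \<phi> w = 0" for B \<phi>
    using that
  proof (induction B arbitrary: \<phi> rule: finite_induct)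
    case empty
    then have "\<phi> w = 0" if "w \<in> A" for w using that by blast
    then show ?case by (simp cong: sum.cong)
  next
    case (insert a B)
    show ?case
    proof (cases "\<phi> a = 0")
      case True
      then show ?thesis using insert by (intro insert.IH) auto
    next
      case False
      have aF: "\<phi> a \<in> carr F" using insert by auto
      define e where "e = complex_of_real (1 / hnorm F (\<phi> a)) *\<^sub>C \<phi> a"
      have n: "hnorm F (\<phi> a) \<noteq> 0" using F.hnorm_eq_0_iff aF False by simp
      have eF: "e \<in> carr F" using aF by (simp add: e_def)
      have ee: "ip F e e = 1"
        using aF n F.ip_self[OF aF]
        by (simp add: e_def F.ip_scale_left F.ip_scale_right power2_eq_square)
      define c where "c = (\<lambda>w. ip F (\<phi> w) e)"
      define \<psi> where "\<psi> = (\<lambda>w. \<phi> w - c w *\<^sub>C e)"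
      have \<psi>F: "\<psi> w \<in> carr F" if "w \<in> A" for w using that insert eF by (simp add: \<psi>_def)
      have \<psi>e: "ip F (\<psi> w) e = 0" if "w \<in> A" for w
        using that insert eF ee by (simp add: \<psi>_def c_def F.ip_diff_left F.ip_scale_left)
      have ca: "c a = complex_of_real (hnorm F (\<phi> a))"
        using aF n by (simp add: c_def e_def F.ip_scale_right F.ip_self power2_eq_square)
      have "\<psi> a = 0"
        unfolding \<psi>_def ca e_def using n by (simp add: scaleC_one)
      moreover have "\<psi> w = 0" if "w \<in> A - insert a B" for w
        using insert.prems(3)[OF that] eF by (simp add: \<psi>_def c_def)
      ultimately have *: "0 \<le> Re (\<Sum>z\<in>A. \<Sum>w\<in>A. g z w * ip F (\<psi> w) (\<psi> z))"
        using insert.prems \<psi>F by (intro insert.IH) auto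
      have split: "ip F (\<phi> w) (\<phi> z) = cnj (c z) * c w + ip F (\<psi> w) (\<psi> z)" if "z \<in> A" "w \<in> A" for z w
      proof -
        have "\<phi> w = c w *\<^sub>C e + \<psi> w" "\<phi> z = c z *\<^sub>C e + \<psi> z" by (auto simp: \<psi>_def)
        moreover have "ip F e (\<psi> z) = 0" using F.ip_commute[OF \<psi>F eF] \<psi>e that by simp
        ultimately show ?thesis
          using that \<psi>F eF ee \<psi>e
          by (simp add: F.ip_add_left F.ip_add_right F.ip_scale_left F.ip_scale_right mult.commute)
      qed
      have "(\<Sum>z\<in>A. \<Sum>w\<in>A. g z w * ip F (\<phi> w) (\<phi> z))
          = (\<Sum>z\<in>A. \<Sum>w\<in>A. cnj (c z) * c w * g z w) + (\<Sum>z\<in>A. \<Sum>w\<in>A. g z w * ip F (\<psi> w) (\<psi> z))"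
        unfolding sum.distrib[symmetric] by (intro sum.cong refl) (simp add: split algebra_simps)
      then show ?thesis using g[of c] * by simp
    qed
  qed
  from this[of A \<phi>] assms show ?thesis by auto
qed

section \<open>Brehmer submodules\<close>

lemma mult_op_apply: "mult_op \<Omega> \<Theta> f w = (if w \<in> \<Omega> then \<Theta> w (f w) else 0)"
  by (simp add: mult_op_def)

lemma bounded_operatorI:
  "hilbert H \<Longrightarrow> semi_ip K \<Longrightarrow> bounded_op H K T \<Longrightarrow> bounded_operator H K T"
  by (simp add: bounded_operator_def bounded_semi_ip_op_def bounded_semi_ip_op_axioms_def hilbert_def)

section \<open>Closed subspaces, projections and partial isometries\<close>

lemma hilbert_closed_subspace:
  assumes "hilbert H" "closed_subspace H S"
  shows "hilbert (H\<lparr>carr := S\<rparr>)"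
proof -
  interpret H: hilbert H by fact
  have S: "complex_vector.subspace S" "S \<subseteq> carr H"
    "\<And>s x. range s \<subseteq> S \<Longrightarrow> x \<in> carr H \<Longrightarrow> hconverges H s x \<Longrightarrow> x \<in> S"
    using assms(2) unfolding closed_subspace_def by auto
  have n: "hnorm (H\<lparr>carr := S\<rparr>) = hnorm H" by (simp add: hnorm_def fun_eq_iff)
  have semi: "semi_ip (H\<lparr>carr := S\<rparr>)"
  proof
    show "ip (H\<lparr>carr := S\<rparr>) y x = cnj (ip (H\<lparr>carr := S\<rparr>) x y)"
      if "x \<in> carr (H\<lparr>carr := S\<rparr>)" "y \<in> carr (H\<lparr>carr := S\<rparr>)" for x y
      using that S(2) H.ip_commute[of x y] by auto
  qed (use S in \<open>auto simp: H.ip_add_left H.ip_scale_left H.ip_nonneg subset_iff\<close>)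
  interpret S: semi_ip "H\<lparr>carr := S\<rparr>" by (rule semi)
  have "inner_product_space (H\<lparr>carr := S\<rparr>)"
    unfolding inner_product_space_def
  proof (intro conjI ballI allI impI)
    fix x assume x: "x \<in> carr (H\<lparr>carr := S\<rparr>)" "x \<noteq> 0"
    then have "Re (ip H x x) \<noteq> 0" using H.ip_eq_0_iff S by auto
    then show "0 < Re (ip (H\<lparr>carr := S\<rparr>) x x)" using S.ip_nonneg[OF x(1)] by simp
  qed (fact S.subspace_carr S.ip_add_left S.ip_scale_left S.ip_commute)+
  moreover have "\<exists>x\<in>carr (H\<lparr>carr := S\<rparr>). hconverges (H\<lparr>carr := S\<rparr>) s x"
    if "range s \<subseteq> carr (H\<lparr>carr := S\<rparr>) \<and> hCauchy (H\<lparr>carr := S\<rparr>) s" for s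
  proof -
    have s: "range s \<subseteq> S" "hCauchy H s" using that by (auto simp: hCauchy_def n)
    then obtain x where x: "x \<in> carr H" "hconverges H s x"
      using H.complete[of s] S(2) by blast
    then have "x \<in> S" using S(3) s by blast
    then show ?thesis using x by (auto simp: hconverges_def n)
  qed
  ultimately have "hilbert_space (H\<lparr>carr := S\<rparr>)" unfolding hilbert_space_def by blast
  then show ?thesis by (rule hilbertI)
qed

text \<open>Phrased with an approximating sequence because projections are taken onto spans that may
  fail to be closed, so \<open>p\<close> itself may lie outside the subspace.\<close>

lemma (in hilbert) projection_norm_le:
  assumes x: "x \<in> carr H" and p: "p \<in> carr H" and s: "\<And>n. s n \<in> carr H" "hconverges H s p"
    and orth: "\<And>n. ip H (x - p) (s n) = 0"
  shows "ip H (x - p) p = 0" "hnorm H p \<le> hnorm H x"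
proof -
  have "(\<lambda>n. ip H (x - p) (s n)) \<longlonglongrightarrow> ip H (x - p) p"
    using x p s by (intro hconverges_ip) simp_all
  then show 0: "ip H (x - p) p = 0" by (simp add: orth LIMSEQ_const_iff)
  have "(hnorm H ((x - p) + p))\<^sup>2 = (hnorm H (x - p))\<^sup>2 + (hnorm H p)\<^sup>2"
    using x p 0 by (subst hnorm_sq_add) auto
  then have "(hnorm H p)\<^sup>2 \<le> (hnorm H x)\<^sup>2" by simp
  then show "hnorm H p \<le> hnorm H x" by (rule power2_le_imp_le) (use x in simp)
qed

text \<open>The definition of a partial isometry speaks of norms only. The kernel component of
  \<open>x\<close> contributes to neither side, and polarization recovers the inner product for the
  remaining component.\<close>

lemma partial_isometry_ip:
  assumes H: "hilbert H" and K: "semi_ip K" and T: "partial_isometry H K T"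
    and x: "x \<in> carr H" and u: "u \<in> carr H" and orth: "\<And>y. y \<in> carr H \<Longrightarrow> T y = 0 \<Longrightarrow> ip H u y = 0"
  shows "ip K (T x) (T u) = ip H x u"
proof -
  interpret H: hilbert H by fact
  interpret K: semi_ip K by fact
  have b: "bounded_op H K T"
    and iso: "\<And>x. x \<in> carr H \<Longrightarrow> (\<And>y. y \<in> carr H \<Longrightarrow> T y = 0 \<Longrightarrow> ip H x y = 0) \<Longrightarrow> hnorm K (T x) = hnorm H x"
    using T unfolding partial_isometry_def by auto
  interpret T: bounded_operator H K T by (rule bounded_operatorI[OF H K b])
  obtain C where C: "\<And>x. x \<in> carr H \<Longrightarrow> hnorm K (T x) \<le> C * hnorm H x" using T.bound by blast
  define N where "N = {y \<in> carr H. T y = 0}"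
  have N: "complex_vector.subspace N" "N \<subseteq> carr H"
    by (auto simp: complex_vector.subspace_def N_def T.add T.scale)
  obtain p s where p: "p \<in> carr H" "\<And>n. s n \<in> N" "hconverges H s p" "\<And>m. m \<in> N \<Longrightarrow> ip H (x - p) m = 0"
    using H.projection_exists[OF N x] by blast
  have sH: "s n \<in> carr H" for n using p(2) N by auto
  \<comment> \<open>\<open>p\<close> is a limit of kernel vectors, so its image is a limit of zeros.
    As \<open>K\<close> is only a semi-inner product space, this yields norm zero, which suffices
    through the Cauchy-Schwarz inequality.\<close>
  have "hconverges K (\<lambda>n. T (s n)) (T p)" using T.hconverges_image sH p by blast
  then have Tp: "hnorm K (T p) = 0"
    using p(2) T.maps[OF p(1)] K.hnorm_minus[of "T p"] by (simp add: N_def hconverges_def LIMSEQ_const_iff)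
  define v where "v = x - p"
  have v: "v \<in> carr H" "\<And>y. y \<in> carr H \<Longrightarrow> T y = 0 \<Longrightarrow> ip H v y = 0"
    using p x by (auto simp: v_def N_def)
  have "(\<lambda>n. ip H (s n) u) \<longlonglongrightarrow> ip H p u" using sH p u by (intro H.hconverges_ip) auto
  moreover have "ip H (s n) u = 0" for n
    using p(2)[of n] orth[of "s n"] H.ip_commute[OF u sH] by (simp add: N_def)
  ultimately have pu: "ip H p u = 0" by (simp add: LIMSEQ_const_iff)
  have "cmod (ip K (T p) (T u)) = 0"
    using K.Cauchy_Schwarz[of "T p" "T u"] Tp p(1) u by simp
  then have Tpu: "ip K (T p) (T u) = 0" by simp
  \<comment> \<open>The vectors \<open>v\<close>, \<open>c\<close> times \<open>u\<close> and their
    sum are all orthogonal to the kernel, so all three norms are preserved. The scalars 1 and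
    \<open>\<i>\<close> then give the real and the imaginary part.\<close>
  have re: "Re (ip K (T v) (c *\<^sub>C T u)) = Re (ip H v (c *\<^sub>C u))" for c
  proof -
    have cu: "c *\<^sub>C u \<in> carr H" using u by simp
    have o1: "ip H (c *\<^sub>C u) y = 0" if "y \<in> carr H" "T y = 0" for y
      using that orth u by (simp add: H.ip_scale_left)
    have o2: "ip H (v + c *\<^sub>C u) y = 0" if "y \<in> carr H" "T y = 0" for y
      using that o1 v u by (simp add: H.ip_add_left)
    have "hnorm K (T (v + c *\<^sub>C u)) = hnorm H (v + c *\<^sub>C u)" using v cu o2 by (intro iso) auto
    then have "hnorm K (T v + c *\<^sub>C T u) = hnorm H (v + c *\<^sub>C u)" using v u by (simp add: T.add T.scale)
    moreover have "hnorm K (T v) = hnorm H v" using v by (intro iso) auto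
    moreover have "hnorm K (T (c *\<^sub>C u)) = hnorm H (c *\<^sub>C u)" using cu o1 by (intro iso) auto
    then have "hnorm K (c *\<^sub>C T u) = hnorm H (c *\<^sub>C u)" using u by (simp add: T.scale)
    ultimately show ?thesis
      using K.hnorm_sq_add[of "T v" "c *\<^sub>C T u"] H.hnorm_sq_add[OF v(1) cu] v(1) u by simp
  qed
  have "ip K (T v) (T u) = ip H v u"
  proof (rule complex_eqI)
    show "Re (ip K (T v) (T u)) = Re (ip H v u)" using re[of 1] by (simp add: scaleC_one)
    show "Im (ip K (T v) (T u)) = Im (ip H v u)"
      using re[of \<i>] v(1) u by (simp add: H.ip_scale_right K.ip_scale_right)
  qed
  moreover have "ip H v u = ip H x u" using pu x p(1) u by (simp add: v_def H.ip_diff_left)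
  moreover have "ip K (T v) (T u) = ip K (T x) (T u)"
    using Tpu x p(1) u by (simp add: v_def T.diff K.ip_diff_left)
  ultimately show ?thesis by simp
qed

text \<open>The operator valued kernel is \<open>g z w\<close> times the identity of
  \<open>F\<close>; its quadratic form is \<open>g\<close> weighted by the Gram matrix of the
  directions, so its positivity is the Schur product lemma.\<close>

lemma scalar_rkhs_exists:
  fixes g :: "complex^'n \<Rightarrow> complex^'n \<Rightarrow> complex" and F :: "'f::complex_vector ip_space"
  assumes F: "hilbert_space F" and g: "scalar_kernel \<Omega> g"
    and herm: "\<And>z w. z \<in> \<Omega> \<Longrightarrow> w \<in> \<Omega> \<Longrightarrow> g w z = cnj (g z w)"
  shows "\<exists>HF. is_rkhs \<Omega> g F HF"
proof -
  interpret F: hilbert F by (rule hilbertI[OF F])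
  have psd: "0 \<le> Re (\<Sum>z\<in>A. \<Sum>w\<in>A. cnj (c z) * c w * g z w)" if "finite A" "A \<subseteq> \<Omega>" for A c
  proof -
    have "(\<Sum>z\<in>A. \<Sum>w\<in>A. cnj (c z) * c w * g z w) \<in> \<real>\<^sub>\<ge>\<^sub>0"
      using g that unfolding scalar_kernel_def by blast
    then show ?thesis unfolding complex_nonneg_Reals_iff by (rule conjunct1)
  qed
  have "\<exists>HF :: (complex^'n \<Rightarrow> 'f) ip_space. hilbert_space HF \<and>
     (\<forall>f\<in>carr HF. (\<forall>z\<in>\<Omega>. f z \<in> carr F) \<and> (\<forall>z. z \<notin> \<Omega> \<longrightarrow> f z = 0)) \<and>
     (\<forall>z\<in>\<Omega>. \<exists>C. \<forall>f\<in>carr HF. hnorm F (f z) \<le> C * hnorm HF f) \<and>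
     (\<forall>w\<in>\<Omega>. \<forall>\<eta>\<in>carr F. (\<lambda>z. if z \<in> \<Omega> then g z w *\<^sub>C \<eta> else 0) \<in> carr HF \<and>
        (\<forall>f\<in>carr HF. ip HF f (\<lambda>z. if z \<in> \<Omega> then g z w *\<^sub>C \<eta> else 0) = ip F (f w) \<eta>))"
  proof (rule operator_kernel_rkhs_exists[OF F])
    fix z w \<eta> \<zeta> assume "z \<in> \<Omega>" "w \<in> \<Omega>" "\<eta> \<in> carr F" "\<zeta> \<in> carr F"
    then show "ip F (g w z *\<^sub>C \<zeta>) \<eta> = cnj (ip F (g z w *\<^sub>C \<eta>) \<zeta>)"
      using herm[of z w] F.ip_commute[of \<eta> \<zeta>] by (simp only: F.ip_scale_left complex_cnj_mult)
  next
    fix A and \<phi> :: "complex^'n \<Rightarrow> 'f"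
    assume A: "finite A" "A \<subseteq> \<Omega>" "\<And>w. w \<in> A \<Longrightarrow> \<phi> w \<in> carr F"
    have "0 \<le> Re (\<Sum>z\<in>A. \<Sum>w\<in>A. g z w * ip F (\<phi> w) (\<phi> z))"
      by (rule Schur_product_nonneg[OF F.hilbert_axioms A(1) psd[OF A(1,2)] A(3)])
    also have "(\<Sum>z\<in>A. \<Sum>w\<in>A. g z w * ip F (\<phi> w) (\<phi> z)) = (\<Sum>z\<in>A. \<Sum>w\<in>A. ip F (g z w *\<^sub>C \<phi> w) (\<phi> z))"
      using A by (intro sum.cong refl) (simp add: F.ip_scale_left)
    finally show "0 \<le> Re (\<Sum>z\<in>A. \<Sum>w\<in>A. ip F (g z w *\<^sub>C \<phi> w) (\<phi> z))" .
  next
    fix z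
    have "Re (ip F (g z z *\<^sub>C \<eta>) \<eta>) \<le> cmod (g z z) * (hnorm F \<eta>)\<^sup>2" if "\<eta> \<in> carr F" for \<eta>
      using complex_Re_le_cmod[of "ip F (g z z *\<^sub>C \<eta>) \<eta>"] that
      by (simp add: F.ip_scale_left F.ip_self norm_mult norm_power)
    then show "\<exists>C. \<forall>\<eta>\<in>carr F. Re (ip F (g z z *\<^sub>C \<eta>) \<eta>) \<le> C * (hnorm F \<eta>)\<^sup>2" by blast
  qed (auto simp: scaleC_add_right mult.commute)
  then show ?thesis
    unfolding is_rkhs_def kernel_fun_def by (elim exE conjE) (rule exI, intro conjI, assumption+)
qed

section \<open>The submodule and its reproducing kernel\<close>

locale brehmer_setting =
  fixes \<Omega> :: "(complex^'n) set"
    and g :: "complex^'n \<Rightarrow> complex^'n \<Rightarrow> complex"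
    and a :: "'n coeffs"
    and E :: "'e::complex_vector ip_space"
    and HE :: "(complex^'n \<Rightarrow> 'e) ip_space"
    and S :: "(complex^'n \<Rightarrow> 'e) set"
  assumes E_hilbert: "hilbert_space E"
    and good: "good_kernel \<Omega> g"
    and inv: "inverse_is_polynomial \<Omega> g a"
    and rkhs: "is_rkhs \<Omega> g E HE"
    and submod: "submodule HE S"
begin

abbreviation HS where "HS \<equiv> HE\<lparr>carr := S\<rparr>"

sublocale E: hilbert E by (rule hilbertI[OF E_hilbert])
sublocale HE: hilbert HE using rkhs by (intro hilbertI) (simp add: is_rkhs_def)

lemma closed_S: "closed_subspace HE S"
  using submod by (simp add: submodule_def)

sublocale HS: hilbert HS by (rule hilbert_closed_subspace[OF HE.hilbert_axioms closed_S])

lemma S_subset: "f \<in> S \<Longrightarrow> f \<in> carr HE"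
  using closed_S by (auto simp: closed_subspace_def)

lemma hnorm_HS: "hnorm HS = hnorm HE"
  by (simp add: hnorm_def fun_eq_iff)

lemma value_in: "f \<in> carr HE \<Longrightarrow> z \<in> \<Omega> \<Longrightarrow> f z \<in> carr E"
  and value_off: "f \<in> carr HE \<Longrightarrow> z \<notin> \<Omega> \<Longrightarrow> f z = 0"
  using rkhs unfolding is_rkhs_def by auto

lemma kernel_in: "w \<in> \<Omega> \<Longrightarrow> \<eta> \<in> carr E \<Longrightarrow> kernel_fun \<Omega> g w \<eta> \<in> carr HE"
  and kernel_ip: "w \<in> \<Omega> \<Longrightarrow> \<eta> \<in> carr E \<Longrightarrow> f \<in> carr HE \<Longrightarrow> ip HE f (kernel_fun \<Omega> g w \<eta>) = ip E (f w) \<eta>"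
  using rkhs unfolding is_rkhs_def by auto

lemma g_nonzero: "z \<in> \<Omega> \<Longrightarrow> w \<in> \<Omega> \<Longrightarrow> g z w \<noteq> 0"
  using inv unfolding inverse_is_polynomial_def by blast

lemma g_inverse:
  "z \<in> \<Omega> \<Longrightarrow> w \<in> \<Omega> \<Longrightarrow>
    1 / g z w = (\<Sum>(k, l)\<in>coeff_support a. a k l * monomial z k * cnj (monomial w l))"
  using inv unfolding inverse_is_polynomial_def by blast

lemma scalar_kernel: "scalar_kernel \<Omega> g"
  using good by (simp add: good_kernel_def)

text \<open>\<open>g u v\<close> is an inner product of two kernel functions in the scalar space,
  and that inner product is conjugate symmetric.\<close>

lemma g_hermitian:
  assumes z: "z \<in> \<Omega>" and w: "w \<in> \<Omega>"
  shows "g w z = cnj (g z w)"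
proof -
  obtain H where H: "is_rkhs \<Omega> g complex_space H" using good unfolding good_kernel_def by blast
  interpret H: hilbert H using H by (intro hilbertI) (simp add: is_rkhs_def)
  have k: "kernel_fun \<Omega> g v 1 \<in> carr H" if "v \<in> \<Omega>" for v
    using H that unfolding is_rkhs_def by (simp add: complex_space_def)
  have e: "ip H (kernel_fun \<Omega> g v 1) (kernel_fun \<Omega> g u 1) = g u v" if "u \<in> \<Omega>" "v \<in> \<Omega>" for u v
  proof -
    have "ip H (kernel_fun \<Omega> g v 1) (kernel_fun \<Omega> g u 1) = ip complex_space (kernel_fun \<Omega> g v 1 u) 1"
      using H that k[of v] unfolding is_rkhs_def by (simp add: complex_space_def)
    then show ?thesis using that by (simp add: complex_space_def kernel_fun_def scaleC_complex_def)
  qed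
  show ?thesis using H.ip_commute[OF k[OF w] k[OF z]] e[OF z w] e[OF w z] by simp
qed

text \<open>The projection of the kernel function to \<open>S\<close>.\<close>

definition skernel :: "complex^'n \<Rightarrow> 'e \<Rightarrow> complex^'n \<Rightarrow> 'e" where
  "skernel w \<eta> = (SOME k. k \<in> S \<and> (\<forall>f\<in>S. ip HE f k = ip E (f w) \<eta>))"

text \<open>The kernel function and its projection differ by a vector orthogonal to
  \<open>S\<close>, so both have the same inner products with elements of \<open>S\<close>.\<close>

lemma skernel:
  assumes w: "w \<in> \<Omega>" and \<eta>: "\<eta> \<in> carr E"
  shows "skernel w \<eta> \<in> S" "f \<in> S \<Longrightarrow> ip HE f (skernel w \<eta>) = ip E (f w) \<eta>"
proof -
  let ?K = "kernel_fun \<Omega> g w \<eta>"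
  obtain p where p: "p \<in> S" "\<And>m. m \<in> S \<Longrightarrow> ip HE (?K - p) m = 0"
    using HE.closed_projection_exists[OF closed_S kernel_in[OF w \<eta>]] by blast
  have "ip HE f p = ip E (f w) \<eta>" if f: "f \<in> S" for f
  proof -
    have in': "?K \<in> carr HE" "p \<in> carr HE" "f \<in> carr HE" using p f kernel_in w \<eta> S_subset by auto
    then have "ip HE f (?K - p) = 0"
      using HE.ip_commute[of "?K - p" f] p(2)[OF f] by simp
    then show ?thesis using in' kernel_ip[OF w \<eta>] by (simp add: HE.ip_diff_right)
  qed
  then have "p \<in> S \<and> (\<forall>f\<in>S. ip HE f p = ip E (f w) \<eta>)" using p by blast
  then have *: "skernel w \<eta> \<in> S \<and> (\<forall>f\<in>S. ip HE f (skernel w \<eta>) = ip E (f w) \<eta>)"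
    unfolding skernel_def by (rule someI[of "\<lambda>k. k \<in> S \<and> (\<forall>f\<in>S. ip HE f k = ip E (f w) \<eta>)"])
  then show "skernel w \<eta> \<in> S" "f \<in> S \<Longrightarrow> ip HE f (skernel w \<eta>) = ip E (f w) \<eta>" by auto
qed

lemma skernel_value_in: "\<lbrakk>w \<in> \<Omega>; z \<in> \<Omega>; \<eta> \<in> carr E\<rbrakk> \<Longrightarrow> skernel w \<eta> z \<in> carr E"
  using skernel(1) S_subset value_in by blast

text \<open>Orthogonality says that each value of \<open>f\<close> is orthogonal to all of
  \<open>E\<close>. Both the density of the span and the boundedness of the coordinate
  multiplications rest on this.\<close>

lemma skernel_total:
  assumes f: "f \<in> S" and orth: "\<And>w \<eta>. w \<in> \<Omega> \<Longrightarrow> \<eta> \<in> carr E \<Longrightarrow> ip HE f (skernel w \<eta>) = 0"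
  shows "f = 0"
proof
  fix z
  show "f z = 0 z"
  proof (cases "z \<in> \<Omega>")
    case True
    have "f z = 0"
    proof (rule E.eqI_ip)
      show "f z \<in> carr E" using f True S_subset value_in by blast
    qed (use skernel(2)[OF True _ f] orth[OF True] in auto)
    then show ?thesis by simp
  qed (use f S_subset value_off in auto)
qed

text \<open>\<open>skernel\<close> is fixed by a choice, so additivity comes from uniqueness: both
  sides have the same inner product with every element of \<open>S\<close>.\<close>

lemma skernel_add:
  assumes "w \<in> \<Omega>" "\<eta> \<in> carr E" "\<zeta> \<in> carr E"
  shows "skernel w (\<eta> + \<zeta>) = skernel w \<eta> + skernel w \<zeta>"
proof -
  have in': "skernel w (\<eta> + \<zeta>) \<in> S" "skernel w \<eta> \<in> S" "skernel w \<zeta> \<in> S"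
    using assms skernel(1) by auto
  show ?thesis
  proof (rule HS.eqI_ip)
    fix f assume f: "f \<in> carr HS"
    have "ip HE f (skernel w (\<eta> + \<zeta>)) = ip HE f (skernel w \<eta> + skernel w \<zeta>)"
      using assms f in' value_in S_subset by (simp add: skernel(2) HE.ip_add_right E.ip_add_right)
    then show "ip HS (skernel w (\<eta> + \<zeta>)) f = ip HS (skernel w \<eta> + skernel w \<zeta>) f"
      using in' f S_subset HE.ip_commute[of f "skernel w (\<eta> + \<zeta>)"]
        HE.ip_commute[of f "skernel w \<eta> + skernel w \<zeta>"] by simp
  qed (use in' HS.carr_add in auto)
qed

lemma skernel_scale:
  assumes "w \<in> \<Omega>" "\<eta> \<in> carr E"
  shows "skernel w (c *\<^sub>C \<eta>) = c *\<^sub>C skernel w \<eta>"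
proof -
  have in': "skernel w (c *\<^sub>C \<eta>) \<in> S" "skernel w \<eta> \<in> S"
    using assms skernel(1) by auto
  show ?thesis
  proof (rule HS.eqI_ip)
    fix f assume f: "f \<in> carr HS"
    have "ip HE f (skernel w (c *\<^sub>C \<eta>)) = ip HE f (c *\<^sub>C skernel w \<eta>)"
      using assms f in' value_in S_subset by (simp add: skernel(2) HE.ip_scale_right E.ip_scale_right)
    then show "ip HS (skernel w (c *\<^sub>C \<eta>)) f = ip HS (c *\<^sub>C skernel w \<eta>) f"
      using in' f S_subset HE.ip_commute[of f "skernel w (c *\<^sub>C \<eta>)"]
        HE.ip_commute[of f "c *\<^sub>C skernel w \<eta>"] by simp
  qed (use in' HS.carr_scale in auto)
qed

abbreviation skernels where
  "skernels \<equiv> (\<lambda>(w, \<eta>). skernel w \<eta>) ` (\<Omega> \<times> carr E)"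

lemma S_dense_sequence:
  assumes "f \<in> S"
  obtains s where "\<And>n. s n \<in> complex_vector.span skernels" "\<And>n. s n \<in> S" "hconverges HE s f"
proof -
  let ?M = "complex_vector.span skernels"
  have M: "complex_vector.subspace ?M" "?M \<subseteq> carr HS"
    by (rule complex_vector.subspace_span, rule complex_vector.span_minimal[OF _ HS.subspace_carr])
       (use skernel(1) in auto)
  have total: "y = 0" if y: "y \<in> carr HS" "\<And>m. m \<in> ?M \<Longrightarrow> ip HS y m = 0" for y
  proof (rule skernel_total)
    fix w \<eta> assume "w \<in> \<Omega>" "\<eta> \<in> carr E"
    then have "skernel w \<eta> \<in> ?M" by (intro complex_vector.span_base) auto
    then show "ip HE y (skernel w \<eta>) = 0" using y(2) by simp
  qed (use y in simp)
  have "f \<in> carr HS" using assms by simp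
  then obtain s where s: "\<And>n. s n \<in> ?M" "hconverges HS s f"
    using HS.dense_sequence[OF M _ total] by blast
  then show thesis using that[of s] M by (auto simp: hconverges_def hnorm_HS)
qed

section \<open>Coordinate multiplications on \<open>S\<close> and the operator
  \<open>\<Delta>\<close>\<close>

lemma coord_mult_S: "f \<in> S \<Longrightarrow> coord_mult j f \<in> S"
  using submod by (auto simp: submodule_def)

lemma coord_mult_skernel:
  assumes "w \<in> \<Omega>" "\<eta> \<in> carr E" "f \<in> S"
  shows "ip HE (coord_mult j f) (skernel w \<eta>) = w $ j * ip HE f (skernel w \<eta>)"
  using assms coord_mult_S[of f j] value_in S_subset
  by (simp add: skernel(2)) (simp add: coord_mult_def E.ip_scale_left)

text \<open>The formal adjoint of multiplication by the coordinate \<open>j\<close> multiplies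
  \<open>skernel w \<eta>\<close> by \<open>cnj (w $ j)\<close>. These vectors are total in
  \<open>S\<close>, so the Hellinger-Toeplitz lemma gives the norm bound.\<close>

lemma bounded_op_coord_mult: "bounded_op HS HS (coord_mult j)"
proof (rule HS.bounded_op_if_adjoint_on_total[where G = skernels])
  fix y assume "y \<in> skernels"
  then obtain w \<eta> where w: "w \<in> \<Omega>" "\<eta> \<in> carr E" and y: "y = skernel w \<eta>" by auto
  have "ip HS (coord_mult j f) y = ip HS f (cnj (w $ j) *\<^sub>C y)" if f: "f \<in> carr HS" for f
    using f w S_subset skernel(1)[OF w] by (simp add: y coord_mult_skernel HE.ip_scale_right)
  then show "\<exists>y'\<in>carr HS. \<forall>f\<in>carr HS. ip HS (coord_mult j f) y = ip HS f y'"
    using skernel(1)[OF w] HS.carr_scale by (intro bexI[of _ "cnj (w $ j) *\<^sub>C y"]) (auto simp: y)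
next
  fix y assume y: "y \<in> carr HS" "\<And>m. m \<in> skernels \<Longrightarrow> ip HS y m = 0"
  show "y = 0" by (rule skernel_total) (use y in auto)
qed (use coord_mult_S skernel(1) in
    \<open>auto simp: coord_mult_def scaleC_add_right scaleC_fun_def mult.commute\<close>)

lemma coord_mult_operator: "bounded_operator HS HS (coord_mult j)"
  by (intro bounded_operatorI HS.hilbert_axioms HS.semi_ip_axioms bounded_op_coord_mult)

text \<open>The extra scalar \<open>c\<close> lets the eigenvector relation be iterated through the
  monomials.\<close>

lemma hadjoint_coord_mult_skernel:
  assumes w: "w \<in> \<Omega>" "\<eta> \<in> carr E"
  shows "hadjoint HS HS (coord_mult j) (c *\<^sub>C skernel w \<eta>) = (c * cnj (w $ j)) *\<^sub>C skernel w \<eta>"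
proof (rule hadjoint_eqI[OF HS.hilbert_axioms])
  show "(c * cnj (w $ j)) *\<^sub>C skernel w \<eta> \<in> carr HS" using skernel(1)[OF w] HS.carr_scale by simp
  fix u assume "u \<in> carr HS"
  then show "ip HS (coord_mult j u) (c *\<^sub>C skernel w \<eta>) = ip HS u ((c * cnj (w $ j)) *\<^sub>C skernel w \<eta>)"
    using w S_subset skernel(1)[OF w] coord_mult_S[of u j]
    by (simp add: HE.ip_scale_right coord_mult_skernel)
qed

abbreviation \<Delta> where "\<Delta> \<equiv> poly_op a HS coord_mult"

lemma bounded_op_Delta: "bounded_op HS HS \<Delta>"
proof -
  interpret R: bounded_operator HS HS "coord_mult j" for j by (rule coord_mult_operator)
  have *: "bounded_op HS HS (\<lambda>x. c *\<^sub>C op_monomial coord_mult k (op_monomial (\<lambda>j. hadjoint HS HS (coord_mult j)) l x))"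
    for c k l
  proof (rule bounded_op_scaleC[OF HS.semi_ip_axioms HS.semi_ip_axioms])
    have "bounded_op HS HS (op_monomial coord_mult k \<circ> op_monomial (\<lambda>j. hadjoint HS HS (coord_mult j)) l)"
      by (intro bounded_op_comp[where K = HS] bounded_op_op_monomial HS.semi_ip_axioms
          bounded_op_coord_mult R.bounded_op_hadjoint)
    then show "bounded_op HS HS (\<lambda>x. op_monomial coord_mult k (op_monomial (\<lambda>j. hadjoint HS HS (coord_mult j)) l x))"
      by (simp add: o_def)
  qed
  have "bounded_op HS HS (\<lambda>x. \<Sum>kl\<in>coeff_support a. (case kl of (k, l) \<Rightarrow>
      a k l *\<^sub>C op_monomial coord_mult k (op_monomial (\<lambda>j. hadjoint HS HS (coord_mult j)) l x)))"
  proof (rule bounded_op_sum[OF HS.semi_ip_axioms HS.semi_ip_axioms])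
    fix kl
    show "bounded_op HS HS (\<lambda>x. case kl of (k, l) \<Rightarrow>
      a k l *\<^sub>C op_monomial coord_mult k (op_monomial (\<lambda>j. hadjoint HS HS (coord_mult j)) l x))"
      using * by (cases kl) simp
  qed
  then show ?thesis unfolding poly_op_def[abs_def] .
qed

sublocale D: bounded_operator HS HS \<Delta>
  by (intro bounded_operatorI HS.hilbert_axioms HS.semi_ip_axioms bounded_op_Delta)

lemma Delta_S [simp]: "f \<in> S \<Longrightarrow> \<Delta> f \<in> S"
  using D.maps by simp

lemma op_monomial_coord_mult: "op_monomial coord_mult k f z = monomial z k *\<^sub>C f z"
  for f :: "complex^'n \<Rightarrow> 'e"
  by (rule op_monomial_scalar[where R = "\<lambda>c y. y z = c *\<^sub>C f z"])
     (auto simp: coord_mult_def scaleC_one mult.commute)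

lemma op_monomial_hadjoint_skernel:
  assumes "w \<in> \<Omega>" "\<eta> \<in> carr E"
  shows "op_monomial (\<lambda>j. hadjoint HS HS (coord_mult j)) l (skernel w \<eta>)
    = cnj (monomial w l) *\<^sub>C skernel w \<eta>"
proof -
  have "op_monomial (\<lambda>j. hadjoint HS HS (coord_mult j)) l (skernel w \<eta>)
    = monomial (\<chi> j. cnj (w $ j)) l *\<^sub>C skernel w \<eta>"
    by (rule op_monomial_scalar[where R = "\<lambda>c y. y = c *\<^sub>C skernel w \<eta>"])
       (use assms in \<open>auto simp: hadjoint_coord_mult_skernel scaleC_one\<close>)
  then show ?thesis by (simp add: monomial_def)
qed

text \<open>In each term the adjoints act first and meet an eigenvector, producing the conjugate
  monomial in \<open>w\<close>; the multiplications then act on values, producing the monomial in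
  \<open>z\<close>. The terms add up to the polynomial for \<open>1 / g z w\<close>.\<close>

lemma Delta_skernel:
  assumes "w \<in> \<Omega>" "z \<in> \<Omega>" "\<eta> \<in> carr E"
  shows "\<Delta> (skernel w \<eta>) z = (1 / g z w) *\<^sub>C skernel w \<eta> z"
proof -
  have "\<Delta> (skernel w \<eta>) z = (\<Sum>(k, l)\<in>coeff_support a.
      (a k l * monomial z k * cnj (monomial w l)) *\<^sub>C skernel w \<eta> z)"
    unfolding poly_op_def sum_fun_apply
    using assms by (intro sum.cong refl)
      (auto simp: op_monomial_hadjoint_skernel scaleC_fun_def op_monomial_coord_mult mult_ac)
  also have "\<dots> = (\<Sum>(k, l)\<in>coeff_support a. a k l * monomial z k * cnj (monomial w l)) *\<^sub>C skernel w \<eta> z"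
    unfolding complex_vector.scale_sum_left by (intro sum.cong refl) auto
  finally show ?thesis using g_inverse[OF assms(2,1)] by simp
qed

lemma Delta_skernel_ip:
  assumes "w \<in> \<Omega>" "z \<in> \<Omega>" "\<eta> \<in> carr E" "\<zeta> \<in> carr E"
  shows "ip HE (\<Delta> (skernel w \<eta>)) (skernel z \<zeta>) = ip E (skernel w \<eta> z) \<zeta> / g z w"
  using assms skernel(2)[of z \<zeta> "\<Delta> (skernel w \<eta>)"]
  by (simp add: skernel(1) Delta_skernel E.ip_scale_left skernel_value_in)

text \<open>On combinations of the \<open>skernel w \<eta>\<close> the form of
  \<open>\<Delta>\<close> is the squared norm of the same combination of the vectors
  \<open>ad w \<eta>\<close> in \<open>F\<close>; positivity then passes to limits by continuity of
  \<open>\<Delta>\<close>.\<close>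

lemma multiplier_range_imp_Brehmer:
  fixes F :: "'f::complex_vector ip_space"
  assumes F: "hilbert_space F" and range: "is_multiplier_range \<Omega> g E HE S F"
  shows "Brehmer_submodule a HE S"
proof -
  interpret F: hilbert F by (rule hilbertI[OF F])
  obtain HF \<Theta> where HF: "is_rkhs \<Omega> g F HF"
    and M: "is_multiplier \<Omega> F HF E HE \<Theta>" and V: "partial_isometry HF HE (mult_op \<Omega> \<Theta>)"
    and S: "S = mult_op \<Omega> \<Theta> ` carr HF"
    using range unfolding is_multiplier_range_def partially_isometric_multiplier_def by blast
  interpret HF: hilbert HF using HF by (intro hilbertI) (simp add: is_rkhs_def)
  have HF_value: "f z \<in> carr F" if "f \<in> carr HF" "z \<in> \<Omega>" for f z
    using HF that unfolding is_rkhs_def by blast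
  have HF_kernel: "kernel_fun \<Omega> g w \<eta> \<in> carr HF" if "w \<in> \<Omega>" "\<eta> \<in> carr F" for w \<eta>
    using HF that unfolding is_rkhs_def by blast
  have HF_ip: "ip HF f (kernel_fun \<Omega> g w \<eta>) = ip F (f w) \<eta>" if "w \<in> \<Omega>" "\<eta> \<in> carr F" "f \<in> carr HF" for w \<eta> f
    using HF that unfolding is_rkhs_def by blast
  have \<Theta>: "bounded_operator F E (\<Theta> w)" if "w \<in> \<Omega>" for w
    using M that unfolding is_multiplier_def
    by (intro bounded_operatorI F.hilbert_axioms E.semi_ip_axioms) blast
  define ad where "ad = (\<lambda>w \<eta>. hadjoint F E (\<Theta> w) \<eta>)"
  have ad_in: "ad w \<eta> \<in> carr F" if "w \<in> \<Omega>" "\<eta> \<in> carr E" for w \<eta>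
    using bounded_operator.hadjoint_in[OF \<Theta>] that by (simp add: ad_def)
  have ad_ip: "ip F y (ad w \<eta>) = ip E (\<Theta> w y) \<eta>" if "w \<in> \<Omega>" "\<eta> \<in> carr E" "y \<in> carr F" for w \<eta> y
    using bounded_operator.hadjoint_ip[OF \<Theta>] that by (simp add: ad_def)
  \<comment> \<open>The adjoint of multiplication by \<open>\<Theta>\<close> sends the kernel
    function at \<open>w\<close> to \<open>g\<close> times the adjoint of \<open>\<Theta> w\<close>
    applied to \<open>\<eta>\<close>. A partial isometry composed with its adjoint is the projection
    onto its range, here \<open>S\<close>.\<close>
  have V_kernel: "mult_op \<Omega> \<Theta> (kernel_fun \<Omega> g w (ad w \<eta>)) = skernel w \<eta>"
    if w: "w \<in> \<Omega>" "\<eta> \<in> carr E" for w \<eta>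
  proof (rule HS.eqI_ip)
    let ?u = "kernel_fun \<Omega> g w (ad w \<eta>)"
    have u: "?u \<in> carr HF" using HF_kernel ad_in w by blast
    have Vu: "mult_op \<Omega> \<Theta> ?u \<in> S" using u S by blast
    show "mult_op \<Omega> \<Theta> ?u \<in> carr HS" using Vu by simp
    show "skernel w \<eta> \<in> carr HS" using skernel(1)[OF w] by simp
    fix f assume "f \<in> carr HS"
    then obtain x where x: "x \<in> carr HF" and f: "f = mult_op \<Omega> \<Theta> x" "f \<in> S" using S by auto
    have u_ip: "ip HF y ?u = ip E (mult_op \<Omega> \<Theta> y w) \<eta>" if "y \<in> carr HF" for y
      using that w ad_in HF_value by (simp add: HF_ip ad_ip mult_op_apply)
    \<comment> \<open>By \<open>u_ip\<close> the inner product with \<open>?u\<close> sees only the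
      value of the image at \<open>w\<close>, so \<open>?u\<close> is orthogonal to the kernel and
      \<open>partial_isometry_ip\<close> applies.\<close>
    have "ip HF ?u y = 0" if "y \<in> carr HF" "mult_op \<Omega> \<Theta> y = 0" for y
      using u_ip[OF that(1)] that HF.ip_commute[OF that(1) u] w by simp
    then have "ip HE f (mult_op \<Omega> \<Theta> ?u) = ip HF x ?u"
      unfolding f using partial_isometry_ip[OF HF.hilbert_axioms HE.semi_ip_axioms V x u] by blast
    also have "\<dots> = ip HE f (skernel w \<eta>)"
      using u_ip[OF x] skernel(2)[OF w f(2)] f(1) by simp
    finally have "ip HE f (mult_op \<Omega> \<Theta> ?u) = ip HE f (skernel w \<eta>)" .
    then show "ip HS (mult_op \<Omega> \<Theta> ?u) f = ip HS (skernel w \<eta>) f"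
      using HE.ip_commute[OF S_subset[OF f(2)] S_subset[OF Vu]]
        HE.ip_commute[OF S_subset[OF f(2)] S_subset[OF skernel(1)[OF w]]] by simp
  qed
  \<comment> \<open>The factor \<open>g z w\<close> of the kernel function in \<open>HF\<close>
    cancels against the division performed by \<open>\<Delta>\<close>.\<close>
  have key: "ip HE (\<Delta> (skernel w \<eta>)) (skernel z \<zeta>) = ip F (ad w \<eta>) (ad z \<zeta>)"
    if "w \<in> \<Omega>" "z \<in> \<Omega>" "\<eta> \<in> carr E" "\<zeta> \<in> carr E" for w z \<eta> \<zeta>
  proof -
    interpret \<Theta>: bounded_operator F E "\<Theta> z" by (rule \<Theta>[OF that(2)])
    have "skernel w \<eta> z = g z w *\<^sub>C \<Theta> z (ad w \<eta>)"
      unfolding V_kernel[OF that(1,3), symmetric]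
      using that ad_in by (simp add: mult_op_apply kernel_fun_def \<Theta>.scale)
    then show ?thesis
      using that ad_in g_nonzero by (simp add: Delta_skernel_ip E.ip_scale_left ad_ip)
  qed
  define G where "G = (\<lambda>(w, \<eta>). (skernel w \<eta>, ad w \<eta>)) ` (\<Omega> \<times> carr E)"
  have G: "G \<subseteq> carr HS \<times> carr F" using skernel(1) ad_in by (auto simp: G_def)
  have fstG: "fst ` G = skernels" by (auto simp: G_def image_image split_beta)
  have "ip HS (\<Delta> f) f \<in> \<real>\<^sub>\<ge>\<^sub>0" if f: "f \<in> carr HS" for f
  proof -
    obtain s where s: "\<And>n. s n \<in> complex_vector.span skernels" "\<And>n. s n \<in> S" "hconverges HE s f"
      using S_dense_sequence f by auto
    have sc: "hconverges HS s f" using s(3) by (simp add: hconverges_def hnorm_HS)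
    have lim: "(\<lambda>n. ip HS (\<Delta> (s n)) (s n)) \<longlonglongrightarrow> ip HS (\<Delta> f) f"
      using s(2) f sc by (intro HS.hconverges_ip D.hconverges_image) auto
    have "ip HS (\<Delta> (s n)) (s n) \<in> \<real>\<^sub>\<ge>\<^sub>0" for n
    proof -
      have "s n \<in> fst ` complex_vector.span G" using s(1)[of n] by (simp only: span_image_fst[symmetric] fstG)
      then obtain p where p: "p \<in> complex_vector.span G" "s n = fst p" by (rule imageE)
      have "ip HS (\<Delta> (fst p)) (fst p) = ip F (snd p) (snd p)"
        by (rule span_pairs_form_eq[OF HS.semi_ip_axioms F.semi_ip_axioms G, where T = \<Delta>])
           (use p(1) key in \<open>auto simp: G_def D.add[simplified] D.scale[simplified] HS.carr_scale[simplified]\<close>)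
      moreover have "snd p \<in> carr F"
        by (rule span_pairs_in[OF HS.semi_ip_axioms F.semi_ip_axioms G p(1)])
      ultimately show ?thesis using p(2) by (simp add: F.ip_self)
    qed
    then show ?thesis by (intro closed_sequentially[OF closed_nonneg_Reals_complex _ lim]) auto
  qed
  then show ?thesis using submod by (simp add: Brehmer_submodule_def positive_op_def)
qed

text \<open>Since evaluation on \<open>F\<close> has the kernel functions of \<open>F\<close> as
  adjoint vectors, the space \<open>HF\<close> splits into the closed span of the
  \<open>u i\<close>, on which \<open>V\<close> is isometric onto \<open>S\<close> by equality of
  Gram matrices, and the orthogonal complement, which \<open>V\<close> annihilates.\<close>

lemma Brehmer_imp_multiplier_range:
  assumes pos: "positive_op HS \<Delta>"
  shows "\<exists>F :: (complex^'n \<Rightarrow> 'e) ip_space. hilbert_space F \<and> is_multiplier_range \<Omega> g E HE S F"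
proof -
  \<comment> \<open>The quotient of the kernel of \<open>S\<close> by \<open>g\<close>. Defining it
    through \<open>\<Delta>\<close> lets its quadratic form be read off as that of
    \<open>\<Delta>\<close>.\<close>
  define L where "L = (\<lambda>z w \<eta>. \<Delta> (skernel w \<eta>) z)"
  have L_in: "L z w \<eta> \<in> carr E" if "z \<in> \<Omega>" "w \<in> \<Omega>" "\<eta> \<in> carr E" for z w \<eta>
    using that skernel(1) S_subset value_in by (simp add: L_def)
  have L_ip: "ip E (L z w \<eta>) \<zeta> = ip HE (\<Delta> (skernel w \<eta>)) (skernel z \<zeta>)"
    if "z \<in> \<Omega>" "w \<in> \<Omega>" "\<eta> \<in> carr E" "\<zeta> \<in> carr E" for z w \<eta> \<zeta>
    using skernel(2)[OF that(1,4) Delta_S[OF skernel(1)[OF that(2,3)]]] by (simp add: L_def)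
  have L_ip': "ip E (L z w \<eta>) \<zeta> = ip HE (skernel w \<eta>) (skernel z \<zeta>) / g z w"
    if "z \<in> \<Omega>" "w \<in> \<Omega>" "\<eta> \<in> carr E" "\<zeta> \<in> carr E" for z w \<eta> \<zeta>
    using L_ip[OF that] Delta_skernel_ip[OF that(2,1,3,4)]
      skernel(2)[OF that(1,4) skernel(1)[OF that(2,3)]] by simp
  have "\<exists>F :: (complex^'n \<Rightarrow> 'e) ip_space. hilbert_space F \<and>
     (\<forall>f\<in>carr F. (\<forall>z\<in>\<Omega>. f z \<in> carr E) \<and> (\<forall>z. z \<notin> \<Omega> \<longrightarrow> f z = 0)) \<and>
     (\<forall>z\<in>\<Omega>. \<exists>C. \<forall>f\<in>carr F. hnorm E (f z) \<le> C * hnorm F f) \<and>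
     (\<forall>w\<in>\<Omega>. \<forall>\<eta>\<in>carr E. (\<lambda>z. if z \<in> \<Omega> then L z w \<eta> else 0) \<in> carr F \<and>
        (\<forall>f\<in>carr F. ip F f (\<lambda>z. if z \<in> \<Omega> then L z w \<eta> else 0) = ip E (f w) \<eta>))"
  proof (rule operator_kernel_rkhs_exists[OF E_hilbert L_in])
    fix z w \<eta> \<zeta> assume "z \<in> \<Omega>" "w \<in> \<Omega>" "\<eta> \<in> carr E" "\<zeta> \<in> carr E"
    then show "L z w (\<eta> + \<zeta>) = L z w \<eta> + L z w \<zeta>"
      using D.add[of "skernel w \<eta>" "skernel w \<zeta>"] by (simp add: L_def skernel_add skernel(1))
  next
    fix z w \<eta> c assume "z \<in> \<Omega>" "w \<in> \<Omega>" "\<eta> \<in> carr E"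
    then show "L z w (c *\<^sub>C \<eta>) = c *\<^sub>C L z w \<eta>"
      using D.scale[of "skernel w \<eta>" c] by (simp add: L_def skernel_scale skernel(1) scaleC_fun_def)
  next
    fix z w \<eta> \<zeta> assume a: "z \<in> \<Omega>" "w \<in> \<Omega>" "\<eta> \<in> carr E" "\<zeta> \<in> carr E"
    then have "ip HE (skernel z \<zeta>) (skernel w \<eta>) = cnj (ip HE (skernel w \<eta>) (skernel z \<zeta>))"
      by (intro HE.ip_commute S_subset skernel(1))
    then show "ip E (L w z \<zeta>) \<eta> = cnj (ip E (L z w \<eta>) \<zeta>)"
      unfolding L_ip'[OF a] L_ip'[OF a(2,1,4,3)] g_hermitian[OF a(1,2)] by simp
  next
    fix A and \<phi> :: "complex^'n \<Rightarrow> 'e"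
    assume A: "finite A" "A \<subseteq> \<Omega>" "\<And>w. w \<in> A \<Longrightarrow> \<phi> w \<in> carr E"
    \<comment> \<open>The kernel sum over \<open>A\<close> is the quadratic form of
      \<open>\<Delta>\<close> at this single vector of \<open>S\<close>.\<close>
    define x where "x = (\<Sum>w\<in>A. skernel w (\<phi> w))"
    have k: "skernel w (\<phi> w) \<in> S" if "w \<in> A" for w using that A skernel(1) by blast
    have x: "x \<in> S" using HS.carr_sum[of A "\<lambda>w. skernel w (\<phi> w)"] k by (simp add: x_def)
    have Dx: "\<Delta> x = (\<Sum>w\<in>A. \<Delta> (skernel w (\<phi> w)))"
      unfolding x_def using k by (intro D.sum) simp
    have "ip HE (\<Delta> x) x = (\<Sum>z\<in>A. ip HE (\<Delta> x) (skernel z (\<phi> z)))"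
      using k x by (subst (2) x_def) (intro HE.ip_sum_right S_subset Delta_S, auto)
    also have "\<dots> = (\<Sum>z\<in>A. \<Sum>w\<in>A. ip HE (\<Delta> (skernel w (\<phi> w))) (skernel z (\<phi> z)))"
      unfolding Dx using k by (intro sum.cong refl HE.ip_sum_left S_subset Delta_S) auto
    also have "\<dots> = (\<Sum>z\<in>A. \<Sum>w\<in>A. ip E (L z w (\<phi> w)) (\<phi> z))"
      using A by (intro sum.cong refl L_ip[symmetric]) auto
    finally have eq: "ip HE (\<Delta> x) x = (\<Sum>z\<in>A. \<Sum>w\<in>A. ip E (L z w (\<phi> w)) (\<phi> z))" .
    have "ip HE (\<Delta> x) x \<in> \<real>\<^sub>\<ge>\<^sub>0" using pos x by (simp add: positive_op_def)
    then have "(\<Sum>z\<in>A. \<Sum>w\<in>A. ip E (L z w (\<phi> w)) (\<phi> z)) \<in> \<real>\<^sub>\<ge>\<^sub>0" unfolding eq .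
    then show "0 \<le> Re (\<Sum>z\<in>A. \<Sum>w\<in>A. ip E (L z w (\<phi> w)) (\<phi> z))"
      unfolding complex_nonneg_Reals_iff by (rule conjunct1)
  next
    fix z assume z: "z \<in> \<Omega>"
    \<comment> \<open>The constant is 1 because projecting to \<open>S\<close> does not increase the
      norm: the squared norm of the full kernel function is \<open>g z z\<close> times that of
      \<open>\<eta>\<close>, and dividing by \<open>g z z\<close> cancels this factor.\<close>
    have "Re (ip E (L z z \<eta>) \<eta>) \<le> 1 * (hnorm E \<eta>)\<^sup>2" if \<eta>: "\<eta> \<in> carr E" for \<eta>
    proof -
      let ?k = "skernel z \<eta>" and ?K = "kernel_fun \<Omega> g z \<eta>"
      have k: "?k \<in> S" "?k \<in> carr HE" using skernel(1)[OF z \<eta>] S_subset by auto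
      have K: "?K \<in> carr HE" using kernel_in[OF z \<eta>] .
      have kk: "ip HE ?k ?k = ip HE ?k ?K" using skernel(2)[OF z \<eta> k(1)] kernel_ip[OF z \<eta> k(2)] by simp
      have "cmod (ip HE ?k ?k) = hnorm HE ?k * hnorm HE ?k"
        unfolding HE.ip_self[OF k(2)] norm_of_real abs_power2 by (rule power2_eq_square)
      then have "hnorm HE ?k * hnorm HE ?k \<le> hnorm HE ?k * hnorm HE ?K"
        using HE.Cauchy_Schwarz[OF k(2) K] unfolding kk by (simp only:)
      then have "hnorm HE ?k \<le> hnorm HE ?K" by (rule le_if_mult_self_le) (use K in simp)
      then have le: "(hnorm HE ?k)\<^sup>2 \<le> (hnorm HE ?K)\<^sup>2" using k by (intro power_mono) auto
      have "complex_of_real ((hnorm HE ?K)\<^sup>2) = ip E (?K z) \<eta>"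
        using kernel_ip[OF z \<eta> K] HE.ip_self[OF K] by simp
      also have "\<dots> = g z z * complex_of_real ((hnorm E \<eta>)\<^sup>2)"
        using z \<eta> E.ip_self[OF \<eta>] by (simp add: kernel_fun_def E.ip_scale_left)
      finally have K2: "complex_of_real ((hnorm HE ?K)\<^sup>2) = g z z * complex_of_real ((hnorm E \<eta>)\<^sup>2)" .
      \<comment> \<open>Nonnegativity is the kernel condition for the one-point set; the existence
        of \<open>1 / g z z\<close> excludes zero.\<close>
      obtain r where r: "g z z = complex_of_real r" "r > 0"
      proof -
        have "(\<Sum>u\<in>{z}. \<Sum>w\<in>{z}. cnj 1 * 1 * g u w) \<in> \<real>\<^sub>\<ge>\<^sub>0"
          using scalar_kernel z unfolding scalar_kernel_def
          by (elim conjE allE[of _ "{z}"] allE[of _ "\<lambda>_. 1"]) (simp del: sum.insert)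
        then have "g z z \<in> \<real>\<^sub>\<ge>\<^sub>0" by simp
        then obtain r where r: "g z z = complex_of_real r" "r \<ge> 0" by (auto elim!: nonneg_Reals_cases)
        then show thesis using that g_nonzero[OF z z] by (cases "r = 0") auto
      qed
      have "complex_of_real ((hnorm HE ?K)\<^sup>2) = complex_of_real (r * (hnorm E \<eta>)\<^sup>2)"
        using K2 r(1) by simp
      then have K2: "(hnorm HE ?K)\<^sup>2 = r * (hnorm E \<eta>)\<^sup>2" by (simp only: of_real_eq_iff)
      have "ip E (L z z \<eta>) \<eta> = complex_of_real ((hnorm HE ?k)\<^sup>2 / r)"
        using L_ip'[OF z z \<eta> \<eta>] HE.ip_self[OF k(2)] r(1) by simp
      then show ?thesis using le K2 r(2) by (simp add: divide_le_eq mult.commute)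
    qed
    then show "\<exists>C. \<forall>\<eta>\<in>carr E. Re (ip E (L z z \<eta>) \<eta>) \<le> C * (hnorm E \<eta>)\<^sup>2" by blast
  qed
  then obtain F :: "(complex^'n \<Rightarrow> 'e) ip_space" where F: "hilbert_space F"
    and F_val: "\<forall>f\<in>carr F. (\<forall>z\<in>\<Omega>. f z \<in> carr E) \<and> (\<forall>z. z \<notin> \<Omega> \<longrightarrow> f z = 0)"
    and F_eval: "\<forall>z\<in>\<Omega>. \<exists>C. \<forall>f\<in>carr F. hnorm E (f z) \<le> C * hnorm F f"
    and F_ker: "\<forall>w\<in>\<Omega>. \<forall>\<eta>\<in>carr E. (\<lambda>z. if z \<in> \<Omega> then L z w \<eta> else 0) \<in> carr F \<and>
        (\<forall>f\<in>carr F. ip F f (\<lambda>z. if z \<in> \<Omega> then L z w \<eta> else 0) = ip E (f w) \<eta>)"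
    by (elim exE conjE)
  interpret F: hilbert F by (rule hilbertI[OF F])
  obtain HF where HF: "is_rkhs \<Omega> g F HF"
    using scalar_rkhs_exists[OF F scalar_kernel g_hermitian] by blast
  interpret HF: hilbert HF using HF by (intro hilbertI) (simp add: is_rkhs_def)
  have HF_value: "f z \<in> carr F" if "f \<in> carr HF" "z \<in> \<Omega>" for f z
    using HF that unfolding is_rkhs_def by blast
  have HF_kernel: "kernel_fun \<Omega> g w \<eta> \<in> carr HF" if "w \<in> \<Omega>" "\<eta> \<in> carr F" for w \<eta>
    using HF that unfolding is_rkhs_def by blast
  have HF_ip: "ip HF f (kernel_fun \<Omega> g w \<eta>) = ip F (f w) \<eta>" if "w \<in> \<Omega>" "\<eta> \<in> carr F" "f \<in> carr HF" for w \<eta> f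
    using HF that unfolding is_rkhs_def by blast
  define l where "l = (\<lambda>w \<eta> z. if z \<in> \<Omega> then L z w \<eta> else 0)"
  have l_in: "l w \<eta> \<in> carr F" if "w \<in> \<Omega>" "\<eta> \<in> carr E" for w \<eta>
    using F_ker that unfolding l_def by blast
  have l_ip: "ip F y (l w \<eta>) = ip E (y w) \<eta>" if "w \<in> \<Omega>" "\<eta> \<in> carr E" "y \<in> carr F" for w \<eta> y
    using F_ker that unfolding l_def by blast
  \<comment> \<open>Elements of \<open>HF\<close> take values in \<open>F\<close>, which itself
    consists of functions, so \<open>V f\<close> at \<open>z\<close> is the double evaluation
    \<open>f z z\<close>.\<close>
  define V where "V = mult_op \<Omega> (\<lambda>z (y :: complex^'n \<Rightarrow> 'e). y z)"
  define I where "I = \<Omega> \<times> carr E"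
  define u where "u = (\<lambda>(w, \<eta>). kernel_fun \<Omega> g w (l w \<eta>))"
  define k where "k = (\<lambda>(w, \<eta>). skernel w \<eta>)"
  have u_in: "u i \<in> carr HF" and k_in: "k i \<in> carr HS" if "i \<in> I" for i
    using that HF_kernel l_in skernel(1) by (auto simp: u_def k_def I_def)
  have kI: "k ` I = skernels" by (simp add: k_def I_def)
  have V_value: "V f w \<in> carr E" if "f \<in> carr HF" "w \<in> \<Omega>" for f w
    using F_val HF_value[OF that] that by (simp add: V_def mult_op_apply)
  have u_ip: "ip HF f (u (w, \<eta>)) = ip E (V f w) \<eta>" if "f \<in> carr HF" "w \<in> \<Omega>" "\<eta> \<in> carr E" for f w \<eta>
    using that l_in HF_value by (simp add: u_def HF_ip l_ip V_def mult_op_apply)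
  \<comment> \<open>The kernel of \<open>HF\<close> restores the factor \<open>g z w\<close> that
    was divided out in \<open>L\<close>.\<close>
  have Gram: "ip HF (u i) (u j) = ip HS (k i) (k j)" if ij: "i \<in> I" "j \<in> I" for i j
  proof -
    obtain w \<eta> z \<zeta> where i: "i = (w, \<eta>)" "w \<in> \<Omega>" "\<eta> \<in> carr E" and j: "j = (z, \<zeta>)" "z \<in> \<Omega>" "\<zeta> \<in> carr E"
      using ij by (auto simp: I_def)
    have "ip HF (u i) (u j) = ip E (g z w *\<^sub>C L z w \<eta>) \<zeta>"
      using u_ip[OF u_in[OF ij(1)] j(2,3)] i j
      by (simp add: V_def mult_op_apply u_def kernel_fun_def scaleC_fun_def l_def)
    also have "\<dots> = ip HE (skernel w \<eta>) (skernel z \<zeta>)"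
      using i j L_in g_nonzero by (simp add: E.ip_scale_left L_ip')
    finally show ?thesis by (simp add: i j k_def)
  qed
  \<comment> \<open>Inner products with \<open>u (w, \<eta>)\<close> on one side and with
    \<open>k (w, \<eta>)\<close> on the other are the coordinates of the value at \<open>w\<close>;
    matching them for all \<open>w\<close> and \<open>\<eta>\<close> identifies the
    functions.\<close>
  have V_eqI: "V f = h" if f: "f \<in> carr HF" and h: "h \<in> S"
    and eq: "\<And>i. i \<in> I \<Longrightarrow> ip HE h (k i) = ip HF f (u i)" for f h
  proof
    fix z
    show "V f z = h z"
    proof (cases "z \<in> \<Omega>")
      case True
      show ?thesis
      proof (rule E.eqI_ip)
        show "V f z \<in> carr E" "h z \<in> carr E" using V_value f h True S_subset value_in by auto
        fix \<zeta> assume "\<zeta> \<in> carr E"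
        then show "ip E (V f z) \<zeta> = ip E (h z) \<zeta>"
          using eq[of "(z, \<zeta>)"] True u_ip[OF f True] skernel(2)[OF True _ h] by (simp add: I_def k_def)
      qed
    next
      case False
      then show ?thesis using value_off S_subset h by (simp add: V_def mult_op_apply)
    qed
  qed
  \<comment> \<open>Let \<open>p\<close> be the projection to the closed span of the
    \<open>u i\<close>. Equality of Gram matrices yields a vector of \<open>S\<close> with the norm
    of \<open>p\<close> and the same inner products, and by \<open>V_eqI\<close> it is both
    \<open>V p\<close> and \<open>V f\<close>.\<close>
  have decompose: "\<exists>p. p \<in> carr HF \<and> ip HF (f - p) p = 0 \<and> hnorm HF p \<le> hnorm HF f \<and>
      V f \<in> S \<and> V p = V f \<and> hnorm HE (V f) = hnorm HF p" if f: "f \<in> carr HF" for f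
  proof -
    let ?M = "complex_vector.span (u ` I)"
    have M: "complex_vector.subspace ?M" "?M \<subseteq> carr HF"
      by (rule complex_vector.subspace_span, rule complex_vector.span_minimal[OF _ HF.subspace_carr])
         (use u_in in auto)
    obtain p s where p: "p \<in> carr HF" "\<And>n. s n \<in> ?M" "hconverges HF s p"
      "\<And>m. m \<in> ?M \<Longrightarrow> ip HF (f - p) m = 0"
      using HF.projection_exists[OF M f] by blast
    have sH: "s n \<in> carr HF" for n using p(2) M(2) by blast
    obtain y where y: "y \<in> carr HS" "hnorm HS y = hnorm HF p" "\<And>i. i \<in> I \<Longrightarrow> ip HS y (k i) = ip HF p (u i)"
      using equal_Gram_transfer[OF HF.semi_ip_axioms HS.hilbert_axioms u_in k_in Gram p(2,1,3)] by blast
    have pf: "ip HF p (u i) = ip HF f (u i)" if "i \<in> I" for i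
    proof -
      have "u i \<in> ?M" using that by (intro complex_vector.span_base) blast
      from p(4)[OF this] show ?thesis using HF.ip_diff_left[OF f p(1) u_in[OF that]] by simp
    qed
    have "V f = y" using y pf f by (intro V_eqI) auto
    moreover have "V p = y" using y p(1) by (intro V_eqI) auto
    ultimately show ?thesis
      using HF.projection_norm_le[OF f p(1) sH p(3,4)] p(1,2) y(1,2) by (auto simp: hnorm_HS)
  qed
  have V_add: "V (f + h) = V f + V h" and V_scale: "V (c *\<^sub>C f) = c *\<^sub>C V f" for f h c
    by (auto simp: V_def mult_op_def fun_eq_iff scaleC_fun_def)
  have V_S: "V f \<in> S" if "f \<in> carr HF" for f using decompose[OF that] by blast
  have V_bounded: "bounded_op HF HE V"
  proof (rule bounded_opI[where C = 1])
    show "hnorm HE (V f) \<le> 1 * hnorm HF f" if "f \<in> carr HF" for f using decompose[OF that] by auto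
  qed (use V_S S_subset V_add V_scale in auto)
  have V_isometry: "hnorm HE (V f) = hnorm HF f"
    if f: "f \<in> carr HF" and orth: "\<And>y. y \<in> carr HF \<Longrightarrow> V y = 0 \<Longrightarrow> ip HF f y = 0" for f
  proof -
    obtain p where p: "p \<in> carr HF" "ip HF (f - p) p = 0" "V p = V f" "hnorm HE (V f) = hnorm HF p"
      using decompose[OF f] by blast
    \<comment> \<open>\<open>f - p\<close> lies in the kernel of \<open>V\<close>, to which
      \<open>f\<close> is orthogonal, and it is also orthogonal to \<open>p\<close>; hence it is
      orthogonal to itself.\<close>
    have "V (f - p) = 0" using p(3) V_add[of f "(- 1) *\<^sub>C p"] V_scale[of "- 1" p] by simp
    then have "ip HF f (f - p) = 0" using orth f p(1) by simp
    then have "ip HF (f - p) f = 0" using HF.ip_commute[of f "f - p"] f p(1) by simp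
    then have "ip HF (f - p) (f - p) = 0" using p f by (simp add: HF.ip_diff_right)
    then have "f - p = 0" using HF.ip_eq_0_iff[of "f - p"] f p(1) by simp
    then show ?thesis using p(4) by simp
  qed
  \<comment> \<open>The Gram transfer is now used in the opposite direction, from the dense span of
    the \<open>k i\<close> in \<open>S\<close> back to \<open>HF\<close>.\<close>
  have V_onto: "\<exists>f\<in>carr HF. V f = h" if h: "h \<in> S" for h
  proof -
    obtain s where s: "\<And>n. s n \<in> complex_vector.span (k ` I)" "hconverges HS s h"
      using S_dense_sequence[OF h] unfolding kI by (metis hconverges_def hnorm_HS)
    have hS: "h \<in> carr HS" using h by simp
    obtain y where "y \<in> carr HF" "\<And>i. i \<in> I \<Longrightarrow> ip HF y (u i) = ip HS h (k i)"
      using equal_Gram_transfer[OF HS.semi_ip_axioms HF.hilbert_axioms k_in u_in Gram[symmetric] s(1) hS s(2)]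
      by blast
    then show ?thesis using h by (intro bexI[of _ y] V_eqI) auto
  qed
  have "is_multiplier \<Omega> F HF E HE (\<lambda>z y. y z)"
    unfolding is_multiplier_def
  proof (intro conjI ballI)
    fix z assume z: "z \<in> \<Omega>"
    then obtain C where "\<forall>f\<in>carr F. hnorm E (f z) \<le> C * hnorm F f" using F_eval by blast
    then show "bounded_op F E (\<lambda>y. y z)"
      using F_val z by (intro bounded_opI[where C = C]) (auto simp: scaleC_fun_def)
  qed (use V_S S_subset in \<open>auto simp: V_def\<close>)
  moreover have "partial_isometry HF HE V"
    unfolding partial_isometry_def using V_bounded V_isometry by blast
  moreover have "S = V ` carr HF" using V_S V_onto by blast
  ultimately show ?thesis
    using F HF unfolding is_multiplier_range_def partially_isometric_multiplier_def V_def by blast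
qed

end

text \<open>A formula cannot quantify over all types, so the existence of the coefficient space is
  split: in the equivalence it is found among the functions with values in the type of
  \<open>E\<close>, and the second conjunct admits coefficient spaces in an arbitrary type
  \<open>'f\<close> for the converse.\<close>

theorem theorem7p4:
  fixes \<Omega> :: "(complex^'n) set"
    and g :: "complex^'n \<Rightarrow> complex^'n \<Rightarrow> complex"
    and a :: "nat^'n \<Rightarrow> nat^'n \<Rightarrow> complex"
    and E :: "'e::complex_vector ip_space"
    and HE :: "(complex^'n \<Rightarrow> 'e) ip_space"
    and S :: "(complex^'n \<Rightarrow> 'e) set"
  assumes "bounded_domain \<Omega>"
    and "hilbert_space E"
    and "good_kernel \<Omega> g"
    and "inverse_is_polynomial \<Omega> g a"
    and "is_rkhs \<Omega> g E HE"
    and "submodule HE S"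
  shows "(Brehmer_submodule a HE S \<longleftrightarrow>
           (\<exists>F :: (complex^'n \<Rightarrow> 'e) ip_space. hilbert_space F \<and> is_multiplier_range \<Omega> g E HE S F))
       \<and> (\<forall>F :: 'f::complex_vector ip_space.
           hilbert_space F \<and> is_multiplier_range \<Omega> g E HE S F \<longrightarrow> Brehmer_submodule a HE S)"
proof -
  interpret brehmer_setting \<Omega> g a E HE S
    by (rule brehmer_setting.intro) fact+
  show ?thesis
  proof (intro conjI iffI allI impI)
    assume "Brehmer_submodule a HE S"
    then show "\<exists>F :: (complex^'n \<Rightarrow> 'e) ip_space. hilbert_space F \<and> is_multiplier_range \<Omega> g E HE S F"
      by (intro Brehmer_imp_multiplier_range) (simp add: Brehmer_submodule_def)
  qed (auto intro: multiplier_range_imp_Brehmer)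
qed

end
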